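(* Let $X$ be a smooth manifold of dimension $n$ and let $(\Sigma,\Lambda)$ be a framed isotropic submanifold of $T^*X$, i.e. $\Lambda\subset T^*X$ is a Lagrangian submanifold and $\Sigma\subset\Lambda$ is an (isotropic) submanifold. Then there is a covering of $\Lambda$ by relatively open sets $\Gamma\subset\Lambda$ such that for each $\Gamma$ there exist: (1) open sets $\mathcal V\subset X$ and $S\subset\mathbb R^N$ (for some $N$); (2) a splitting of the variables $S\ni s=(t,u)\in\mathbb R^K\times\mathbb R^l$; (3) a function $f:\mathcal V\times S\to\mathbb R$; such that: (a) $f$ is a non-degenerate phase function parametrizing $\Gamma$; (b) the intersection $C_f\cap\{u=0\}$ is transverse, where $C_f=\{(x,s)\in\mathcal V\times S: d_sf=0\}$; (c) the map $\Phi(x,s)=(x,(d_xf)_{(x,s)})$ maps $C_f\cap\{u=0\}$ onto $\Sigma\cap\Gamma$.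
   Context: A smooth function $f=f(x,s)$ on $\mathcal V\times S$ is a non-degenerate phase function parametrizing a Lagrangian submanifold $\Gamma\subset T^*X$ if (i) zero is a regular value of $(x,s)\mapsto d_sf$, and (ii) the map $\Phi:(x,s)\mapsto(x,(d_xf)_{(x,s)})\in T^*X$ restricts to an embedding of the critical set $C_f=\{d_sf=0\}$ onto $\Gamma$. Convention: one works with germs of framed isotropics, i.e. $(\Sigma,\Lambda)$ and $(\Sigma,\Lambda')$ are not distinguished if $\Lambda\cap\Lambda'$ contains a relatively open set in each (so $\Lambda$ may be shrunk to a neighborhood of $\Sigma$). *)

theory Defs
  imports "HOL-Analysis.Analysis"
begin

section \<open>Smooth maps between Euclidean spaces\<close>

text \<open>For an open set \<open>S\<close>, the predicate \<open>Ck_on k S f\<close> says that \<open>f\<close> is \<open>k\<close> times continuously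
  differentiable on \<open>S\<close>.\<close>

primrec Ck_on :: "nat \<Rightarrow> 'v::real_normed_vector set \<Rightarrow> ('v \<Rightarrow> 'w::real_normed_vector) \<Rightarrow> bool"
  where
    "Ck_on 0 S f \<longleftrightarrow> continuous_on S f"
  | "Ck_on (Suc k) S f \<longleftrightarrow> (\<forall>x\<in>S. f differentiable (at x)) \<and>
       (\<forall>v. Ck_on k S (\<lambda>x. frechet_derivative f (at x) v))"

definition smooth_on :: "'v::real_normed_vector set \<Rightarrow> ('v \<Rightarrow> 'w::real_normed_vector) \<Rightarrow> bool"
  where "smooth_on S f \<longleftrightarrow> (\<forall>k. Ck_on k S f)"


section \<open>Smooth manifolds\<close>

text \<open>A chart is a pair of its domain and its coordinate map; values of the coordinate map outside
  the domain are irrelevant. The dimension of the manifold is that of the model space \<open>'e\<close>.\<close>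

type_synonym ('a, 'e) chart = "'a set \<times> ('a \<Rightarrow> 'e)"

definition chart_inv :: "('a, 'e) chart \<Rightarrow> 'e \<Rightarrow> 'a"
  where "chart_inv c = inv_into (fst c) (snd c)"

definition is_chart :: "'a topology \<Rightarrow> ('a, 'e::euclidean_space) chart \<Rightarrow> bool"
  where "is_chart X c \<longleftrightarrow> openin X (fst c) \<and> open (snd c ` fst c) \<and>
     homeomorphic_map (subtopology X (fst c)) (top_of_set (snd c ` fst c)) (snd c)"

definition compatible :: "('a, 'e::euclidean_space) chart \<Rightarrow> ('a, 'e) chart \<Rightarrow> bool"
  where "compatible c d \<longleftrightarrow>
     smooth_on (snd c ` (fst c \<inter> fst d)) (snd d \<circ> chart_inv c) \<and>
     smooth_on (snd d ` (fst c \<inter> fst d)) (snd c \<circ> chart_inv d)"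

definition smooth_manifold :: "'a topology \<Rightarrow> ('a, 'e::euclidean_space) chart set \<Rightarrow> bool"
  where "smooth_manifold X A \<longleftrightarrow> Hausdorff_space X \<and> second_countable X \<and>
     topspace X = (\<Union>c\<in>A. fst c) \<and> (\<forall>c\<in>A. is_chart X c) \<and> (\<forall>c\<in>A. \<forall>d\<in>A. compatible c d)"

definition maximal_atlas ::
    "'a topology \<Rightarrow> ('a, 'e::euclidean_space) chart set \<Rightarrow> ('a, 'e) chart set"
  where "maximal_atlas X A = {c. is_chart X c \<and> (\<forall>d\<in>A. compatible c d)}"

text \<open>Submanifolds are embedded (locally a slice in a suitable chart), but need not be closed.\<close>

definition submanifold ::
    "'a topology \<Rightarrow> ('a, 'e::euclidean_space) chart set \<Rightarrow> nat \<Rightarrow> 'a set \<Rightarrow> bool"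
  where "submanifold X A k M \<longleftrightarrow> M \<subseteq> topspace X \<and>
     (\<forall>p\<in>M. \<exists>c\<in>maximal_atlas X A. \<exists>L. p \<in> fst c \<and> subspace L \<and> dim L = k \<and>
        snd c ` (M \<inter> fst c) = snd c ` fst c \<inter> L)"

text \<open>The tangent vectors at \<open>p\<close> to \<open>M\<close>, in the coordinates of the chart \<open>c\<close>: the velocities of
  smooth curves in \<open>M\<close>. For a submanifold \<open>M\<close> this is the tangent space.\<close>

definition tangent_vectors ::
    "('a, 'e::euclidean_space) chart \<Rightarrow> 'a set \<Rightarrow> 'a \<Rightarrow> 'e set"
  where "tangent_vectors c M p =
     {v. \<exists>(\<gamma> :: real \<Rightarrow> 'a) \<epsilon>. \<epsilon> > 0 \<and> \<gamma> 0 = p \<and> (\<forall>t\<in>{-\<epsilon><..<\<epsilon>}. \<gamma> t \<in> M \<inter> fst c) \<and>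
        smooth_on {-\<epsilon><..<\<epsilon>} (snd c \<circ> \<gamma>) \<and> ((snd c \<circ> \<gamma>) has_vector_derivative v) (at 0)}"


section \<open>The cotangent bundle and its symplectic geometry\<close>

text \<open>A covector at \<open>p\<close> is the family of its coordinate representations in the charts around \<open>p\<close>,
  subject to the transformation law of covectors; the representation \<open>\<xi> c\<close> in the chart \<open>c\<close> is
  the vector that represents the covector through the inner product of the model space. At charts
  that are not around \<open>p\<close> the family is set to 0.\<close>

definition cotangent_space ::
    "('a, 'e::euclidean_space) chart set \<Rightarrow> 'a \<Rightarrow> (('a, 'e) chart \<Rightarrow> 'e) set"
  where "cotangent_space A p =
     {\<xi>. (\<forall>c. \<not> (c \<in> A \<and> p \<in> fst c) \<longrightarrow> \<xi> c = 0) \<and>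
         (\<forall>c\<in>A. \<forall>d\<in>A. p \<in> fst c \<inter> fst d \<longrightarrow>
            (\<forall>v. \<xi> c \<bullet> v = \<xi> d \<bullet> frechet_derivative (snd d \<circ> chart_inv c) (at (snd c p)) v))}"

type_synonym ('a, 'e) covector = "'a \<times> (('a, 'e) chart \<Rightarrow> 'e)"

definition cotangent_bundle ::
    "'a topology \<Rightarrow> ('a, 'e::euclidean_space) chart set \<Rightarrow> ('a, 'e) covector set"
  where "cotangent_bundle X A = Sigma (topspace X) (cotangent_space A)"

definition cotangent_chart :: "'a topology \<Rightarrow> ('a, 'e::euclidean_space) chart set \<Rightarrow>
    ('a, 'e) chart \<Rightarrow> (('a, 'e) covector, 'e \<times> 'e) chart"
  where "cotangent_chart X A c =
     ({z \<in> cotangent_bundle X A. fst z \<in> fst c}, \<lambda>z. (snd c (fst z), snd z c))"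

definition cotangent_atlas :: "'a topology \<Rightarrow> ('a, 'e::euclidean_space) chart set \<Rightarrow>
    (('a, 'e) covector, 'e \<times> 'e) chart set"
  where "cotangent_atlas X A = cotangent_chart X A ` A"

definition cotangent_topology ::
    "'a topology \<Rightarrow> ('a, 'e::euclidean_space) chart set \<Rightarrow> ('a, 'e) covector topology"
  where "cotangent_topology X A = topology_generated_by
     {{z \<in> fst C. snd C z \<in> W} | C W. C \<in> cotangent_atlas X A \<and> open W}"

text \<open>The form \<open>d\<xi> \<and> dx\<close> in the coordinates \<open>(x, \<xi>)\<close> of a cotangent chart.\<close>

definition symplectic_form :: "'e::euclidean_space \<times> 'e \<Rightarrow> 'e \<times> 'e \<Rightarrow> real"
  where "symplectic_form v w = snd v \<bullet> fst w - fst v \<bullet> snd w"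

definition lagrangian_submanifold ::
    "'a topology \<Rightarrow> ('a, 'e::euclidean_space) chart set \<Rightarrow> ('a, 'e) covector set \<Rightarrow> bool"
  where "lagrangian_submanifold X A \<Lambda> \<longleftrightarrow>
     submanifold (cotangent_topology X A) (cotangent_atlas X A) DIM('e) \<Lambda> \<and>
     (\<forall>z\<in>\<Lambda>. \<forall>C\<in>cotangent_atlas X A. z \<in> fst C \<longrightarrow>
        (\<forall>v\<in>tangent_vectors C \<Lambda> z. \<forall>w\<in>tangent_vectors C \<Lambda> z. symplectic_form v w = 0))"

text \<open>That \<open>\<Sigma>\<close> is isotropic follows from \<open>\<Sigma> \<subseteq> \<Lambda>\<close>. For subsets of the embedded \<open>\<Lambda>\<close>, being a
  submanifold of \<open>\<Lambda>\<close> and being one of the cotangent bundle is the same. A framed isotropic is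
  regarded as a germ: \<open>\<Lambda>\<close> may be replaced by a relatively open \<open>\<Lambda>' \<supseteq> \<Sigma>\<close>. Shrinking is necessary when
  \<open>\<Sigma>\<close> is not relatively closed in \<open>\<Lambda>\<close>.\<close>

definition framed_isotropic :: "'a topology \<Rightarrow> ('a, 'e::euclidean_space) chart set \<Rightarrow>
    ('a, 'e) covector set \<Rightarrow> ('a, 'e) covector set \<Rightarrow> bool"
  where "framed_isotropic X A \<Sigma> \<Lambda> \<longleftrightarrow> lagrangian_submanifold X A \<Lambda> \<and> \<Sigma> \<subseteq> \<Lambda> \<and>
     (\<exists>k. submanifold (cotangent_topology X A) (cotangent_atlas X A) k \<Sigma>)"


section \<open>Calculus on open subsets of $X \times \mathbf{R}^N$\<close>

text \<open>As \<open>N\<close> is existentially quantified, $\mathbf{R}^N$ is the carrier of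
  \<^term>\<open>Euclidean_space N\<close>, that is, the sequences vanishing from index \<open>N\<close> on. Sequences carry no
  norm, so derivatives are taken along lines: \<open>dir_deriv g z d\<close> is the derivative of \<open>g\<close> at \<open>z\<close>
  in direction \<open>d\<close>, and \<open>Ck_on_param\<close> asks for existence and continuity of all iterated
  directional derivatives up to order \<open>k\<close> on a relatively open \<open>W\<close>.\<close>

definition line :: "'e::real_vector \<times> (nat \<Rightarrow> real) \<Rightarrow> 'e \<times> (nat \<Rightarrow> real) \<Rightarrow> real \<Rightarrow>
    'e \<times> (nat \<Rightarrow> real)"
  where "line z d t = (fst z + t *\<^sub>R fst d, \<lambda>j. snd z j + t * snd d j)"

definition dir_deriv :: "('e::real_vector \<times> (nat \<Rightarrow> real) \<Rightarrow> 'w::real_normed_vector) \<Rightarrow>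
    'e \<times> (nat \<Rightarrow> real) \<Rightarrow> 'e \<times> (nat \<Rightarrow> real) \<Rightarrow> 'w"
  where "dir_deriv g z d = vector_derivative (\<lambda>t. g (line z d t)) (at 0)"

primrec Ck_on_param :: "nat \<Rightarrow> nat \<Rightarrow> ('e::euclidean_space \<times> (nat \<Rightarrow> real)) set \<Rightarrow>
    ('e \<times> (nat \<Rightarrow> real) \<Rightarrow> 'w::real_normed_vector) \<Rightarrow> bool"
  where
    "Ck_on_param N 0 W g \<longleftrightarrow> continuous_on W g"
  | "Ck_on_param N (Suc k) W g \<longleftrightarrow> continuous_on W g \<and>
       (\<forall>d \<in> UNIV \<times> topspace (Euclidean_space N).
          (\<forall>z\<in>W. (\<lambda>t. g (line z d t)) differentiable (at 0)) \<and>
          Ck_on_param N k W (\<lambda>z. dir_deriv g z d))"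

definition smooth_on_param :: "nat \<Rightarrow> ('e::euclidean_space \<times> (nat \<Rightarrow> real)) set \<Rightarrow>
    ('e \<times> (nat \<Rightarrow> real) \<Rightarrow> 'w::real_normed_vector) \<Rightarrow> bool"
  where "smooth_on_param N W g \<longleftrightarrow> (\<forall>k. Ck_on_param N k W g)"

text \<open>The expression of a function on $X \times \mathbf{R}^N$, respectively of a point and of a
  set, in the coordinates given by a chart \<open>c\<close> of \<open>X\<close> and the identity of $\mathbf{R}^N$.\<close>

definition in_chart :: "('a, 'e) chart \<Rightarrow> ('a \<times> (nat \<Rightarrow> real) \<Rightarrow> 'w) \<Rightarrow> 'e \<times> (nat \<Rightarrow> real) \<Rightarrow> 'w"
  where "in_chart c g = (\<lambda>(y, s). g (chart_inv c y, s))"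

definition pt_in_chart :: "('a, 'e) chart \<Rightarrow> 'a \<times> (nat \<Rightarrow> real) \<Rightarrow> 'e \<times> (nat \<Rightarrow> real)"
  where "pt_in_chart c z = (snd c (fst z), snd z)"

definition dom_in_chart ::
    "('a, 'e) chart \<Rightarrow> 'a set \<Rightarrow> (nat \<Rightarrow> real) set \<Rightarrow> ('e \<times> (nat \<Rightarrow> real)) set"
  where "dom_in_chart c V S = snd c ` (fst c \<inter> V) \<times> S"

definition smooth_function :: "('a, 'e::euclidean_space) chart set \<Rightarrow> nat \<Rightarrow> 'a set \<Rightarrow>
    (nat \<Rightarrow> real) set \<Rightarrow> ('a \<times> (nat \<Rightarrow> real) \<Rightarrow> real) \<Rightarrow> bool"
  where "smooth_function A N V S f \<longleftrightarrow>
     (\<forall>c\<in>A. smooth_on_param N (dom_in_chart c V S) (in_chart c f))"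

definition tangent_vectors_param :: "('a, 'e::euclidean_space) chart \<Rightarrow>
    ('a \<times> (nat \<Rightarrow> real)) set \<Rightarrow> 'a \<times> (nat \<Rightarrow> real) \<Rightarrow> ('e \<times> (nat \<Rightarrow> real)) set"
  where "tangent_vectors_param c M p =
     {d. \<exists>(\<gamma> :: real \<Rightarrow> 'a) (\<sigma> :: real \<Rightarrow> nat \<Rightarrow> real) \<epsilon>. \<epsilon> > 0 \<and> (\<gamma> 0, \<sigma> 0) = p \<and>
        (\<forall>t\<in>{-\<epsilon><..<\<epsilon>}. \<gamma> t \<in> fst c \<and> (\<gamma> t, \<sigma> t) \<in> M) \<and>
        smooth_on {-\<epsilon><..<\<epsilon>} (snd c \<circ> \<gamma>) \<and>
        ((snd c \<circ> \<gamma>) has_vector_derivative fst d) (at 0) \<and>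
        (\<forall>j. smooth_on {-\<epsilon><..<\<epsilon>} (\<lambda>t. \<sigma> t j) \<and>
             ((\<lambda>t. \<sigma> t j) has_vector_derivative snd d j) (at 0))}"

text \<open>\<open>F\<close> takes values in $\mathbf{R}^N$ here: \<open>y\<close> is a regular value if the differential of \<open>F\<close> is
  onto $\mathbf{R}^N$ at every preimage of \<open>y\<close>.\<close>

definition regular_value :: "('a, 'e::euclidean_space) chart set \<Rightarrow> nat \<Rightarrow> 'a set \<Rightarrow>
    (nat \<Rightarrow> real) set \<Rightarrow> ('a \<times> (nat \<Rightarrow> real) \<Rightarrow> nat \<Rightarrow> real) \<Rightarrow> (nat \<Rightarrow> real) \<Rightarrow> bool"
  where "regular_value A N V S F y \<longleftrightarrow>
     (\<forall>z\<in>V \<times> S. F z = y \<longrightarrow> (\<forall>c\<in>A. fst z \<in> fst c \<longrightarrow>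
        (\<forall>\<eta>\<in>topspace (Euclidean_space N). \<exists>d\<in>UNIV \<times> topspace (Euclidean_space N).
           \<forall>j<N. dir_deriv (in_chart c (\<lambda>z. F z j)) (pt_in_chart c z) d = \<eta> j)))"

text \<open>Transversality of submanifolds of \<open>V \<times> S\<close>: at common points the two tangent spaces
  together span the whole tangent space.\<close>

definition transverse :: "('a, 'e::euclidean_space) chart set \<Rightarrow> nat \<Rightarrow>
    ('a \<times> (nat \<Rightarrow> real)) set \<Rightarrow> ('a \<times> (nat \<Rightarrow> real)) set \<Rightarrow> bool"
  where "transverse A N M M' \<longleftrightarrow>
     (\<forall>z\<in>M \<inter> M'. \<forall>c\<in>A. fst z \<in> fst c \<longrightarrow>
        (\<forall>d\<in>UNIV \<times> topspace (Euclidean_space N).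
           \<exists>a\<in>tangent_vectors_param c M z. \<exists>b\<in>tangent_vectors_param c M' z.
             fst d = fst a + fst b \<and> (\<forall>j. snd d j = snd a j + snd b j)))"


section \<open>Phase functions\<close>

definition differential ::
    "('a, 'e::euclidean_space) chart set \<Rightarrow> ('a \<Rightarrow> real) \<Rightarrow> 'a \<Rightarrow> ('a, 'e) chart \<Rightarrow> 'e"
  where "differential A g p = (\<lambda>c. if c \<in> A \<and> p \<in> fst c
     then \<Sum>b\<in>Basis. frechet_derivative (g \<circ> chart_inv c) (at (snd c p)) b *\<^sub>R b else 0)"

definition d_s :: "nat \<Rightarrow> ('a \<times> (nat \<Rightarrow> real) \<Rightarrow> real) \<Rightarrow> 'a \<times> (nat \<Rightarrow> real) \<Rightarrow> nat \<Rightarrow> real"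
  where "d_s N f = (\<lambda>(x, s) j. if j < N then deriv (\<lambda>t. f (x, s(j := t))) (s j) else 0)"

definition critical_set :: "nat \<Rightarrow> 'a set \<Rightarrow> (nat \<Rightarrow> real) set \<Rightarrow>
    ('a \<times> (nat \<Rightarrow> real) \<Rightarrow> real) \<Rightarrow> ('a \<times> (nat \<Rightarrow> real)) set"
  where "critical_set N V S f = {z \<in> V \<times> S. d_s N f z = (\<lambda>j. 0)}"

definition phase_map :: "('a, 'e::euclidean_space) chart set \<Rightarrow>
    ('a \<times> (nat \<Rightarrow> real) \<Rightarrow> real) \<Rightarrow> 'a \<times> (nat \<Rightarrow> real) \<Rightarrow> ('a, 'e) covector"
  where "phase_map A f = (\<lambda>(x, s). (x, differential A (\<lambda>y. f (y, s)) x))"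

text \<open>The restriction to \<open>C\<close> of a map \<open>F\<close> from \<open>V \<times> S\<close> to the cotangent bundle is an embedding
  onto \<open>\<Gamma>\<close>: smooth, injective on tangent spaces of \<open>C\<close>, and a homeomorphism onto \<open>\<Gamma>\<close>. This is only
  used for \<open>F\<close> lying over the projection to \<open>X\<close>, so it is enough to use a chart of \<open>X\<close> and the
  cotangent chart that it induces.\<close>

definition embedding_onto :: "'a topology \<Rightarrow> ('a, 'e::euclidean_space) chart set \<Rightarrow> nat \<Rightarrow>
    'a set \<Rightarrow> (nat \<Rightarrow> real) set \<Rightarrow> ('a \<times> (nat \<Rightarrow> real)) set \<Rightarrow>
    ('a \<times> (nat \<Rightarrow> real) \<Rightarrow> ('a, 'e) covector) \<Rightarrow> ('a, 'e) covector set \<Rightarrow> bool"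
  where "embedding_onto X A N V S C F \<Gamma> \<longleftrightarrow>
     (\<forall>c\<in>A. let G = snd (cotangent_chart X A c) \<circ> in_chart c F in
        smooth_on_param N (dom_in_chart c V S) G \<and>
        (\<forall>z\<in>C. fst z \<in> fst c \<longrightarrow> (\<forall>d\<in>tangent_vectors_param c C z.
           dir_deriv G (pt_in_chart c z) d = 0 \<longrightarrow> d = (0, \<lambda>j. 0)))) \<and>
     homeomorphic_map (subtopology (prod_topology X (Euclidean_space N)) C)
       (subtopology (cotangent_topology X A) \<Gamma>) F"

definition nondegenerate_phase_function :: "'a topology \<Rightarrow> ('a, 'e::euclidean_space) chart set \<Rightarrow>
    nat \<Rightarrow> 'a set \<Rightarrow> (nat \<Rightarrow> real) set \<Rightarrow> ('a \<times> (nat \<Rightarrow> real) \<Rightarrow> real) \<Rightarrow>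
    ('a, 'e) covector set \<Rightarrow> bool"
  where "nondegenerate_phase_function X A N V S f \<Gamma> \<longleftrightarrow>
     smooth_function A N V S f \<and>
     regular_value A N V S (d_s N f) (\<lambda>j. 0) \<and>
     embedding_onto X A N V S (critical_set N V S f) (phase_map A f) \<Gamma>"

text \<open>In the splitting \<open>s = (t, u)\<close> of $\mathbf{R}^{K+l}$, the component \<open>t\<close> consists of the
  first \<open>K\<close> coordinates and \<open>u\<close> of the last \<open>l\<close>. This is the set \<open>u = 0\<close>.\<close>

definition u_zero_set ::
    "nat \<Rightarrow> nat \<Rightarrow> 'a set \<Rightarrow> (nat \<Rightarrow> real) set \<Rightarrow> ('a \<times> (nat \<Rightarrow> real)) set"
  where "u_zero_set K l V S = {z \<in> V \<times> S. \<forall>j. K \<le> j \<and> j < K + l \<longrightarrow> snd z j = 0}"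

end

theory Submission
  imports Defs
begin

text \<open>In the coordinates \<open>(x, \<xi>)\<close> of a cotangent chart, a Lagrangian plane is transverse to
  \<open>\<xi> = s x\<close> for some real \<open>s\<close>. So near a given point \<open>z = \<xi> - s x\<close> is a coordinate on \<open>\<Lambda>\<close>, and \<open>\<Lambda>\<close>
  is the graph of \<open>x = a(z)\<close>; being Lagrangian means that the derivative of \<open>a\<close> is symmetric, hence
  \<open>a\<close> is the gradient of some \<open>h\<close>. Choose functions \<open>\<psi>\<^sub>i\<close> of \<open>z\<close> with independent differentials that cut out \<open>\<Sigma>\<close> in \<open>\<Lambda>\<close>.
  With fibre variables \<open>(z, u)\<close>, the phase function
  \<open>s |x|\<^sup>2 / 2 + x \<bullet> z - h(z) + |u - \<psi>(z)|\<^sup>2 / 2\<close> has the critical set \<open>x = a(z), u = \<psi>(z)\<close>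
  and the fibre-wise differential \<open>\<xi> = s x + z\<close>.\<close>

section \<open>Calculus of smooth maps\<close>

text \<open>The quadratic term of the phase shears the fibres by \<open>s x\<close>, and for a slope
  \<open>s\<close> adapted to the tangent plane at the given point the sheared projection to
  \<open>z\<close> is a local diffeomorphism. Hence any chart of the atlas around the base point
  serves, always with n variables \<open>z\<close>, and neither mixed coordinates nor special charts
  of \<open>X\<close> occur. A second obstacle is \<open>\<Sigma>\<close>: it is a slice in a chart
  of the cotangent bundle that need not straighten \<open>\<Lambda>\<close>. The map
  \<open>\<psi>\<close> is made from that chart by composing with a linear map that is invertible on
  the tangent space of \<open>\<Lambda>\<close>. On the critical set \<open>u\<close> equals
  \<open>\<psi>(z)\<close>, so meeting \<open>u = 0\<close> transversally comes down to surjectivity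
  of the derivative of \<open>\<psi>\<close> along \<open>\<Sigma>\<close>. Near a point with a
  neighbourhood free of \<open>\<Sigma>\<close>, if it lies outside \<open>\<Sigma>\<close>, one
  takes a single \<open>u\<close> and a constant nonzero equation, which makes the intersection
  empty.\<close>

lemma frechet_derivative_eq:
  assumes "(f has_derivative f') (at x)"
  shows "frechet_derivative f (at x) = f'"
  using frechet_derivative_at[OF assms] by simp

lemma frechet_derivative_cong_open:
  assumes "open S" "x \<in> S" "\<And>y. y \<in> S \<Longrightarrow> f y = g y"
  shows "frechet_derivative f (at x) = frechet_derivative g (at x)"
    and "f differentiable (at x) \<longleftrightarrow> g differentiable (at x)"
proof -
  have *: "(f has_derivative D) (at x) \<longleftrightarrow> (g has_derivative D) (at x)" for D
    using has_derivative_transform_within_open[of f D x UNIV S g]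
      has_derivative_transform_within_open[of g D x UNIV S f] assms by metis
  then show "frechet_derivative f (at x) = frechet_derivative g (at x)"
    by (simp add: frechet_derivative_def)
  show "f differentiable (at x) \<longleftrightarrow> g differentiable (at x)"
    using * by (simp add: differentiable_def)
qed

section \<open>Closure properties of maps of class C^k\<close>

lemma Ck_on_cong:
  assumes "open S" "\<And>x. x \<in> S \<Longrightarrow> f x = g x"
  shows "Ck_on k S f \<longleftrightarrow> Ck_on k S g"
  using assms(2)
proof (induction k arbitrary: f g)
  case 0
  then show ?case by (simp cong: continuous_on_cong)
next
  case (Suc k)
  have "frechet_derivative f (at x) = frechet_derivative g (at x)"
    "f differentiable (at x) \<longleftrightarrow> g differentiable (at x)" if "x \<in> S" for x
    using frechet_derivative_cong_open[OF assms(1) that Suc.prems] by auto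
  then show ?case
    using Suc.IH[of "\<lambda>x. frechet_derivative f (at x) v" "\<lambda>x. frechet_derivative g (at x) v" for v] by auto
qed

lemma Ck_on_subset: "Ck_on k S f \<Longrightarrow> T \<subseteq> S \<Longrightarrow> Ck_on k T f"
  by (induction k arbitrary: f) (auto intro: continuous_on_subset)

lemma Ck_on_continuous: "Ck_on k S f \<Longrightarrow> continuous_on S f"
  by (cases k) (auto intro!: differentiable_imp_continuous_on differentiable_at_imp_differentiable_on)

lemma Ck_on_SucD: "Ck_on (Suc k) S f \<Longrightarrow> Ck_on k S f"
proof (induction k arbitrary: f)
  case 0
  then show ?case using Ck_on_continuous[OF 0] by simp
next
  case (Suc k)
  have *: "\<forall>x\<in>S. f differentiable at x" "\<forall>v. Ck_on (Suc k) S (\<lambda>x. frechet_derivative f (at x) v)"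
    using Suc.prems unfolding Ck_on.simps(2)[of "Suc k"] by blast+
  have "Ck_on k S (\<lambda>x. frechet_derivative f (at x) v)" for v
    using *(2) by (intro Suc.IH) blast
  then show ?case using * unfolding Ck_on.simps(2)[of k] by blast
qed

lemma Ck_on_has_derivative:
  "Ck_on (Suc k) S f \<Longrightarrow> x \<in> S \<Longrightarrow> (f has_derivative frechet_derivative f (at x)) (at x)"
  by (simp add: frechet_derivative_works[symmetric])

lemma Ck_on_SucI:
  assumes "open S" "\<And>x. x \<in> S \<Longrightarrow> (f has_derivative f' x) (at x)"
    and "\<And>v. Ck_on k S (\<lambda>x. f' x v)"
  shows "Ck_on (Suc k) S f"
proof -
  have "frechet_derivative f (at x) = f' x" if "x \<in> S" for x
    using assms(2)[OF that] by (rule frechet_derivative_eq)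
  then show ?thesis
    using assms Ck_on_cong[OF assms(1), of "\<lambda>x. frechet_derivative f (at x) v" "\<lambda>x. f' x v" k for v]
    by (auto simp: differentiable_def)
qed

lemma Ck_on_const: "Ck_on k S (\<lambda>x. c)"
  by (induction k arbitrary: c) (auto simp: frechet_derivative_const)

lemma Ck_on_bounded_linear_compose:
  assumes "bounded_linear L" "open S" "Ck_on k S f"
  shows "Ck_on k S (\<lambda>x. L (f x))"
  using assms(3)
proof (induction k arbitrary: f)
  case 0
  then show ?case
    using bounded_linear.continuous_on[OF assms(1)] by auto
next
  case (Suc k)
  show ?case
  proof (rule Ck_on_SucI[OF assms(2)])
    show "((\<lambda>x. L (f x)) has_derivative (\<lambda>v. L (frechet_derivative f (at x) v))) (at x)" if "x \<in> S" for x
      using bounded_linear.has_derivative[OF assms(1) Ck_on_has_derivative[OF Suc.prems that]] .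
    show "Ck_on k S (\<lambda>x. L (frechet_derivative f (at x) v))" for v
      using Suc.prems by (intro Suc.IH) (simp add: Ck_on.simps(2)[of k])
  qed
qed

lemma Ck_on_id: "open S \<Longrightarrow> Ck_on k S (\<lambda>x. x)"
  by (cases k) (auto intro: Ck_on_SucI[where f' = "\<lambda>_ v. v"] Ck_on_const)

lemma Ck_on_bounded_linear: "bounded_linear L \<Longrightarrow> open S \<Longrightarrow> Ck_on k S L"
  using Ck_on_bounded_linear_compose[of L S k "\<lambda>x. x"] Ck_on_id by auto

lemma Ck_on_add:
  assumes "open S" "Ck_on k S f" "Ck_on k S g"
  shows "Ck_on k S (\<lambda>x. f x + g x)"
  using assms(2,3)
proof (induction k arbitrary: f g)
  case 0
  then show ?case by (simp add: continuous_on_add)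
next
  case (Suc k)
  show ?case
  proof (rule Ck_on_SucI[OF assms(1)])
    show "((\<lambda>x. f x + g x) has_derivative
      (\<lambda>v. frechet_derivative f (at x) v + frechet_derivative g (at x) v)) (at x)" if "x \<in> S" for x
      using Ck_on_has_derivative[OF Suc.prems(1) that] Ck_on_has_derivative[OF Suc.prems(2) that]
      by (rule has_derivative_add)
    show "Ck_on k S (\<lambda>x. frechet_derivative f (at x) v + frechet_derivative g (at x) v)" for v
      using Suc.prems by (intro Suc.IH) (simp_all add: Ck_on.simps(2)[of k])
  qed
qed

lemma Ck_on_sum:
  assumes "open S" "\<And>i. i \<in> I \<Longrightarrow> Ck_on k S (f i)"
  shows "Ck_on k S (\<lambda>x. \<Sum>i\<in>I. f i x)"
  using assms(2)
proof (induction I rule: infinite_finite_induct)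
  case (insert i I)
  then have "Ck_on k S (\<lambda>x. f i x + (\<Sum>i\<in>I. f i x))" by (intro Ck_on_add assms(1)) auto
  then show ?case using insert by simp
qed (simp_all add: Ck_on_const)

lemma Ck_on_bilinear:
  assumes "bounded_bilinear B" "open S" "Ck_on k S f" "Ck_on k S g"
  shows "Ck_on k S (\<lambda>x. B (f x) (g x))"
  using assms(3,4)
proof (induction k arbitrary: f g)
  case 0
  then show ?case using bounded_bilinear.continuous_on[OF assms(1)] by auto
next
  case (Suc k)
  show ?case
  proof (rule Ck_on_SucI[OF assms(2)])
    show "((\<lambda>x. B (f x) (g x)) has_derivative
      (\<lambda>v. B (f x) (frechet_derivative g (at x) v) + B (frechet_derivative f (at x) v) (g x))) (at x)"
      if "x \<in> S" for x
      using bounded_bilinear.FDERIV[OF assms(1) Ck_on_has_derivative[OF Suc.prems(1) that]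
          Ck_on_has_derivative[OF Suc.prems(2) that]] .
    show "Ck_on k S (\<lambda>x. B (f x) (frechet_derivative g (at x) v) +
        B (frechet_derivative f (at x) v) (g x))" for v
      using Suc.prems Ck_on_SucD[OF Suc.prems(1)] Ck_on_SucD[OF Suc.prems(2)]
      by (intro Ck_on_add assms Suc.IH) auto
  qed
qed

text \<open>\<open>Ck_on\<close> speaks of derivatives in fixed directions only. Where a direction
  depends on the base point, this expansion trades it for fixed basis directions with varying
  coefficients.\<close>

lemma linear_euclidean_expand:
  fixes L :: "'w::euclidean_space \<Rightarrow> 'u::real_vector"
  assumes "linear L"
  shows "L v = (\<Sum>b\<in>Basis. (v \<bullet> b) *\<^sub>R L b)"
proof -
  have "L v = L (\<Sum>b\<in>Basis. (v \<bullet> b) *\<^sub>R b)" by (simp add: euclidean_representation)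
  also have "\<dots> = (\<Sum>b\<in>Basis. (v \<bullet> b) *\<^sub>R L b)"
    by (simp add: linear_sum[OF assms] linear_cmul[OF assms])
  finally show ?thesis .
qed

text \<open>By the chain rule \<open>g\<close> is differentiated in the direction
  \<open>frechet_derivative f (at x) v\<close>, which moves with \<open>x\<close>; hence the basis
  expansion and the Euclidean middle space. In the induction \<open>f\<close> stays fixed and
  \<open>g\<close> is replaced by its derivatives.\<close>

lemma Ck_on_compose:
  fixes f :: "'v::real_normed_vector \<Rightarrow> 'w::euclidean_space" and g :: "'w \<Rightarrow> 'u::real_normed_vector"
  assumes "open S" "Ck_on k S f" "Ck_on k T g" "f ` S \<subseteq> T"
  shows "Ck_on k S (\<lambda>x. g (f x))"
  using assms(2,3)
proof (induction k arbitrary: g)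
  case 0
  then show ?case using assms(4) by (auto intro: continuous_on_compose2)
next
  case (Suc k)
  show ?case
  proof (rule Ck_on_SucI[OF assms(1)])
    fix x assume x: "x \<in> S"
    then have fx: "f x \<in> T" using assms(4) by auto
    have "((\<lambda>x. g (f x)) has_derivative
        (\<lambda>v. frechet_derivative g (at (f x)) (frechet_derivative f (at x) v))) (at x)"
      using Ck_on_has_derivative[OF Suc.prems(1) x] Ck_on_has_derivative[OF Suc.prems(2) fx]
      by (rule has_derivative_compose)
    moreover have "linear (frechet_derivative g (at (f x)))"
      using Ck_on_has_derivative[OF Suc.prems(2) fx] has_derivative_linear by blast
    ultimately show "((\<lambda>x. g (f x)) has_derivative
        (\<lambda>v. \<Sum>b\<in>Basis. (frechet_derivative f (at x) v \<bullet> b) *\<^sub>R frechet_derivative g (at (f x)) b)) (at x)"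
      by (simp only: linear_euclidean_expand[symmetric])
  next
    fix v
    show "Ck_on k S (\<lambda>x. \<Sum>b\<in>Basis. (frechet_derivative f (at x) v \<bullet> b) *\<^sub>R
        frechet_derivative g (at (f x)) b)"
      using Suc.prems Ck_on_SucD[OF Suc.prems(1)] Ck_on_SucD[OF Suc.prems(2)]
      by (intro Ck_on_sum assms(1) Ck_on_bilinear[OF bounded_bilinear_scaleR]
          Ck_on_bounded_linear_compose[OF bounded_linear_inner_left] Suc.IH) auto
  qed
qed

lemma Ck_on_Pair:
  assumes "open S" "Ck_on k S f" "Ck_on k S g"
  shows "Ck_on k S (\<lambda>x. (f x, g x))"
proof -
  have "bounded_linear (\<lambda>y. (y, 0))" "bounded_linear (\<lambda>y. (0, y))"
    by (intro bounded_linear_Pair bounded_linear_ident bounded_linear_zero)+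
  then have "Ck_on k S (\<lambda>x. (f x, 0) + (0, g x))"
    using assms(2,3)[THEN Ck_on_bounded_linear_compose[rotated 2, OF _ _ assms(1)]]
    by (intro Ck_on_add assms(1)) blast+
  then show ?thesis by simp
qed

section \<open>Smooth maps, treated order by order\<close>

lemma smooth_on_has_derivative:
  "smooth_on S f \<Longrightarrow> x \<in> S \<Longrightarrow> (f has_derivative frechet_derivative f (at x)) (at x)"
  unfolding smooth_on_def using Ck_on_has_derivative by blast

lemma smooth_on_linear_derivative:
  "smooth_on S f \<Longrightarrow> x \<in> S \<Longrightarrow> linear (frechet_derivative f (at x))"
  using smooth_on_has_derivative has_derivative_linear by blast

lemma smooth_on_continuous: "smooth_on S f \<Longrightarrow> continuous_on S f"
  unfolding smooth_on_def using Ck_on_continuous by blast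

lemma smooth_on_derivative: "smooth_on S f \<Longrightarrow> smooth_on S (\<lambda>x. frechet_derivative f (at x) v)"
  unfolding smooth_on_def using Ck_on.simps(2) by blast

text \<open>Meant for a function that is known only through its derivative, as the potential
  \<open>h\<close> of the construction is.\<close>

lemma smooth_onI:
  assumes "open S" "\<And>x. x \<in> S \<Longrightarrow> (f has_derivative f' x) (at x)"
    and "\<And>v. smooth_on S (\<lambda>x. f' x v)"
  shows "smooth_on S f"
  unfolding smooth_on_def
proof
  fix k
  have "Ck_on (Suc k) S f"
    by (rule Ck_on_SucI[OF assms(1,2)]) (use assms(3) in \<open>auto simp: smooth_on_def\<close>)
  then show "Ck_on k S f" by (rule Ck_on_SucD)
qed

lemma smooth_on_cong: "open S \<Longrightarrow> (\<And>x. x \<in> S \<Longrightarrow> f x = g x) \<Longrightarrow> smooth_on S f \<longleftrightarrow> smooth_on S g"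
  unfolding smooth_on_def using Ck_on_cong by blast

lemma smooth_on_subset: "smooth_on S f \<Longrightarrow> T \<subseteq> S \<Longrightarrow> smooth_on T f"
  unfolding smooth_on_def using Ck_on_subset by blast

lemma smooth_on_const: "smooth_on S (\<lambda>x. c)"
  unfolding smooth_on_def using Ck_on_const by blast

lemma smooth_on_id: "open S \<Longrightarrow> smooth_on S (\<lambda>x. x)"
  unfolding smooth_on_def using Ck_on_id by blast

lemma smooth_on_bounded_linear: "bounded_linear L \<Longrightarrow> open S \<Longrightarrow> smooth_on S L"
  unfolding smooth_on_def using Ck_on_bounded_linear by blast

lemma smooth_on_bounded_linear_compose:
  "bounded_linear L \<Longrightarrow> open S \<Longrightarrow> smooth_on S f \<Longrightarrow> smooth_on S (\<lambda>x. L (f x))"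
  unfolding smooth_on_def using Ck_on_bounded_linear_compose by blast

lemma smooth_on_add:
  "open S \<Longrightarrow> smooth_on S f \<Longrightarrow> smooth_on S g \<Longrightarrow> smooth_on S (\<lambda>x. f x + g x)"
  unfolding smooth_on_def using Ck_on_add by blast

lemma smooth_on_sum:
  "open S \<Longrightarrow> (\<And>i. i \<in> I \<Longrightarrow> smooth_on S (f i)) \<Longrightarrow> smooth_on S (\<lambda>x. \<Sum>i\<in>I. f i x)"
  unfolding smooth_on_def by (simp add: Ck_on_sum)

lemma smooth_on_bilinear:
  "bounded_bilinear B \<Longrightarrow> open S \<Longrightarrow> smooth_on S f \<Longrightarrow> smooth_on S g \<Longrightarrow> smooth_on S (\<lambda>x. B (f x) (g x))"
  unfolding smooth_on_def using Ck_on_bilinear by blast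

lemma smooth_on_scaleR:
  "open S \<Longrightarrow> smooth_on S f \<Longrightarrow> smooth_on S g \<Longrightarrow> smooth_on S (\<lambda>x. f x *\<^sub>R g x)"
  using smooth_on_bilinear[OF bounded_bilinear_scaleR] by blast

lemma smooth_on_mult:
  fixes f g :: "'v::real_normed_vector \<Rightarrow> 'w::real_normed_algebra"
  shows "open S \<Longrightarrow> smooth_on S f \<Longrightarrow> smooth_on S g \<Longrightarrow> smooth_on S (\<lambda>x. f x * g x)"
  using smooth_on_bilinear[OF bounded_bilinear_mult] by blast

lemma smooth_on_inner:
  "open S \<Longrightarrow> smooth_on S f \<Longrightarrow> smooth_on S g \<Longrightarrow> smooth_on S (\<lambda>x. f x \<bullet> g x)"
  using smooth_on_bilinear[OF bounded_bilinear_inner] by blast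

lemma smooth_on_minus: "open S \<Longrightarrow> smooth_on S f \<Longrightarrow> smooth_on S (\<lambda>x. - f x)"
  using smooth_on_bounded_linear_compose[OF bounded_linear_minus[OF bounded_linear_ident]] by blast

lemma smooth_on_diff:
  "open S \<Longrightarrow> smooth_on S f \<Longrightarrow> smooth_on S g \<Longrightarrow> smooth_on S (\<lambda>x. f x - g x)"
  using smooth_on_add[of S f "\<lambda>x. - g x"] smooth_on_minus[of S g] by simp

lemma smooth_on_compose:
  fixes f :: "'v::real_normed_vector \<Rightarrow> 'w::euclidean_space" and g :: "'w \<Rightarrow> 'u::real_normed_vector"
  shows "open S \<Longrightarrow> smooth_on S f \<Longrightarrow> smooth_on T g \<Longrightarrow> f ` S \<subseteq> T \<Longrightarrow> smooth_on S (\<lambda>x. g (f x))"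
  unfolding smooth_on_def using Ck_on_compose by blast

lemma smooth_on_Pair:
  "open S \<Longrightarrow> smooth_on S f \<Longrightarrow> smooth_on S g \<Longrightarrow> smooth_on S (\<lambda>x. (f x, g x))"
  unfolding smooth_on_def using Ck_on_Pair by blast

lemma smooth_on_affine: "smooth_on S (\<lambda>t::real. a + t *\<^sub>R v)"
  by (rule smooth_on_subset[of UNIV], intro smooth_on_add smooth_on_const smooth_on_bounded_linear)
    (auto intro: bounded_linear_scaleR_left)

lemmas smooth_intros = smooth_on_const smooth_on_id smooth_on_add smooth_on_diff smooth_on_sum
  smooth_on_scaleR smooth_on_mult smooth_on_inner smooth_on_Pair

section \<open>Inverse functions, closed one-forms and isotropic planes\<close>

text \<open>Since \<open>h y = 0\<close>, near \<open>y\<close> the factor \<open>h x\<close> is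
  O(|x - y|), while \<open>p x - p y\<close> tends to 0; their product is negligible, so continuity
  of \<open>p\<close> replaces its differentiability. The use is for an inverse whose
  differentiability is still to be shown.\<close>

lemma has_derivative_scaleR_vanishing:
  fixes h :: "'b::real_normed_vector \<Rightarrow> real" and p :: "'b \<Rightarrow> 'c::real_normed_vector"
  assumes h: "(h has_derivative h') (at y)" and "h y = 0" and p: "isCont p y"
  shows "((\<lambda>x. h x *\<^sub>R p x) has_derivative (\<lambda>d. h' d *\<^sub>R p y)) (at y)"
proof -
  have lin: "bounded_linear h'" using h by (rule has_derivative_bounded_linear)
  then obtain K where K: "K > 0" "\<And>d. norm (h' d) \<le> norm d * K"
    using bounded_linear.pos_bounded by blast
  have "((\<lambda>x. h x *\<^sub>R (p x - p y)) has_derivative (\<lambda>d. 0)) (at y)"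
    unfolding has_derivative_at_alt
  proof (intro conjI allI impI bounded_linear_zero)
    fix e :: real assume "e > 0"
    obtain d1 where d1: "d1 > 0" "\<And>x. norm (x - y) < d1 \<Longrightarrow> norm (h x - h y - h' (x - y)) \<le> 1 * norm (x - y)"
      using h zero_less_one unfolding has_derivative_at_alt by blast
    have "e / (K + 1) > 0" using \<open>e > 0\<close> K by simp
    then obtain d2 where d2: "d2 > 0" "\<And>x. dist x y < d2 \<Longrightarrow> dist (p x) (p y) < e / (K + 1)"
      using p unfolding continuous_at_eps_delta by blast
    have "norm (h x *\<^sub>R (p x - p y)) \<le> e * norm (x - y)" if x: "norm (x - y) < min d1 d2" for x
    proof -
      have "norm (h x) \<le> norm (h x - h y - h' (x - y)) + norm (h' (x - y))"
        using \<open>h y = 0\<close> norm_triangle_ineq[of "h x - h' (x - y)" "h' (x - y)"] by simp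
      also have "\<dots> \<le> (K + 1) * norm (x - y)"
        using d1(2)[of x] K(2)[of "x - y"] x by (simp add: algebra_simps)
      finally have 1: "norm (h x) \<le> (K + 1) * norm (x - y)" .
      have "norm (p x - p y) \<le> e / (K + 1)"
        using d2(2)[of x] x by (simp add: dist_norm)
      then have "norm (h x) * norm (p x - p y) \<le> ((K + 1) * norm (x - y)) * (e / (K + 1))"
        using 1 K(1) by (intro mult_mono) auto
      also have "\<dots> = e * norm (x - y)" using K(1) by simp
      finally show ?thesis by simp
    qed
    then show "\<exists>d>0. \<forall>x. norm (x - y) < d \<longrightarrow>
        norm (h x *\<^sub>R (p x - p y) - h y *\<^sub>R (p y - p y) - 0) \<le> e * norm (x - y)"
      using d1(1) d2(1) by (intro exI[of _ "min d1 d2"]) auto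
  qed
  from has_derivative_add[OF this has_derivative_scaleR_left[OF h, of "p y"]]
  show ?thesis by (simp add: algebra_simps)
qed

text \<open>Derivatives of an inverse: \<open>P\<close> satisfies \<open>P y v - P z v = P y (M z - M y) (P z v)\<close>, which
  reduces all derivatives of \<open>P\<close> to those of \<open>M\<close>.\<close>

lemma continuous_on_inverse_family:
  fixes M P :: "'b::real_normed_vector \<Rightarrow> 'a::euclidean_space \<Rightarrow> 'a"
  assumes lin: "\<And>y. y \<in> S \<Longrightarrow> linear (M y)" "\<And>y. y \<in> S \<Longrightarrow> linear (P y)"
    and PM: "\<And>y v. y \<in> S \<Longrightarrow> P y (M y v) = v" and MP: "\<And>y v. y \<in> S \<Longrightarrow> M y (P y v) = v"
    and cont: "\<And>v. continuous_on S (\<lambda>y. M y v)"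
  shows "continuous_on S (\<lambda>y. P y v)"
  unfolding continuous_on_def
proof
  fix z assume z: "z \<in> S"
  have "inj (M z)" using PM[OF z] by (metis injI)
  \<comment> \<open>\<open>c\<close> bounds \<open>M z\<close> from below. Once \<open>M y\<close>
    is within \<open>c / 2\<close> of \<open>M z\<close>, it is bounded below by
    \<open>c / 2\<close>, so the inverses \<open>P y\<close> are uniformly bounded near
    \<open>z\<close>.\<close>
  then obtain c where c: "c > 0" "\<And>w. c * norm w \<le> norm (M z w)"
    using linear_inj_bounded_below_pos[OF lin(1)[OF z]] by (metis mult.commute)
  have tend: "((\<lambda>y. M y w) \<longlongrightarrow> M z w) (at z within S)" for w
    using cont z by (auto simp: continuous_on_def)
  have "((\<lambda>y. \<Sum>b\<in>Basis. norm (M y b - M z b)) \<longlongrightarrow> (\<Sum>b\<in>(Basis::'a set). norm (M z b - M z b))) (at z within S)"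
    by (intro tendsto_intros tend)
  then have "\<forall>\<^sub>F y in at z within S. (\<Sum>b\<in>Basis. norm (M y b - M z b)) < c / 2"
    using c(1) by (intro order_tendstoD(2)) auto
  moreover have "\<forall>\<^sub>F y in at z within S. y \<in> S" by (simp add: eventually_at_filter)
  ultimately have ev: "\<forall>\<^sub>F y in at z within S. norm (P y v - P z v) \<le> 2 / c * norm (M z (P z v) - M y (P z v))"
  proof eventually_elim
    case (elim y)
    have "norm (M y w - M z w) \<le> c / 2 * norm w" for w
    proof -
      have "M y w - M z w = (\<Sum>b\<in>Basis. (w \<bullet> b) *\<^sub>R (M y b - M z b))"
        unfolding linear_euclidean_expand[OF lin(1)[OF elim(2)], of w]
          linear_euclidean_expand[OF lin(1)[OF z], of w]
        by (simp add: sum_subtractf scaleR_diff_right)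
      also have "norm \<dots> \<le> (\<Sum>b\<in>Basis. norm w * norm (M y b - M z b))"
        by (intro order_trans[OF norm_sum] sum_mono) (simp add: Basis_le_norm mult_right_mono)
      also have "\<dots> \<le> c / 2 * norm w"
        using mult_left_mono[OF less_imp_le[OF elim(1)], of "norm w"]
        by (simp add: sum_distrib_left[symmetric] mult.commute)
      finally show ?thesis .
    qed
    note d = this
    have low: "c / 2 * norm w \<le> norm (M y w)" for w
      using c(2)[of w] d[of w] norm_triangle_ineq2[of "M z w" "M y w"]
      by (simp add: norm_minus_commute)
    have "P y v - P z v = P y (M z (P z v) - M y (P z v))"
      using PM[OF elim(2)] MP[OF z] by (simp add: linear_diff[OF lin(2)[OF elim(2)]])
    then have "c / 2 * norm (P y v - P z v) \<le> norm (M z (P z v) - M y (P z v))"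
      using low[of "P y v - P z v"] MP[OF elim(2)] by simp
    then show ?case using c(1) by (simp add: field_simps)
  qed
  have "((\<lambda>y. 2 / c * norm (M z (P z v) - M y (P z v))) \<longlongrightarrow> 2 / c * norm (M z (P z v) - M z (P z v))) (at z within S)"
    by (intro tendsto_intros tend)
  then have "((\<lambda>y. P y v - P z v) \<longlongrightarrow> 0) (at z within S)"
    using Lim_null_comparison[OF ev] by simp
  then show "((\<lambda>y. P y v) \<longlongrightarrow> P z v) (at z within S)" by (rule LIM_zero_cancel)
qed

text \<open>The derivative of \<open>P\<close> is \<open>- P (dM) P\<close>, an expression in
  \<open>P\<close> and the first derivatives of \<open>M\<close>, so each induction step gains one
  order of differentiability.\<close>

lemma Ck_on_inverse_family:
  fixes M P :: "'b::real_normed_vector \<Rightarrow> 'a::euclidean_space \<Rightarrow> 'a"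
  assumes S: "open S"
    and lin: "\<And>y. y \<in> S \<Longrightarrow> linear (M y)" "\<And>y. y \<in> S \<Longrightarrow> linear (P y)"
    and PM: "\<And>y v. y \<in> S \<Longrightarrow> P y (M y v) = v" and MP: "\<And>y v. y \<in> S \<Longrightarrow> M y (P y v) = v"
    and Ck: "\<And>v. Ck_on k S (\<lambda>y. M y v)"
  shows "Ck_on k S (\<lambda>y. P y v)"
  using Ck
proof (induction k arbitrary: v)
  case 0
  then show ?case using continuous_on_inverse_family[of S M P] lin PM MP by auto
next
  case (Suc k)
  let ?D = "\<lambda>y w d. frechet_derivative (\<lambda>y. M y w) (at y) d"
  have M: "((\<lambda>y. M y w) has_derivative ?D y w) (at y)" if "y \<in> S" for y w
    using Ck_on_has_derivative[OF Suc.prems that] .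
  have contP: "continuous_on S (\<lambda>y. P y w)" for w
    using continuous_on_inverse_family[of S M P] lin PM MP Ck_on_continuous[OF Suc.prems] by blast
  have CkM: "Ck_on k S (\<lambda>y. M y w)" "Ck_on k S (\<lambda>y. ?D y w d)" for w d
    using Ck_on_SucD[OF Suc.prems] Suc.prems by auto
  have CkP: "Ck_on k S (\<lambda>y. P y w)" for w
    using Suc.IH CkM by blast
  have expand: "?D y w d = (\<Sum>b\<in>Basis. (w \<bullet> b) *\<^sub>R ?D y b d)" if "y \<in> S" for y w d
  proof -
    have "((\<lambda>x. \<Sum>b\<in>Basis. (w \<bullet> b) *\<^sub>R M x b) has_derivative (\<lambda>d. \<Sum>b\<in>Basis. (w \<bullet> b) *\<^sub>R ?D y b d)) (at y)"
      by (intro has_derivative_sum has_derivative_scaleR_right M that)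
    then have "((\<lambda>x. M x w) has_derivative (\<lambda>d. \<Sum>b\<in>Basis. (w \<bullet> b) *\<^sub>R ?D y b d)) (at y)"
      by (rule has_derivative_transform_within_open[OF _ S that])
        (simp add: linear_euclidean_expand[OF lin(1), symmetric])
    then show ?thesis by (simp add: frechet_derivative_eq)
  qed
  let ?P' = "\<lambda>y d. \<Sum>b\<in>Basis. (- (?D y (P y v) d \<bullet> b)) *\<^sub>R P y b"
  show ?case
  proof (rule Ck_on_SucI[OF S, where f' = ?P'])
    fix z assume z: "z \<in> S"
    \<comment> \<open>The sum is \<open>P y (v - M y (P z v))\<close>; its coefficients vanish at
      \<open>y = z\<close>, so it can be differentiated with \<open>P\<close> merely
      continuous.\<close>
    have "((\<lambda>y. \<Sum>b\<in>Basis. ((v - M y (P z v)) \<bullet> b) *\<^sub>R P y b) has_derivative ?P' z) (at z)"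
    proof (intro has_derivative_sum has_derivative_scaleR_vanishing)
      fix b :: 'a
      show "((\<lambda>y. (v - M y (P z v)) \<bullet> b) has_derivative (\<lambda>d. - (?D z (P z v) d \<bullet> b))) (at z)"
        by (auto intro!: derivative_eq_intros M z)
      show "isCont (\<lambda>y. P y b) z"
        using contP z S continuous_on_eq_continuous_at by blast
    qed (simp add: MP z)
    from has_derivative_add[OF has_derivative_const[of "P z v"] this]
    have "((\<lambda>y. P z v + (\<Sum>b\<in>Basis. ((v - M y (P z v)) \<bullet> b) *\<^sub>R P y b)) has_derivative ?P' z) (at z)"
      by simp
    then show "((\<lambda>y. P y v) has_derivative ?P' z) (at z)"
    proof (rule has_derivative_transform_within_open[OF _ S z])
      fix y assume y: "y \<in> S"
      show "P z v + (\<Sum>b\<in>Basis. ((v - M y (P z v)) \<bullet> b) *\<^sub>R P y b) = P y v"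
        unfolding linear_euclidean_expand[OF lin(2)[OF y], symmetric]
        by (simp add: linear_diff[OF lin(2)[OF y]] PM[OF y])
    qed
  next
    fix d
    \<comment> \<open>The argument \<open>P y v\<close> of the derivative of \<open>M\<close> varies
      with \<open>y\<close>, so it has to be expanded in the basis as well.\<close>
    have "Ck_on k S (\<lambda>y. \<Sum>b\<in>Basis. (- ((\<Sum>b'\<in>Basis. (P y v \<bullet> b') *\<^sub>R ?D y b' d) \<bullet> b)) *\<^sub>R P y b)"
      by (intro Ck_on_sum S Ck_on_bilinear[OF bounded_bilinear_scaleR] CkP CkM
          Ck_on_bounded_linear_compose[OF bounded_linear_minus[OF bounded_linear_inner_left]]
          Ck_on_bounded_linear_compose[OF bounded_linear_inner_left])
    then show "Ck_on k S (\<lambda>y. ?P' y d)"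
      by (subst Ck_on_cong[OF S]) (simp_all add: expand[symmetric])
  qed
qed

text \<open>The inverse function theorem gives a differentiable \<open>G\<close> whose derivative at
  \<open>y\<close> inverts that of \<open>F\<close> at \<open>G y\<close>. If \<open>G\<close> is of
  class C^k, this is the inverse of a C^k family, so \<open>G\<close> is of class C^(k+1).\<close>

lemma smooth_inverse_function:
  fixes F :: "'a::euclidean_space \<Rightarrow> 'a"
  assumes U: "open U" and F: "smooth_on U F" and "x0 \<in> U"
    and inj: "\<And>v. frechet_derivative F (at x0) v = 0 \<Longrightarrow> v = 0"
  obtains U' V G where "open U'" "U' \<subseteq> U" "x0 \<in> U'" "open V" "homeomorphism U' V F G" "smooth_on V G"
    "\<And>x. x \<in> U' \<Longrightarrow> bij (frechet_derivative F (at x))"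
proof -
  define F' where "F' = (\<lambda>x. Blinfun (frechet_derivative F (at x)))"
  have lin: "linear (frechet_derivative F (at x))" if "x \<in> U" for x
    using smooth_on_linear_derivative[OF F that] .
  have F': "blinfun_apply (F' x) = frechet_derivative F (at x)" if "x \<in> U" for x
    unfolding F'_def using lin[OF that] by (simp add: bounded_linear_Blinfun_apply linear_conv_bounded_linear)
  have cont: "continuous_on U F'"
  proof (rule continuous_on_blinfun_componentwise)
    fix i :: 'a
    show "continuous_on U (\<lambda>x. blinfun_apply (F' x) i)"
      using smooth_on_continuous[OF smooth_on_derivative[OF F, of i]]
      by (rule continuous_on_eq) (simp add: F')
  qed
  have "inj (frechet_derivative F (at x0))"
    using inj lin[OF \<open>x0 \<in> U\<close>] by (simp add: linear_injective_0)
  then obtain g where g: "linear g" "g \<circ> frechet_derivative F (at x0) = id"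
    using linear_injective_left_inverse lin[OF \<open>x0 \<in> U\<close>] by blast
  have inv: "Blinfun g o\<^sub>L F' x0 = id_blinfun"
    using g F'[OF \<open>x0 \<in> U\<close>]
    by (intro blinfun_eqI)
      (simp add: bounded_linear_Blinfun_apply linear_conv_bounded_linear fun_eq_iff)
  from inverse_function_theorem[OF U _ cont \<open>x0 \<in> U\<close> inv, of F]
  obtain U' V G G' where res: "open U'" "U' \<subseteq> U" "x0 \<in> U'" "open V" "homeomorphism U' V F G"
    and G: "\<And>y. y \<in> V \<Longrightarrow> (G has_derivative (G' y)) (at y)"
      "\<And>y. y \<in> V \<Longrightarrow> G' y = inv (blinfun_apply (F' (G y)))"
      "\<And>y. y \<in> V \<Longrightarrow> bij (blinfun_apply (F' (G y)))"
    using smooth_on_has_derivative[OF F] F' by metis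
  have GV: "G y \<in> U'" if "y \<in> V" for y
    using that res(5) by (auto simp: homeomorphism_def)
  have "Ck_on k V G" for k
  proof (induction k)
    case 0
    then show ?case using res(5) by (auto simp: homeomorphism_def)
  next
    case (Suc k)
    show ?case
    proof (rule Ck_on_SucI[OF \<open>open V\<close> G(1)])
      fix v
      show "Ck_on k V (\<lambda>y. G' y v)"
      proof (rule Ck_on_inverse_family[OF \<open>open V\<close>, where M = "\<lambda>y. frechet_derivative F (at (G y))"])
        fix y assume y: "y \<in> V"
        then have y': "G y \<in> U" using GV res(2) by auto
        show "linear (frechet_derivative F (at (G y)))" using lin y' .
        show "linear (G' y)" using G(1)[OF y] has_derivative_linear by blast
        fix v
        show "G' y (frechet_derivative F (at (G y)) v) = v"
          using G(2,3)[OF y] F'[OF y'] by (simp add: bij_is_inj)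
        show "frechet_derivative F (at (G y)) (G' y v) = v"
          using G(2,3)[OF y] F'[OF y'] by (simp add: bij_is_surj surj_f_inv_f)
      next
        fix v
        show "Ck_on k V (\<lambda>y. frechet_derivative F (at (G y)) v)"
        proof (rule Ck_on_compose[OF \<open>open V\<close> Suc, where T = U])
          show "Ck_on k U (\<lambda>x. frechet_derivative F (at x) v)"
            using smooth_on_derivative[OF F, of v] by (simp add: smooth_on_def)
        qed (use GV res(2) in auto)
      qed
    qed
  qed
  then have smooth: "smooth_on V G" by (simp add: smooth_on_def)
  have "bij (frechet_derivative F (at x))" if "x \<in> U'" for x
  proof -
    have "F x \<in> V" "G (F x) = x" using that res(5) by (auto simp: homeomorphism_def)
    then show ?thesis using G(3)[of "F x"] F' that res(2) by auto
  qed
  then show thesis using that[OF res(1-5) smooth] by blast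
qed

text \<open>The Poincare lemma, with the integral of
  \<open>a (z0 + t (z - z0)) \<bullet> (z - z0)\<close> over \<open>t\<close> in [0,1] as potential.
  Symmetry turns the \<open>z\<close>-derivative of the integrand into the
  \<open>t\<close>-derivative of \<open>t a (z0 + t (z - z0))\<close>, which integrates to
  \<open>a z\<close>.\<close>

lemma closed_one_form_exact:
  fixes a :: "'e::euclidean_space \<Rightarrow> 'e"
  assumes a: "smooth_on (ball z0 r) a"
    and sym: "\<And>z v w. z \<in> ball z0 r \<Longrightarrow>
      frechet_derivative a (at z) v \<bullet> w = frechet_derivative a (at z) w \<bullet> v"
  obtains h where "\<And>z. z \<in> ball z0 r \<Longrightarrow> (h has_derivative (\<lambda>v. a z \<bullet> v)) (at z)"
proof -
  let ?B = "ball z0 r"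
  define p where "p = (\<lambda>z t. z0 + t *\<^sub>R (z - z0))"
  define f where "f = (\<lambda>z t. a (p z t) \<bullet> (z - z0))"
  define fx where "fx = (\<lambda>z t. blinfun_inner_right (t *\<^sub>R frechet_derivative a (at (p z t)) (z - z0) + a (p z t)))"
  have pB: "p z t \<in> ?B" if "z \<in> ?B" "t \<in> cbox 0 1" for z and t :: real
  proof -
    have "p z t = (1 - t) *\<^sub>R z0 + t *\<^sub>R z" by (simp add: p_def algebra_simps)
    moreover have "z0 \<in> ?B" using that by (metis centre_in_ball dist_not_less_zero linorder_not_less mem_ball order_le_less_trans)
    ultimately show ?thesis using that convexD_alt[OF convex_ball, of z0 z0 r z t] by simp
  qed
  have contp: "continuous_on (?B \<times> cbox 0 1) (\<lambda>(z, t). p z t)"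
    unfolding p_def split_def by (intro continuous_intros)
  have cont_comp: "continuous_on (?B \<times> cbox 0 1) (\<lambda>(z, t). g (p z t))" if "continuous_on ?B g"
    for g :: "'e \<Rightarrow> 'e"
    using continuous_on_compose2[OF that contp] pB by (force simp: split_def)
  have deriv: "((\<lambda>z. integral (cbox 0 1) (f z)) has_derivative integral (cbox 0 1) (fx z)) (at z within ?B)"
    if z: "z \<in> ?B" for z
  proof (rule leibniz_rule[OF _ _ _ z convex_ball])
    fix z t assume zt: "z \<in> ?B" "t \<in> cbox (0::real) 1"
    let ?D = "frechet_derivative a (at (p z t))"
    have "(a has_derivative ?D) (at (p z t))"
      using smooth_on_has_derivative[OF a pB[OF zt]] .
    moreover have "((\<lambda>z. p z t) has_derivative (\<lambda>v. t *\<^sub>R v)) (at z)"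
      unfolding p_def by (auto intro!: derivative_eq_intros)
    ultimately have "((\<lambda>z. a (p z t)) has_derivative (\<lambda>v. ?D (t *\<^sub>R v))) (at z)"
      using has_derivative_compose by blast
    then have "((\<lambda>z. f z t) has_derivative (\<lambda>v. a (p z t) \<bullet> v + ?D (t *\<^sub>R v) \<bullet> (z - z0))) (at z)"
      unfolding f_def by (auto intro!: derivative_eq_intros)
    \<comment> \<open>Here symmetry of the derivative of \<open>a\<close> exchanges \<open>v\<close>
      with the radial vector \<open>z - z0\<close>.\<close>
    moreover have "a (p z t) \<bullet> v + ?D (t *\<^sub>R v) \<bullet> (z - z0) = fx z t v" for v
      unfolding fx_def using sym[OF pB[OF zt], of v "z - z0"]
      by (simp add: linear_cmul[OF smooth_on_linear_derivative[OF a pB[OF zt]]] inner_add_left)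
    ultimately have "((\<lambda>z. f z t) has_derivative blinfun_apply (fx z t)) (at z)" by simp
    then show "((\<lambda>z. f z t) has_derivative blinfun_apply (fx z t)) (at z within ?B)"
      by (rule has_derivative_at_withinI)
  next
    fix z assume z: "z \<in> ?B"
    have "continuous_on (cbox 0 1) (\<lambda>t. case (z, t) of (z, t) \<Rightarrow> a (p z t))"
      by (rule continuous_on_compose2[OF cont_comp[OF smooth_on_continuous[OF a]]])
        (use z in \<open>auto intro!: continuous_intros\<close>)
    then show "f z integrable_on cbox 0 1"
      unfolding f_def by (intro integrable_continuous continuous_intros) auto
  next
    have "continuous_on (?B \<times> cbox 0 1) (\<lambda>zt. blinfun_inner_right (snd zt *\<^sub>R
        (\<Sum>b\<in>Basis. ((fst zt - z0) \<bullet> b) *\<^sub>R (case zt of (z, t) \<Rightarrow> frechet_derivative a (at (p z t)) b))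
         + (case zt of (z, t) \<Rightarrow> a (p z t))))"
      by (intro bounded_linear.continuous_on[OF bounded_linear_blinfun_inner_right] continuous_intros
          cont_comp smooth_on_continuous smooth_on_derivative a)
    moreover have "(case zt of (z, t) \<Rightarrow> fx z t) = blinfun_inner_right (snd zt *\<^sub>R
        (\<Sum>b\<in>Basis. ((fst zt - z0) \<bullet> b) *\<^sub>R (case zt of (z, t) \<Rightarrow> frechet_derivative a (at (p z t)) b))
         + (case zt of (z, t) \<Rightarrow> a (p z t)))" if "zt \<in> ?B \<times> cbox 0 1" for zt
      using that by (auto simp: fx_def linear_euclidean_expand[OF smooth_on_linear_derivative[OF a pB], symmetric])
    ultimately show "continuous_on (?B \<times> cbox 0 1) (\<lambda>(z, t). fx z t)"
      by (simp cong: continuous_on_cong)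
  qed
  have int: "integral (cbox 0 1) (fx z) = blinfun_inner_right (a z)" if z: "z \<in> ?B" for z
  proof -
    have "(fx z has_integral (blinfun_inner_right (1 *\<^sub>R a (p z 1)) - blinfun_inner_right (0 *\<^sub>R a (p z 0)))) {0..1}"
    proof (rule fundamental_theorem_of_calculus)
      fix t :: real assume "t \<in> {0..1}"
      then have t: "t \<in> cbox 0 1" by simp
      have "(a has_derivative frechet_derivative a (at (p z t))) (at (p z t))"
        using smooth_on_has_derivative[OF a pB[OF z t]] .
      moreover have "(p z has_vector_derivative (z - z0)) (at t)"
        unfolding p_def by (auto intro!: derivative_eq_intros)
      ultimately have "((\<lambda>t. a (p z t)) has_vector_derivative frechet_derivative a (at (p z t)) (z - z0)) (at t)"
        using has_derivative_compose[of "p z" "\<lambda>h. h *\<^sub>R (z - z0)" t UNIV a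
            "frechet_derivative a (at (p z t))"]
        by (simp add: has_vector_derivative_def
            linear_cmul[OF smooth_on_linear_derivative[OF a pB[OF z t]]])
      then have "((\<lambda>t. t *\<^sub>R a (p z t)) has_vector_derivative t *\<^sub>R frechet_derivative a (at (p z t)) (z - z0) + a (p z t)) (at t)"
        by (auto intro!: derivative_eq_intros)
      then have "((\<lambda>t. blinfun_inner_right (t *\<^sub>R a (p z t))) has_vector_derivative fx z t) (at t)"
        unfolding fx_def by (rule bounded_linear.has_vector_derivative[OF bounded_linear_blinfun_inner_right])
      then show "((\<lambda>t. blinfun_inner_right (t *\<^sub>R a (p z t))) has_vector_derivative fx z t) (at t within {0..1})"
        by (rule has_vector_derivative_at_within)
    qed simp
    then show ?thesis
      by (simp add: p_def integral_unique
          linear_0[OF bounded_linear.linear[OF bounded_linear_blinfun_inner_right]])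
  qed
  show thesis
  proof (rule that)
    fix z assume z: "z \<in> ?B"
    have "blinfun_apply (blinfun_inner_right (a z)) = (\<lambda>v. a z \<bullet> v)"
      by (simp add: fun_eq_iff)
    then show "((\<lambda>z. integral (cbox 0 1) (f z)) has_derivative (\<lambda>v. a z \<bullet> v)) (at z)"
      using deriv[OF z] unfolding int[OF z] at_within_open[OF z open_ball] by simp
  qed
qed

text \<open>Vectors of the plane that have the form \<open>(x, s x)\<close> for different slopes \<open>s\<close> have orthogonal
  \<open>x\<close>, so that only finitely many slopes occur.\<close>

lemma isotropic_transverse_slope:
  fixes D :: "'v::real_vector \<Rightarrow> 'e::euclidean_space \<times> 'e"
  assumes inj: "\<And>v. D v = 0 \<Longrightarrow> v = 0"
    and iso: "\<And>v w. symplectic_form (D v) (D w) = 0"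
  obtains s :: real where "\<And>v. snd (D v) = s *\<^sub>R fst (D v) \<Longrightarrow> v = 0"
proof (rule ccontr)
  assume "\<not> thesis"
  then have "\<forall>s. \<exists>v. snd (D v) = s *\<^sub>R fst (D v) \<and> v \<noteq> 0"
    using that by blast
  then obtain v where v: "\<And>s. snd (D (v s)) = s *\<^sub>R fst (D (v s))" "\<And>s. v s \<noteq> 0" by metis
  define x where "x = (\<lambda>s. fst (D (v s)))"
  have nz: "x s \<noteq> 0" for s
  proof
    assume "x s = 0"
    then have "D (v s) = 0" using v(1)[of s] by (simp add: x_def prod_eq_iff)
    then show False using inj v(2) by blast
  qed
  have orth: "x s \<bullet> x t = 0" if "s \<noteq> t" for s t
  proof -
    \<comment> \<open>The symplectic form of \<open>(x, s x)\<close> and \<open>(y, t y)\<close> is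
      \<open>(s - t) (x \<bullet> y)\<close>.\<close>
    have "(s - t) * (x s \<bullet> x t) = 0"
      using iso[of "v s" "v t"] by (simp add: symplectic_form_def v(1) x_def algebra_simps)
    then show ?thesis using that by simp
  qed
  have "inj x"
  proof (rule injI)
    fix s t assume "x s = x t"
    then show "s = t" using orth[of s t] nz[of t] by (metis inner_eq_zero_iff)
  qed
  then have "infinite (range x)" using infinite_UNIV_char_0 finite_imageD by blast
  moreover have "independent (range x)"
  proof (rule pairwise_orthogonal_independent)
    show "pairwise orthogonal (range x)"
      using orth unfolding pairwise_def orthogonal_def by (metis (no_types, lifting) imageE)
  qed (use nz in force)
  then have "finite (range x)" by (rule independent_imp_finite)
  ultimately show False by blast
qed

section \<open>Charts of the manifold and of its cotangent bundle\<close>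

lemma chart_inj: "is_chart X c \<Longrightarrow> inj_on (snd c) (fst c)"
  unfolding is_chart_def
  by (metis (no_types, lifting) homeomorphic_imp_injective_map inf.absorb_iff2 openin_subset topspace_subtopology)

lemma chart_inv_left: "inj_on (snd c) (fst c) \<Longrightarrow> p \<in> fst c \<Longrightarrow> chart_inv c (snd c p) = p"
  by (simp add: chart_inv_def)

lemma chart_topspace: "is_chart X c \<Longrightarrow> fst c \<subseteq> topspace X"
  by (simp add: is_chart_def openin_subset)

lemma chart_continuous: "is_chart X c \<Longrightarrow> continuous_map (subtopology X (fst c)) euclidean (snd c)"
  unfolding is_chart_def using homeomorphic_imp_continuous_map continuous_map_in_subtopology by blast

lemma chart_openin_preimage:
  assumes "is_chart X c" "open W"
  shows "openin X {p \<in> fst c. snd c p \<in> W}"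
proof -
  have "openin (subtopology X (fst c)) {p \<in> topspace (subtopology X (fst c)). snd c p \<in> W}"
    using openin_continuous_map_preimage[OF chart_continuous[OF assms(1)]] assms(2) by simp
  moreover have "{p \<in> topspace (subtopology X (fst c)). snd c p \<in> W} = {p \<in> fst c. snd c p \<in> W}"
    using chart_topspace[OF assms(1)] by auto
  moreover have "openin X (fst c)" using assms(1) by (simp add: is_chart_def)
  ultimately show ?thesis by (metis openin_open_subtopology)
qed

lemma chart_open_image:
  assumes "is_chart X c" "openin X U"
  shows "open (snd c ` (fst c \<inter> U))"
proof -
  have "openin (subtopology X (fst c)) (fst c \<inter> U)"
    using assms by (auto simp: openin_subtopology_Int2)
  then have "openin (top_of_set (snd c ` fst c)) (snd c ` (fst c \<inter> U))"
    using assms(1) homeomorphic_map_openness unfolding is_chart_def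
    by (metis (no_types, lifting) openin_subset)
  then show ?thesis
    using assms(1) openin_open_trans unfolding is_chart_def by blast
qed

lemma chart_inv_continuous:
  assumes "is_chart X c"
  shows "continuous_map (top_of_set (snd c ` fst c)) X (chart_inv c)"
proof -
  have top: "topspace (subtopology X (fst c)) = fst c"
    using chart_topspace[OF assms] by auto
  obtain g where g: "homeomorphic_maps (subtopology X (fst c)) (top_of_set (snd c ` fst c)) (snd c) g"
    using assms homeomorphic_map_maps unfolding is_chart_def by blast
  have eq: "g y = chart_inv c y" if "y \<in> snd c ` fst c" for y
  proof -
    obtain p where p: "p \<in> fst c" "y = snd c p" using \<open>y \<in> _\<close> by blast
    have "g (snd c p) = p" using g p top by (auto simp: homeomorphic_maps_def)
    then show ?thesis using chart_inv_left[OF chart_inj[OF assms]] p by simp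
  qed
  have "continuous_map (top_of_set (snd c ` fst c)) X g"
    using g by (auto simp: homeomorphic_maps_def continuous_map_in_subtopology)
  then show ?thesis
    by (rule continuous_map_eq) (simp add: eq)
qed

lemma transition_derivative_inverse:
  assumes "compatible c d" "is_chart X c" "openin X (fst d)" "inj_on (snd d) (fst d)" "p \<in> fst c \<inter> fst d"
  shows "frechet_derivative (snd c \<circ> chart_inv d) (at (snd d p))
    (frechet_derivative (snd d \<circ> chart_inv c) (at (snd c p)) v) = v"
proof -
  let ?S = "snd c ` (fst c \<inter> fst d)"
  have S: "open ?S" "snd c p \<in> ?S"
    using chart_open_image[OF assms(2,3)] assms(5) by auto
  have inv: "chart_inv c (snd c p) = p" if "p \<in> fst c" for p
    using chart_inv_left[OF chart_inj[OF assms(2)] that] .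
  have "((snd d \<circ> chart_inv c) has_derivative frechet_derivative (snd d \<circ> chart_inv c) (at (snd c p))) (at (snd c p))"
    using assms(1) S(2) smooth_on_has_derivative unfolding compatible_def by blast
  moreover have "((snd c \<circ> chart_inv d) has_derivative frechet_derivative (snd c \<circ> chart_inv d) (at (snd d p)))
      (at ((snd d \<circ> chart_inv c) (snd c p)))"
    using assms(1,5) smooth_on_has_derivative inv[of p] unfolding compatible_def by auto
  ultimately have "((\<lambda>y. (snd c \<circ> chart_inv d) ((snd d \<circ> chart_inv c) y)) has_derivative
      (\<lambda>v. frechet_derivative (snd c \<circ> chart_inv d) (at (snd d p))
        (frechet_derivative (snd d \<circ> chart_inv c) (at (snd c p)) v))) (at (snd c p))"
    by (rule has_derivative_compose)
  then have "((\<lambda>y. y) has_derivative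
      (\<lambda>v. frechet_derivative (snd c \<circ> chart_inv d) (at (snd d p))
        (frechet_derivative (snd d \<circ> chart_inv c) (at (snd c p)) v))) (at (snd c p))"
    by (rule has_derivative_transform_within_open[OF _ S])
      (use inv chart_inv_left[OF assms(4)] in auto)
  from has_derivative_unique[OF this has_derivative_ident] show ?thesis by metis
qed

locale smooth_mfd =
  fixes X :: "'a topology" and A :: "('a, 'e::euclidean_space) chart set"
  assumes mfd: "smooth_manifold X A"
begin

abbreviation "TX \<equiv> cotangent_topology X A"
abbreviation "TA \<equiv> cotangent_atlas X A"
abbreviation "TC \<equiv> cotangent_chart X A"
abbreviation "transition c d \<equiv> snd d \<circ> chart_inv c"
abbreviation "dtrans c d p \<equiv> frechet_derivative (transition c d) (at (snd c p))"

lemma chart: "c \<in> A \<Longrightarrow> is_chart X c"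
  and compat: "c \<in> A \<Longrightarrow> d \<in> A \<Longrightarrow> compatible c d"
  and chart_open: "c \<in> A \<Longrightarrow> openin X (fst c)"
  using mfd unfolding smooth_manifold_def is_chart_def by auto

lemma inv_left [simp]: "c \<in> A \<Longrightarrow> p \<in> fst c \<Longrightarrow> chart_inv c (snd c p) = p"
  by (rule chart_inv_left[OF chart_inj[OF chart]])

lemma transition_smooth:
  "c \<in> A \<Longrightarrow> d \<in> A \<Longrightarrow> smooth_on (snd c ` (fst c \<inter> fst d)) (transition c d)"
  using compat unfolding compatible_def by blast

lemma overlap_open: "c \<in> A \<Longrightarrow> openin X U \<Longrightarrow> open (snd c ` (fst c \<inter> U))"
  using chart_open_image chart by blast

lemma transition_has_derivative:
  "c \<in> A \<Longrightarrow> d \<in> A \<Longrightarrow> p \<in> fst c \<Longrightarrow> p \<in> fst d \<Longrightarrow>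
    (transition c d has_derivative dtrans c d p) (at (snd c p))"
  using smooth_on_has_derivative[OF transition_smooth] by blast

lemma dtrans_inverse:
  "c \<in> A \<Longrightarrow> d \<in> A \<Longrightarrow> p \<in> fst c \<Longrightarrow> p \<in> fst d \<Longrightarrow> dtrans d c p (dtrans c d p v) = v"
  by (rule transition_derivative_inverse[OF compat chart chart_open chart_inj[OF chart]]) auto

lemma has_derivative_change_chart:
  fixes g :: "'a \<Rightarrow> 'w::real_normed_vector"
  assumes "c \<in> A" "d \<in> A" "p \<in> fst c" "p \<in> fst d"
    and g: "(g \<circ> chart_inv c has_derivative g') (at (snd c p))"
  shows "(g \<circ> chart_inv d has_derivative (\<lambda>v. g' (dtrans d c p v))) (at (snd d p))"
proof -
  have "((\<lambda>y. (g \<circ> chart_inv c) (transition d c y)) has_derivative (\<lambda>v. g' (dtrans d c p v))) (at (snd d p))"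
    by (rule has_derivative_compose[OF transition_has_derivative[OF assms(2,1,4,3)]])
      (use g assms(1-4) in \<open>simp add: comp_def\<close>)
  then show ?thesis
    by (rule has_derivative_transform_within_open[OF _ overlap_open[OF assms(2) chart_open[OF assms(1)]]])
      (use assms in auto)
qed

text \<open>This is the change of charts applied to the coordinate map of \<open>e\<close>.\<close>

lemma dtrans_cocycle:
  assumes "c \<in> A" "d \<in> A" "e \<in> A" "p \<in> fst c" "p \<in> fst d" "p \<in> fst e"
  shows "dtrans d e p v = dtrans c e p (dtrans d c p v)"
  using has_derivative_change_chart[OF assms(1,2,4,5) transition_has_derivative[OF assms(1,3,4,6)]]
  by (simp add: frechet_derivative_eq)

lemma dtrans_linear: "c \<in> A \<Longrightarrow> d \<in> A \<Longrightarrow> p \<in> fst c \<Longrightarrow> p \<in> fst d \<Longrightarrow> linear (dtrans c d p)"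
  using transition_has_derivative has_derivative_linear by blast

text \<open>The phase function is explicit in one chart \<open>c\<close> only; this reads its
  differential in every other chart \<open>d\<close>.\<close>

lemma differential_chart:
  assumes "c \<in> A" "d \<in> A" "p \<in> fst c" "p \<in> fst d"
    and g: "(g \<circ> chart_inv c has_derivative g') (at (snd c p))"
  shows "differential A g p d \<bullet> v = g' (dtrans d c p v)"
proof -
  have D: "frechet_derivative (g \<circ> chart_inv d) (at (snd d p)) = (\<lambda>v. g' (dtrans d c p v))"
    using has_derivative_change_chart[OF assms] by (rule frechet_derivative_eq)
  have lin: "linear (\<lambda>v. g' (dtrans d c p v))"
    using has_derivative_change_chart[OF assms] has_derivative_linear by blast
  have "differential A g p d \<bullet> v = (\<Sum>b\<in>Basis. (v \<bullet> b) *\<^sub>R g' (dtrans d c p b))"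
    unfolding differential_def D using assms(2,4)
    by (simp add: inner_sum_left) (simp add: inner_commute mult.commute)
  then show ?thesis by (simp only: linear_euclidean_expand[OF lin, of v])
qed

lemma differential_in_cotangent_space:
  assumes "c \<in> A" "p \<in> fst c" and g: "(g \<circ> chart_inv c has_derivative g') (at (snd c p))"
  shows "differential A g p \<in> cotangent_space A p"
proof -
  have "differential A g p d \<bullet> v = differential A g p e \<bullet> dtrans d e p v"
    if "d \<in> A" "e \<in> A" "p \<in> fst d \<inter> fst e" for d e v
  proof -
    have "differential A g p d \<bullet> v = g' (dtrans d c p v)"
      using that by (intro differential_chart[OF assms(1) _ assms(2) _ g]) auto
    also have "dtrans d c p v = dtrans e c p (dtrans d e p v)"
      using that assms(1,2) by (intro dtrans_cocycle) auto
    also have "g' \<dots> = differential A g p e \<bullet> dtrans d e p v"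
      using that by (intro differential_chart[OF assms(1) _ assms(2) _ g, symmetric]) auto
    finally show ?thesis .
  qed
  moreover have "differential A g p d = 0" if "\<not> (d \<in> A \<and> p \<in> fst d)" for d
    using that unfolding differential_def by (simp only: if_False)
  ultimately show ?thesis unfolding cotangent_space_def by blast
qed

section \<open>Cotangent charts and the topology of the cotangent bundle\<close>

lemma fst_TC: "fst (TC c) = {z. fst z \<in> topspace X \<inter> fst c \<and> snd z \<in> cotangent_space A (fst z)}"
  unfolding cotangent_chart_def cotangent_bundle_def by auto

lemma snd_TC: "snd (TC c) z = (snd c (fst z), snd z c)"
  by (simp add: cotangent_chart_def)

lemma TC_in: "c \<in> A \<Longrightarrow> TC c \<in> TA"
  by (simp add: cotangent_atlas_def)

text \<open>A covector is a family over all charts: its member at \<open>c\<close> determines those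
  at the other charts around the point by the transformation law, and the remaining members are 0 by
  convention.\<close>

lemma inj_on_TC:
  assumes c: "c \<in> A"
  shows "inj_on (snd (TC c)) (fst (TC c))"
proof (rule inj_onI)
  fix z w assume z: "z \<in> fst (TC c)" and w: "w \<in> fst (TC c)" and eq: "snd (TC c) z = snd (TC c) w"
  have p: "fst z = fst w"
    using eq z w inv_left[OF c] unfolding fst_TC snd_TC by (metis (mono_tags, lifting) IntD2 mem_Collect_eq prod.inject)
  have "snd z d = snd w d" for d
  proof (cases "d \<in> A \<and> fst z \<in> fst d")
    case True
    have "snd z d \<bullet> v = snd w d \<bullet> v" for v
    proof -
      have "snd x d \<bullet> v = snd x c \<bullet> dtrans d c (fst x) v" if "x \<in> fst (TC c)" "fst x \<in> fst d" for x
        using that True c unfolding fst_TC cotangent_space_def by blast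
      from this[OF z] this[OF w] have "snd z d \<bullet> v = snd z c \<bullet> dtrans d c (fst z) v"
        "snd w d \<bullet> v = snd w c \<bullet> dtrans d c (fst w) v"
        using True p by auto
      then show ?thesis using eq p by (simp add: snd_TC)
    qed
    then show ?thesis by (metis vector_eq_rdot)
  next
    case False
    then have "snd x d = 0" if "x \<in> fst (TC c)" "fst x = fst z" for x
      using that unfolding fst_TC cotangent_space_def by (metis (mono_tags, lifting) mem_Collect_eq)
    then show ?thesis using z w p by metis
  qed
  then show "z = w" using p by (auto simp: prod_eq_iff)
qed

lemma openin_TX:
  assumes "c \<in> A" "open W"
  shows "openin TX {z \<in> fst (TC c). snd (TC c) z \<in> W}"
proof -
  have "{z \<in> fst (TC c). snd (TC c) z \<in> W} \<in> {{z \<in> fst C. snd C z \<in> W} |C W. C \<in> TA \<and> open W}"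
    using assms TC_in by blast
  then show ?thesis
    unfolding cotangent_topology_def openin_topology_generated_by_iff
    by (rule generate_topology_on.Basis)
qed

lemma openin_TC: "c \<in> A \<Longrightarrow> openin TX (fst (TC c))"
  using openin_TX[of c UNIV] by simp

lemma TC_continuous:
  assumes c: "c \<in> A"
  shows "continuous_map (subtopology TX (fst (TC c))) euclidean (snd (TC c))"
  unfolding continuous_map_def
proof (intro conjI allI impI)
  fix W :: "('e \<times> 'e) set" assume "openin euclidean W"
  then have W: "openin TX {z \<in> fst (TC c). snd (TC c) z \<in> W}" using openin_TX[OF c] by simp
  have "{z \<in> topspace (subtopology TX (fst (TC c))). snd (TC c) z \<in> W} = {z \<in> fst (TC c). snd (TC c) z \<in> W}"
    using openin_subset[OF openin_TC[OF c]] by auto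
  then show "openin (subtopology TX (fst (TC c))) {z \<in> topspace (subtopology TX (fst (TC c))). snd (TC c) z \<in> W}"
    using W openin_open_subtopology[OF openin_TC[OF c]] by auto
qed auto

lemma topspace_TX: "topspace TX \<subseteq> cotangent_bundle X A"
  unfolding cotangent_topology_def topology_generated_by_topspace
  by (auto simp: cotangent_atlas_def cotangent_chart_def)

lemma chart_around:
  assumes "z \<in> topspace TX"
  obtains c where "c \<in> A" "z \<in> fst (TC c)"
proof -
  have z: "fst z \<in> topspace X" "snd z \<in> cotangent_space A (fst z)"
    using assms topspace_TX unfolding cotangent_bundle_def by auto
  then obtain c where "c \<in> A" "fst z \<in> fst c"
    using mfd unfolding smooth_manifold_def by auto
  then show thesis using that z by (auto simp: fst_TC)
qed

end

section \<open>Lagrangian submanifolds as graphs\<close>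

lemma line_in_open:
  fixes U :: "'v::real_normed_vector set"
  assumes "open U" "u \<in> U"
  obtains e :: real where "e > 0" "\<And>t. t \<in> {-e<..<e} \<Longrightarrow> u + t *\<^sub>R w \<in> U"
proof -
  have "continuous_on UNIV (\<lambda>t::real. u + t *\<^sub>R w)" by (intro continuous_intros)
  then have "open ((\<lambda>t::real. u + t *\<^sub>R w) -` U)"
    using assms(1) by (simp add: open_vimage)
  moreover have "0 \<in> (\<lambda>t::real. u + t *\<^sub>R w) -` U" using assms(2) by simp
  ultimately obtain e where "e > 0" "ball 0 e \<subseteq> (\<lambda>t::real. u + t *\<^sub>R w) -` U"
    using open_contains_ball by blast
  then show thesis by (intro that[of e]) (auto simp: dist_real_def subset_iff)
qed

text \<open>The witness curve is the image of the line \<open>u + t w\<close>. In this way the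
  Lagrangian condition, which is about velocities of curves, reaches the derivative of a
  parametrization.\<close>

lemma tangent_vector_of_map:
  fixes \<psi> :: "'v::euclidean_space \<Rightarrow> 'a" and C :: "('a, 'e::euclidean_space) chart"
  assumes "open U" "u \<in> U" and smooth: "smooth_on U (\<lambda>u. snd C (\<psi> u))" and M: "\<psi> ` U \<subseteq> M \<inter> fst C"
  shows "frechet_derivative (\<lambda>u. snd C (\<psi> u)) (at u) w \<in> tangent_vectors C M (\<psi> u)"
proof -
  let ?D = "frechet_derivative (\<lambda>u. snd C (\<psi> u)) (at u)"
  obtain e :: real where e: "e > 0" "\<And>t. t \<in> {-e<..<e} \<Longrightarrow> u + t *\<^sub>R w \<in> U"
    using line_in_open[OF assms(1,2)] by metis
  have "smooth_on {-e<..<e} (\<lambda>t. snd C (\<psi> (u + t *\<^sub>R w)))"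
    by (rule smooth_on_compose[OF _ smooth_on_affine smooth]) (use e(2) in auto)
  moreover have "((\<lambda>t. snd C (\<psi> (u + t *\<^sub>R w))) has_vector_derivative ?D w) (at 0)"
  proof -
    have "((\<lambda>t::real. u + t *\<^sub>R w) has_derivative (\<lambda>t. t *\<^sub>R w)) (at 0)"
      by (auto intro!: derivative_eq_intros)
    moreover have "((\<lambda>u. snd C (\<psi> u)) has_derivative ?D) (at (u + 0 *\<^sub>R w))"
      using smooth_on_has_derivative[OF smooth assms(2)] by simp
    ultimately have "((\<lambda>t. snd C (\<psi> (u + t *\<^sub>R w))) has_derivative (\<lambda>t. ?D (t *\<^sub>R w))) (at 0)"
      by (rule has_derivative_compose)
    then show ?thesis
      by (simp add: has_vector_derivative_def linear_cmul[OF smooth_on_linear_derivative[OF smooth assms(2)]])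
  qed
  ultimately show ?thesis
    unfolding tangent_vectors_def using e M
    by (intro CollectI exI[of _ "\<lambda>t. \<psi> (u + t *\<^sub>R w)"] exI[of _ e]) (auto simp: comp_def)
qed

lemma smooth_on_linear: "linear (L :: 'v::euclidean_space \<Rightarrow> 'w::real_normed_vector) \<Longrightarrow> open S \<Longrightarrow> smooth_on S L"
  using smooth_on_bounded_linear linear_conv_bounded_linear by blast

context smooth_mfd
begin

text \<open>A piece of \<open>\<Lambda>\<close> that is a graph over the variable \<open>z = \<xi> - s x\<close> in the cotangent chart of \<open>c\<close>.\<close>

definition lagrangian_graph where
  "lagrangian_graph c \<Lambda> B s a q \<longleftrightarrow> open B \<and> smooth_on B a \<and> continuous_map (top_of_set B) TX q \<and>
    (\<forall>z\<in>B. q z \<in> \<Lambda> \<inter> fst (TC c) \<and> snd (TC c) (q z) = (a z, s *\<^sub>R a z + z)) \<and>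
    (\<forall>W. open W \<longrightarrow> W \<subseteq> B \<longrightarrow> openin (subtopology TX \<Lambda>) (q ` W))"

lemma lagrangian_graph_subset:
  assumes "lagrangian_graph c \<Lambda> B s a q" "open B'" "B' \<subseteq> B"
  shows "lagrangian_graph c \<Lambda> B' s a q"
  using assms unfolding lagrangian_graph_def
  by (auto intro: smooth_on_subset continuous_map_from_subtopology_mono)

text \<open>A slice chart \<open>C\<close> parametrizes \<open>\<Lambda>\<close> near
  \<open>p\<close>, but the symplectic form is expressed in \<open>TC c\<close>. So the
  parametrization is carried over to \<open>TC c\<close> as \<open>\<phi>\<close> and then
  reparametrized by \<open>z\<close>, using the inverse function theorem for
  \<open>\<pi> \<circ> \<phi>\<close>.\<close>

lemma lagrangian_local_form:
  assumes lag: "lagrangian_submanifold X A \<Lambda>" and p: "p \<in> \<Lambda>" and c: "c \<in> A" and pc: "p \<in> fst (TC c)"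
  obtains B s a q z0 where "lagrangian_graph c \<Lambda> B s a q" "z0 \<in> B" "q z0 = p"
    "\<And>z v w. z \<in> B \<Longrightarrow> frechet_derivative a (at z) v \<bullet> w = frechet_derivative a (at z) w \<bullet> v"
proof -
  obtain C L where C: "C \<in> maximal_atlas TX TA" and pC: "p \<in> fst C" and L: "subspace L" "dim L = DIM('e)"
    and slice: "snd C ` (\<Lambda> \<inter> fst C) = snd C ` fst C \<inter> L"
    using lag p unfolding lagrangian_submanifold_def submanifold_def by blast
  have chC: "is_chart TX C" and comp: "compatible C (TC c)"
    using C TC_in[OF c] unfolding maximal_atlas_def by auto
  note injC = chart_inj[OF chC]
  have "\<exists>\<iota>. linear \<iota> \<and> \<iota> ` (UNIV :: 'e set) = L \<and> inj_on \<iota> UNIV"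
    using L by (intro subspace_isomorphism subspace_UNIV) auto
  \<comment> \<open>Identifying \<open>L\<close> with \<open>'e\<close> makes
    \<open>\<pi> \<circ> \<phi>\<close> a map between open sets of the same space, as the inverse
    function theorem requires.\<close>
  then obtain \<iota> :: "'e \<Rightarrow> 'e \<times> 'e" where \<iota>: "linear \<iota>" "range \<iota> = L" "inj \<iota>" by auto
  then obtain j where j: "linear j" "j \<circ> \<iota> = id" using linear_injective_left_inverse by blast
  define D where "D = snd C ` (fst C \<inter> fst (TC c))"
  have D: "open D" unfolding D_def using chart_open_image[OF chC openin_TC[OF c]] .
  define U where "U = \<iota> -` D"
  have U: "open U" unfolding U_def
    using D linear_continuous_on[of \<iota> UNIV] \<iota>(1) by (simp add: open_vimage linear_conv_bounded_linear)
  define Q where "Q = (\<lambda>u. chart_inv C (\<iota> u))"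
  have Q: "Q u \<in> \<Lambda>" "Q u \<in> fst C" "Q u \<in> fst (TC c)" "snd C (Q u) = \<iota> u" if u: "u \<in> U" for u
  proof -
    obtain x where x: "x \<in> fst C" "x \<in> fst (TC c)" "\<iota> u = snd C x" using u unfolding U_def D_def by auto
    have "Q u = x" using x chart_inv_left[OF injC] by (simp add: Q_def)
    then show "Q u \<in> fst C" "Q u \<in> fst (TC c)" "snd C (Q u) = \<iota> u" using x by auto
    have "snd C x \<in> snd C ` (\<Lambda> \<inter> fst C)" using slice x \<iota>(2) by (metis IntI imageI rangeI)
    then show "Q u \<in> \<Lambda>" using x \<open>Q u = x\<close> injC by (auto dest: inj_onD)
  qed
  define \<phi> where "\<phi> = (\<lambda>u. snd (TC c) (Q u))"
  have \<phi>: "smooth_on U \<phi>"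
  proof -
    have "smooth_on D (snd (TC c) \<circ> chart_inv C)" using comp unfolding compatible_def D_def by blast
    then have "smooth_on U (\<lambda>u. (snd (TC c) \<circ> chart_inv C) (\<iota> u))"
      using smooth_on_compose[OF U smooth_on_linear[OF \<iota>(1) U]] U_def by blast
    then show ?thesis by (simp add: \<phi>_def Q_def comp_def)
  qed
  \<comment> \<open>Passing back to the chart \<open>C\<close> turns \<open>\<phi>\<close> into the
    injective linear map \<open>\<iota>\<close>.\<close>
  have inj\<phi>: "v = 0" if u: "u \<in> U" and v: "frechet_derivative \<phi> (at u) v = 0" for u v
  proof -
    let ?T = "snd C \<circ> chart_inv (TC c)"
    have "smooth_on (snd (TC c) ` (fst C \<inter> fst (TC c))) ?T"
      using comp unfolding compatible_def by blast
    then have "(?T has_derivative frechet_derivative ?T (at (\<phi> u))) (at (\<phi> u))"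
      by (rule smooth_on_has_derivative) (use Q[OF u] in \<open>simp add: \<phi>_def\<close>)
    with smooth_on_has_derivative[OF \<phi> u]
    have "((\<lambda>x. ?T (\<phi> x)) has_derivative
        (\<lambda>v. frechet_derivative ?T (at (\<phi> u)) (frechet_derivative \<phi> (at u) v))) (at u)"
      by (rule has_derivative_compose)
    then have "(\<iota> has_derivative
        (\<lambda>v. frechet_derivative ?T (at (\<phi> u)) (frechet_derivative \<phi> (at u) v))) (at u)"
      by (rule has_derivative_transform_within_open[OF _ U u])
        (simp add: \<phi>_def chart_inv_left[OF inj_on_TC[OF c]] Q)
    moreover have "(\<iota> has_derivative \<iota>) (at u)"
      using \<iota>(1) by (simp add: linear_imp_has_derivative)
    ultimately have "\<iota> v = frechet_derivative ?T (at (\<phi> u)) (frechet_derivative \<phi> (at u) v)"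
      using has_derivative_unique by metis
    moreover have "linear (frechet_derivative ?T (at (\<phi> u)))"
      using \<open>(?T has_derivative _) _\<close> has_derivative_linear by blast
    ultimately have "\<iota> v = 0" using v by (simp add: linear_0)
    then show "v = 0" using \<iota> by (simp add: linear_injective_0)
  qed
  have iso\<phi>: "symplectic_form (frechet_derivative \<phi> (at u) v) (frechet_derivative \<phi> (at u) w) = 0"
    if u: "u \<in> U" for u v w
  proof -
    have "frechet_derivative \<phi> (at u) v \<in> tangent_vectors (TC c) \<Lambda> (Q u)" for v
      unfolding \<phi>_def by (rule tangent_vector_of_map[OF U u]) (use \<phi> Q in \<open>auto simp: \<phi>_def\<close>)
    then show ?thesis
      using lag Q[OF u] TC_in[OF c] unfolding lagrangian_submanifold_def by blast
  qed
  have "snd C p \<in> L" using slice p pC by blast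
  then obtain u0 where u0: "\<iota> u0 = snd C p" using \<iota>(2) by auto
  then have u0U: "u0 \<in> U" using pc pC by (auto simp: U_def D_def)
  have Qu0: "Q u0 = p" using u0 chart_inv_left[OF injC pC] by (simp add: Q_def)
  obtain s where s: "\<And>v. snd (frechet_derivative \<phi> (at u0) v) = s *\<^sub>R fst (frechet_derivative \<phi> (at u0) v) \<Longrightarrow> v = 0"
    using isotropic_transverse_slope[of "frechet_derivative \<phi> (at u0)"] inj\<phi>[OF u0U] iso\<phi>[OF u0U] by metis
  define \<pi> where "\<pi> = (\<lambda>y::'e \<times> 'e. snd y - s *\<^sub>R fst y)"
  have \<pi>: "bounded_linear \<pi>"
    unfolding \<pi>_def
    by (intro bounded_linear_sub bounded_linear_snd bounded_linear_const_scaleR bounded_linear_fst)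
  have F: "smooth_on U (\<lambda>u. \<pi> (\<phi> u))" using smooth_on_bounded_linear_compose[OF \<pi> U \<phi>] .
  have F': "frechet_derivative (\<lambda>u. \<pi> (\<phi> u)) (at u) = (\<lambda>v. \<pi> (frechet_derivative \<phi> (at u) v))" if "u \<in> U" for u
    using bounded_linear.has_derivative[OF \<pi> smooth_on_has_derivative[OF \<phi> that]]
    by (rule frechet_derivative_eq)
  \<comment> \<open>The choice of \<open>s\<close> says that no nonzero tangent vector in the image
    of the derivative of \<open>\<phi>\<close> at \<open>u0\<close> lies in the kernel of
    \<open>\<pi>\<close>.\<close>
  have "v = 0" if "frechet_derivative (\<lambda>u. \<pi> (\<phi> u)) (at u0) v = 0" for v
    using that s[of v] unfolding F'[OF u0U] by (simp add: \<pi>_def)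
  then obtain U' B G where U': "open U'" "U' \<subseteq> U" "u0 \<in> U'" and B: "open B"
    and hom: "homeomorphism U' B (\<lambda>u. \<pi> (\<phi> u)) G" and G: "smooth_on B G"
    using smooth_inverse_function[OF U F u0U] by metis
  have GU: "G z \<in> U'" "G z \<in> U" "\<pi> (\<phi> (G z)) = z" if "z \<in> B" for z
    using hom that U'(2) by (auto simp: homeomorphism_def)
  define a where "a = (\<lambda>z. fst (\<phi> (G z)))"
  define q where "q = (\<lambda>z. Q (G z))"
  have \<phi>G: "smooth_on B (\<lambda>z. \<phi> (G z))"
    using smooth_on_compose[OF B G \<phi>] GU by blast
  then have a: "smooth_on B a"
    unfolding a_def using smooth_on_bounded_linear_compose[OF bounded_linear_fst B] by blast
  have \<phi>G_eq: "\<phi> (G z) = (a z, s *\<^sub>R a z + z)" if "z \<in> B" for z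
    using GU(3)[OF that] by (auto simp: \<pi>_def a_def prod_eq_iff algebra_simps)
  have graph: "lagrangian_graph c \<Lambda> B s a q"
    unfolding lagrangian_graph_def
  proof (intro conjI allI impI ballI B a)
    have "continuous_map (top_of_set B) (top_of_set (snd C ` fst C)) (\<lambda>z. \<iota> (G z))"
    proof -
      have "continuous_on B (\<lambda>z. \<iota> (G z))"
        using smooth_on_continuous[OF G] \<iota>(1) linear_conv_bounded_linear bounded_linear.continuous_on by blast
      moreover have "\<iota> (G z) \<in> snd C ` fst C" if "z \<in> B" for z
        using GU(2)[OF that] by (auto simp: U_def D_def)
      ultimately show ?thesis by (auto simp: continuous_map_in_subtopology)
    qed
    then show "continuous_map (top_of_set B) TX q"
      using continuous_map_compose[OF _ chart_inv_continuous[OF chC]] unfolding q_def Q_def comp_def by blast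
  next
    fix z assume z: "z \<in> B"
    show "q z \<in> \<Lambda> \<inter> fst (TC c)" using Q[OF GU(2)[OF z]] by (simp add: q_def)
    show "snd (TC c) (q z) = (a z, s *\<^sub>R a z + z)" using \<phi>G_eq[OF z] by (simp add: \<phi>_def q_def)
  next
    fix W assume W: "open W" "W \<subseteq> B"
    have "G ` W = {u \<in> U'. \<pi> (\<phi> u) \<in> W}"
      using hom W(2) by (force simp: homeomorphism_def)
    then have "open (G ` W)"
      using continuous_open_preimage[OF _ U'(1) W(1), of "\<lambda>u. \<pi> (\<phi> u)"] hom
      by (auto simp: homeomorphism_def vimage_def Int_def)
    \<comment> \<open>The left inverse \<open>j\<close> of \<open>\<iota>\<close> thickens an open
      set of parameters to an open set of the ambient coordinate space that meets \<open>L\<close>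
      in the same parameters.\<close>
    then have "open (j -` (G ` W))"
      using j(1) linear_continuous_on[of j UNIV] by (simp add: open_vimage linear_conv_bounded_linear)
    then have "openin TX {z \<in> fst C. snd C z \<in> j -` (G ` W)}"
      using chart_openin_preimage[OF chC] by blast
    moreover have "q ` W = {z \<in> fst C. snd C z \<in> j -` (G ` W)} \<inter> \<Lambda>"
    proof (intro set_eqI iffI)
      fix x assume "x \<in> q ` W"
      then obtain z where z: "z \<in> W" "x = Q (G z)" by (auto simp: q_def)
      then have "G z \<in> U" using GU W by auto
      then show "x \<in> {z \<in> fst C. snd C z \<in> j -` (G ` W)} \<inter> \<Lambda>"
        using Q[of "G z"] z j(2) by (auto simp: fun_eq_iff)
    next
      fix x assume x: "x \<in> {z \<in> fst C. snd C z \<in> j -` (G ` W)} \<inter> \<Lambda>"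
      then have "snd C x \<in> L" using slice by blast
      then obtain u where u: "snd C x = \<iota> u" using \<iota>(2) by auto
      then have "u \<in> G ` W" using x j(2) by (simp add: fun_eq_iff)
      moreover have "Q u = x" using u x chart_inv_left[OF injC, of x] by (simp add: Q_def)
      ultimately show "x \<in> q ` W" by (auto simp: q_def)
    qed
    ultimately show "openin (subtopology TX \<Lambda>) (q ` W)"
      by (auto simp: openin_subtopology)
  qed
  have sym: "frechet_derivative a (at z) v \<bullet> w = frechet_derivative a (at z) w \<bullet> v" if z: "z \<in> B" for z v w
  proof -
    let ?a = "frechet_derivative a (at z)"
    have "((\<lambda>z. (a z, s *\<^sub>R a z + z)) has_derivative (\<lambda>v. (?a v, s *\<^sub>R ?a v + v))) (at z)"
      by (intro has_derivative_Pair has_derivative_add has_derivative_scaleR_right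
          has_derivative_ident smooth_on_has_derivative[OF a z])
    then have 1: "((\<lambda>z. \<phi> (G z)) has_derivative (\<lambda>v. (?a v, s *\<^sub>R ?a v + v))) (at z)"
      by (rule has_derivative_transform_within_open[OF _ B z]) (simp add: \<phi>G_eq)
    have 2: "((\<lambda>z. \<phi> (G z)) has_derivative
        (\<lambda>v. frechet_derivative \<phi> (at (G z)) (frechet_derivative G (at z) v))) (at z)"
      using smooth_on_has_derivative[OF G z] smooth_on_has_derivative[OF \<phi> GU(2)[OF z]]
      by (rule has_derivative_compose)
    \<comment> \<open>The terms with \<open>s\<close> cancel, so isotropy of the graph is exactly
      symmetry of \<open>?a\<close>.\<close>
    have "symplectic_form (?a v, s *\<^sub>R ?a v + v) (?a w, s *\<^sub>R ?a w + w) = 0" for v w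
      using has_derivative_unique[OF 1 2] iso\<phi>[OF GU(2)[OF z]] by metis
    then show ?thesis
      by (simp add: symplectic_form_def algebra_simps inner_commute)
  qed
  have "\<pi> (\<phi> u0) \<in> B" "G (\<pi> (\<phi> u0)) = u0" using hom U'(3) by (auto simp: homeomorphism_def)
  then show thesis using that[OF graph, of "\<pi> (\<phi> u0)"] sym Qu0 by (simp add: q_def)
qed

end

section \<open>Coordinates adapted to a submanifold of a Lagrangian\<close>

lemma span_coordinates:
  fixes b :: "nat \<Rightarrow> 'e::euclidean_space"
  assumes b: "bij_betw b {..<DIM('e)} Basis" and l: "l \<le> DIM('e)"
  shows "span (b ` {l..<DIM('e)}) = {v. \<forall>i<l. v \<bullet> b i = 0}"
proof
  have inB: "b i \<in> Basis" if "i < DIM('e)" for i using b that by (auto simp: bij_betw_def)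
  have orth: "b i \<bullet> b j = 0" if "i < DIM('e)" "j < DIM('e)" "i \<noteq> j" for i j
    using inner_not_same_Basis[OF inB inB] b that by (auto simp: bij_betw_def dest: inj_onD)
  show "span (b ` {l..<DIM('e)}) \<subseteq> {v. \<forall>i<l. v \<bullet> b i = 0}"
  proof (rule span_minimal)
    show "subspace {v. \<forall>i<l. v \<bullet> b i = 0}"
      by (auto simp: subspace_def inner_add_left)
    show "b ` {l..<DIM('e)} \<subseteq> {v. \<forall>i<l. v \<bullet> b i = 0}" using orth l by auto
  qed
  show "{v. \<forall>i<l. v \<bullet> b i = 0} \<subseteq> span (b ` {l..<DIM('e)})"
  proof
    fix v assume v: "v \<in> {v. \<forall>i<l. v \<bullet> b i = 0}"
    have "v = (\<Sum>i\<in>Basis. (v \<bullet> i) *\<^sub>R i)" by (simp add: euclidean_representation)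
    also have "\<dots> = (\<Sum>j<DIM('e). (v \<bullet> b j) *\<^sub>R b j)"
      using sum.reindex_bij_betw[OF b, of "\<lambda>i. (v \<bullet> i) *\<^sub>R i"] by simp
    also have "\<dots> \<in> span (b ` {l..<DIM('e)})"
    proof (rule span_sum)
      fix j assume "j \<in> {..<DIM('e)}"
      then show "(v \<bullet> b j) *\<^sub>R b j \<in> span (b ` {l..<DIM('e)})"
        using v by (cases "j < l") (auto intro!: span_zero span_scale intro: span_base)
    qed
    finally show "v \<in> span (b ` {l..<DIM('e)})" .
  qed
qed

text \<open>Extend a basis of \<open>L\<close> to one of \<open>M\<close>; send the part in
  \<open>L\<close> to the last coordinate vectors and the rest to the first ones. The codimension
  comes first because the equations of \<open>\<Sigma>\<close> are to be numbered from 0.\<close>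

lemma linear_onto_coordinates:
  fixes M L :: "'v::euclidean_space set" and b :: "nat \<Rightarrow> 'e::euclidean_space"
  assumes b: "bij_betw b {..<DIM('e)} Basis" and M: "subspace M" "dim M = DIM('e)"
    and L: "subspace L" "L \<subseteq> M"
  obtains R :: "'v \<Rightarrow> 'e" where "linear R" "R ` M = UNIV"
    "R ` L = {v. \<forall>i<DIM('e) - dim L. v \<bullet> b i = 0}"
proof -
  let ?n = "DIM('e)"
  obtain BL where BL: "BL \<subseteq> L" "independent BL" "L \<subseteq> span BL" "card BL = dim L"
    using basis_exists by blast
  obtain BM where BM: "BL \<subseteq> BM" "BM \<subseteq> M" "independent BM" "M \<subseteq> span BM"
    using maximal_independent_subset_extend[of BL M] BL L by blast
  have fin: "finite BL" "finite BM" using BL(2) BM(3) by (simp_all add: independent_imp_finite)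
  have cardM: "card BM = ?n" using BM M(2) basis_card_eq_dim by metis
  have k: "dim L \<le> ?n" using BL BM cardM fin by (metis card_mono)
  have injb: "inj_on b {..<?n}" and imb: "b ` {..<?n} = Basis" using b by (auto simp: bij_betw_def)
  have "card (b ` {?n - dim L..<?n}) = dim L"
    using k by (subst card_image) (auto intro: inj_on_subset[OF injb])
  then obtain g where g: "bij_betw g BL (b ` {?n - dim L..<?n})"
    using finite_same_card_bij[of BL "b ` {?n - dim L..<?n}"] fin BL(4) by auto
  have "card (b ` {..<?n - dim L}) = ?n - dim L"
    by (subst card_image) (auto intro: inj_on_subset[OF injb])
  moreover have "card (BM - BL) = ?n - dim L" using fin BM BL cardM by (simp add: card_Diff_subset)
  ultimately obtain h where h: "bij_betw h (BM - BL) (b ` {..<?n - dim L})"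
    using finite_same_card_bij[of "BM - BL" "b ` {..<?n - dim L}"] fin by auto
  obtain R where R: "linear R" "\<And>x. x \<in> BM \<Longrightarrow> R x = (if x \<in> BL then g x else h x)"
    using linear_independent_extend[OF BM(3), of "\<lambda>x. if x \<in> BL then g x else h x"] by blast
  have RL: "R ` BL = b ` {?n - dim L..<?n}"
  proof -
    have "R ` BL = g ` BL" using BM(1) by (intro image_cong) (auto simp: R(2))
    then show ?thesis using g by (simp add: bij_betw_def)
  qed
  have "R ` (BM - BL) = b ` {..<?n - dim L}"
  proof -
    have "R ` (BM - BL) = h ` (BM - BL)" by (rule image_cong) (auto simp: R(2))
    then show ?thesis using h by (simp add: bij_betw_def)
  qed
  moreover have "BM = BL \<union> (BM - BL)" "{..<?n} = {?n - dim L..<?n} \<union> {..<?n - dim L}" using BM(1) by auto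
  ultimately have RM: "R ` BM = Basis" using RL imb by (metis image_Un)
  have "span BM = M" "span BL = L"
    using BM BL M(1) L(1) span_minimal by (metis subset_antisym)+
  then have "R ` M = UNIV" "R ` L = span (b ` {?n - dim L..<?n})"
    using linear_span_image[OF R(1), of BM] linear_span_image[OF R(1), of BL] RM RL by auto
  then show thesis
    using that[OF R(1)] span_coordinates[OF b, of "?n - dim L"] by simp
qed

context smooth_mfd
begin

text \<open>In the chart \<open>C\<close> the set \<open>\<Sigma>\<close> becomes the plane
  \<open>L\<close>, but \<open>\<Lambda>\<close> becomes the curved image of
  \<open>\<theta>\<close>. The linear map \<open>R\<close> is an isomorphism from the tangent space
  of this image at \<open>\<theta> z0\<close> onto \<open>'e\<close> and takes \<open>L\<close> to a
  coordinate plane, so \<open>\<psi> = R \<circ> \<theta>\<close> is a local diffeomorphism. That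
  \<open>\<psi> z\<close> in \<open>R L\<close> forces \<open>\<theta> z\<close> into
  \<open>L\<close> is the delicate direction: the \<open>y\<close> in \<open>L\<close> with
  \<open>R y = \<psi> z\<close> must itself be a value of \<open>\<theta>\<close>, after which
  injectivity of \<open>\<psi>\<close> applies.\<close>

lemma adapted_coordinates:
  fixes b :: "nat \<Rightarrow> 'e"
  assumes graph: "lagrangian_graph c \<Lambda> B s a q" and c: "c \<in> A" and z0: "z0 \<in> B" "q z0 \<in> \<Sigma>"
    and \<Sigma>: "\<Sigma> \<subseteq> \<Lambda>" "submanifold TX TA k \<Sigma>" and b: "bij_betw b {..<DIM('e)} Basis"
  obtains B' l \<psi> where "open B'" "z0 \<in> B'" "B' \<subseteq> B" "l \<le> DIM('e)" "smooth_on B' \<psi>"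
    "\<And>z. z \<in> B' \<Longrightarrow> bij (frechet_derivative \<psi> (at z))"
    "\<And>z. z \<in> B' \<Longrightarrow> q z \<in> \<Sigma> \<longleftrightarrow> (\<forall>i<l. \<psi> z \<bullet> b i = 0)"
proof -
  have B: "open B" and a: "smooth_on B a" and contq: "continuous_map (top_of_set B) TX q"
    and q: "\<And>z. z \<in> B \<Longrightarrow> q z \<in> \<Lambda>" "\<And>z. z \<in> B \<Longrightarrow> q z \<in> fst (TC c)"
      "\<And>z. z \<in> B \<Longrightarrow> snd (TC c) (q z) = (a z, s *\<^sub>R a z + z)"
    and q_open: "\<And>W. open W \<Longrightarrow> W \<subseteq> B \<Longrightarrow> openin (subtopology TX \<Lambda>) (q ` W)"
    using graph unfolding lagrangian_graph_def by auto
  obtain C L where C: "C \<in> maximal_atlas TX TA" and pC: "q z0 \<in> fst C" and L: "subspace L" "dim L = k"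
    and slice: "snd C ` (\<Sigma> \<inter> fst C) = snd C ` fst C \<inter> L"
    using \<Sigma>(2) z0(2) unfolding submanifold_def by blast
  have chC: "is_chart TX C" and comp: "compatible C (TC c)"
    using C TC_in[OF c] unfolding maximal_atlas_def by auto
  note injC = chart_inj[OF chC]
  have slice_iff: "x \<in> \<Sigma> \<longleftrightarrow> snd C x \<in> L" if "x \<in> fst C" for x
  proof
    assume "snd C x \<in> L"
    then have "snd C x \<in> snd C ` (\<Sigma> \<inter> fst C)" using that unfolding slice by simp
    then obtain y where "y \<in> \<Sigma> \<inter> fst C" "snd C x = snd C y" by blast
    then show "x \<in> \<Sigma>" using injC that by (auto dest: inj_onD)
  qed (use slice that in blast)
  define \<pi> where "\<pi> = (\<lambda>y::'e \<times> 'e. snd y - s *\<^sub>R fst y)"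
  have \<pi>: "bounded_linear \<pi>"
    unfolding \<pi>_def
    by (intro bounded_linear_sub bounded_linear_snd bounded_linear_const_scaleR bounded_linear_fst)
  have \<pi>q: "\<pi> (snd (TC c) (q z)) = z" if "z \<in> B" for z using q(3)[OF that] by (simp add: \<pi>_def)
  define B1 where "B1 = {z \<in> B. q z \<in> fst C}"
  have "openin TX (fst C)" using chC by (simp add: is_chart_def)
  then have "openin (top_of_set B) B1"
    using openin_continuous_map_preimage[OF contq, of "fst C"] unfolding B1_def by simp
  then have B1: "open B1" using B openin_open_trans by blast
  have B1B: "B1 \<subseteq> B" and z0B1: "z0 \<in> B1" using z0 pC by (auto simp: B1_def)
  define D where "D = snd C ` (fst C \<inter> fst (TC c))"
  \<comment> \<open>A smooth left inverse of \<open>\<theta>\<close> on an open set of the ambient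
    coordinates: it reads off \<open>z = \<xi> - s x\<close>.\<close>
  define N where "N = (\<lambda>y. \<pi> ((snd (TC c) \<circ> chart_inv C) y))"
  have D: "open D" unfolding D_def using chart_open_image[OF chC openin_TC[OF c]] .
  have N: "smooth_on D N"
    unfolding N_def using comp
    by (intro smooth_on_bounded_linear_compose[OF \<pi> D]) (simp add: compatible_def D_def del: comp_apply)
  define \<theta> where "\<theta> = (\<lambda>z. snd C (q z))"
  have \<theta>D: "\<theta> z \<in> D" and N\<theta>: "N (\<theta> z) = z" if "z \<in> B1" for z
    using that B1B q(2)[of z] \<pi>q[of z] by (auto simp: \<theta>_def D_def B1_def N_def chart_inv_left[OF injC])
  have \<theta>: "smooth_on B1 \<theta>"
  proof -
    have 1: "smooth_on (snd (TC c) ` (fst C \<inter> fst (TC c))) (snd C \<circ> chart_inv (TC c))"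
      using comp by (simp add: compatible_def)
    have 2: "smooth_on B1 (\<lambda>z. (a z, s *\<^sub>R a z + z))"
      using smooth_on_subset[OF a B1B] by (intro smooth_intros B1)
    have 3: "(\<lambda>z. (a z, s *\<^sub>R a z + z)) ` B1 \<subseteq> snd (TC c) ` (fst C \<inter> fst (TC c))"
      using q(2,3) by (force simp: B1_def)
    have 4: "(snd C \<circ> chart_inv (TC c)) (a z, s *\<^sub>R a z + z) = \<theta> z" if "z \<in> B1" for z
      using that B1B q(2,3)[of z] chart_inv_left[OF inj_on_TC[OF c], of "q z"] by (auto simp: \<theta>_def)
    show ?thesis
      by (rule smooth_on_cong[OF B1 4, THEN iffD1, OF _ smooth_on_compose[OF B1 2 1 3]])
  qed
  define D\<theta> where "D\<theta> = frechet_derivative \<theta> (at z0)"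
  have D\<theta>: "(\<theta> has_derivative D\<theta>) (at z0)" "linear D\<theta>"
    unfolding D\<theta>_def using smooth_on_has_derivative[OF \<theta> z0B1] has_derivative_linear by auto
  define DN where "DN = frechet_derivative N (at (\<theta> z0))"
  have DN: "(N has_derivative DN) (at (\<theta> z0))"
    unfolding DN_def using smooth_on_has_derivative[OF N \<theta>D[OF z0B1]] .
  have ND: "DN (D\<theta> v) = v" for v
  proof -
    have "((\<lambda>z. N (\<theta> z)) has_derivative (\<lambda>v. DN (D\<theta> v))) (at z0)"
      by (rule has_derivative_compose[OF D\<theta>(1) DN])
    then have "((\<lambda>z. z) has_derivative (\<lambda>v. DN (D\<theta> v))) (at z0)"
      by (rule has_derivative_transform_within_open[OF _ B1 z0B1]) (simp add: N\<theta>)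
    from has_derivative_unique[OF this has_derivative_ident] show ?thesis by metis
  qed
  then have injD\<theta>: "inj D\<theta>" by (metis injI)
  \<comment> \<open>An ambient neighbourhood in which \<open>\<Lambda>\<close> consists of the graph
    alone. Points of \<open>\<Sigma>\<close> in it therefore come from \<open>B1\<close>, and other
    sheets of \<open>\<Lambda>\<close> are excluded.\<close>
  obtain W where W: "openin TX W" "q ` B1 = W \<inter> \<Lambda>"
    using q_open[OF B1 B1B] by (auto simp: openin_subtopology)
  define D' where "D' = snd C ` (fst C \<inter> (fst (TC c) \<inter> W))"
  have D': "open D'" "D' \<subseteq> D"
    unfolding D'_def D_def using chart_open_image[OF chC openin_Int[OF openin_TC[OF c] W(1)]] by auto
  have z0D': "\<theta> z0 \<in> D'"
    using z0B1 W(2) q(2)[OF z0(1)] pC by (auto simp: D'_def \<theta>_def)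
  have \<theta>N: "N y \<in> B1 \<and> \<theta> (N y) = y" if y: "y \<in> D'" "y \<in> L" for y
  proof -
    obtain x where x: "x \<in> fst C" "x \<in> W" "y = snd C x" using y(1) by (auto simp: D'_def)
    then have "x \<in> \<Sigma>" using slice_iff y(2) by auto
    then have "x \<in> q ` B1" using W(2) x(2) \<Sigma>(1) by auto
    then obtain z where "z \<in> B1" "y = \<theta> z" using x(3) by (auto simp: \<theta>_def)
    then show ?thesis using N\<theta> by auto
  qed
  have \<theta>0L: "\<theta> z0 \<in> L" using slice_iff[OF pC] z0(2) by (simp add: \<theta>_def)
  \<comment> \<open>Near \<open>\<theta> z0\<close> the points \<open>y\<close> of \<open>L\<close>
    satisfy \<open>\<theta> (N y) = y\<close>; differentiating along a line in \<open>L\<close> puts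
    its direction into the range of \<open>D\<theta>\<close>.\<close>
  have LM: "L \<subseteq> range D\<theta>"
  proof
    fix w assume w: "w \<in> L"
    obtain e :: real where e: "e > 0" "\<And>t. t \<in> {-e<..<e} \<Longrightarrow> \<theta> z0 + t *\<^sub>R w \<in> D'"
      using line_in_open[OF D'(1) z0D'] by metis
    have 1: "((\<lambda>t::real. \<theta> z0 + t *\<^sub>R w) has_derivative (\<lambda>t. t *\<^sub>R w)) (at 0)"
      by (auto intro!: derivative_eq_intros)
    then have "((\<lambda>t. N (\<theta> z0 + t *\<^sub>R w)) has_derivative (\<lambda>t. DN (t *\<^sub>R w))) (at 0)"
      by (rule has_derivative_compose) (simp add: DN)
    then have "((\<lambda>t. \<theta> (N (\<theta> z0 + t *\<^sub>R w))) has_derivative (\<lambda>t. D\<theta> (DN (t *\<^sub>R w)))) (at 0)"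
      by (rule has_derivative_compose) (simp add: N\<theta>[OF z0B1] D\<theta>)
    then have "((\<lambda>t::real. \<theta> z0 + t *\<^sub>R w) has_derivative (\<lambda>t. D\<theta> (DN (t *\<^sub>R w)))) (at 0)"
    proof (rule has_derivative_transform_within_open)
      fix t assume "t \<in> {-e<..<e}"
      then show "\<theta> (N (\<theta> z0 + t *\<^sub>R w)) = \<theta> z0 + t *\<^sub>R w"
        using \<theta>N[OF e(2)] subspace_add[OF L(1) \<theta>0L subspace_scale[OF L(1) w]] by blast
    qed (use e(1) in auto)
    from has_derivative_unique[OF 1 this] have "w = D\<theta> (DN w)" by (metis scaleR_one)
    then show "w \<in> range D\<theta>" by blast
  qed
  have dimM: "subspace (range D\<theta>)" "dim (range D\<theta>) = DIM('e)"
    using D\<theta>(2) injD\<theta> by (auto simp: linear_subspace_image dim_image_eq)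
  define l where "l = DIM('e) - dim L"
  obtain R where R: "linear R" "R ` range D\<theta> = (UNIV :: 'e set)"
    "R ` L = {v. \<forall>i<l. v \<bullet> b i = 0}"
    by (rule linear_onto_coordinates[OF b dimM L(1) LM, folded l_def])
  have linRD: "linear (\<lambda>v. R (D\<theta> v))"
    using linear_compose[OF D\<theta>(2) R(1)] by (simp add: comp_def)
  have surjRD: "surj (\<lambda>v. R (D\<theta> v))"
    using R(2) by (simp add: image_image)
  then have injRD: "inj (\<lambda>v. R (D\<theta> v))"
    using linear_surjective_imp_injective[OF linRD] by blast
  \<comment> \<open>\<open>J\<close> inverts \<open>R\<close> on \<open>range D\<theta>\<close>, so
    it recovers a point \<open>y\<close> of \<open>L\<close> from \<open>R y\<close>.\<close>
  define J where "J = (\<lambda>v. D\<theta> (inv (\<lambda>v. R (D\<theta> v)) v))"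
  have contJ: "continuous_on UNIV J"
  proof -
    have "linear (inv (\<lambda>v. R (D\<theta> v)))"
      using inj_linear_imp_inv_bounded_linear[OF _ injRD] linRD by (simp add: linear_conv_bounded_linear)
    then have "linear J" unfolding J_def using linear_compose[OF _ D\<theta>(2)] by (auto simp: comp_def)
    then show ?thesis by (simp add: linear_continuous_on linear_conv_bounded_linear)
  qed
  have JR: "J (R y) = y" if "y \<in> range D\<theta>" for y
    using that inv_f_f[OF injRD] by (auto simp: J_def)
  define \<psi> where "\<psi> = (\<lambda>z. R (\<theta> z))"
  have \<psi>: "smooth_on B1 \<psi>"
    unfolding \<psi>_def using R(1)
    by (intro smooth_on_bounded_linear_compose[OF _ B1 \<theta>]) (simp add: linear_conv_bounded_linear)
  have "bounded_linear R" using R(1) by (simp add: linear_conv_bounded_linear)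
  then have D\<psi>: "frechet_derivative \<psi> (at z0) = (\<lambda>v. R (D\<theta> v))"
    unfolding \<psi>_def by (rule frechet_derivative_eq[OF bounded_linear.has_derivative[OF _ D\<theta>(1)]])
  have "v = 0" if "frechet_derivative \<psi> (at z0) v = 0" for v
    using that injRD linRD unfolding D\<psi> by (simp add: linear_injective_0)
  then obtain U' V G where U': "open U'" "U' \<subseteq> B1" "z0 \<in> U'" and hom: "homeomorphism U' V \<psi> G"
    and bij: "\<And>z. z \<in> U' \<Longrightarrow> bij (frechet_derivative \<psi> (at z))"
    using smooth_inverse_function[OF B1 \<psi> z0B1] by metis
  have inj\<psi>: "z = w" if "z \<in> U'" "w \<in> U'" "\<psi> z = \<psi> w" for z w
    using that hom unfolding homeomorphism_def by metis
  define D2 where "D2 = {y \<in> D'. N y \<in> U'}"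
  have D2: "open D2"
    unfolding D2_def using continuous_open_preimage[OF continuous_on_subset[OF smooth_on_continuous[OF N] D'(2)] D'(1) U'(1)]
    by (simp add: vimage_def Int_def)
  \<comment> \<open>The shrinking ensures that a \<open>y\<close> in \<open>L\<close> with
    \<open>R y = \<psi> z\<close> lies in \<open>D'\<close>, where
    \<open>\<theta> (N y) = y\<close>, and that \<open>N y\<close> lies in \<open>U'\<close>, where
    \<open>\<psi>\<close> is injective.\<close>
  define B' where "B' = {z \<in> U'. J (\<psi> z) \<in> D2}"
  have "continuous_on U' (\<lambda>z. J (\<psi> z))"
    using continuous_on_compose2[OF contJ continuous_on_subset[OF smooth_on_continuous[OF \<psi>] U'(2)]] by auto
  then have B': "open B'"
    unfolding B'_def using continuous_open_preimage[OF _ U'(1) D2] by (simp add: vimage_def Int_def)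
  have "J (\<psi> z0) = \<theta> z0" using JR[OF subsetD[OF LM \<theta>0L]] by (simp add: \<psi>_def)
  then have z0B': "z0 \<in> B'"
    using U'(3) z0D' N\<theta>[OF z0B1] by (simp add: B'_def D2_def)
  have iff: "q z \<in> \<Sigma> \<longleftrightarrow> (\<forall>i<l. \<psi> z \<bullet> b i = 0)" if z: "z \<in> B'" for z
  proof -
    have zU: "z \<in> U'" "z \<in> B1" "q z \<in> fst C" using z U'(2) by (auto simp: B'_def B1_def)
    have "q z \<in> \<Sigma> \<longleftrightarrow> \<theta> z \<in> L" using slice_iff[OF zU(3)] by (simp add: \<theta>_def)
    also have "\<dots> \<longleftrightarrow> \<psi> z \<in> R ` L"
    proof
      assume "\<psi> z \<in> R ` L"
      then obtain y where y: "y \<in> L" "\<psi> z = R y" by auto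
      then have "J (\<psi> z) = y" using JR[OF subsetD[OF LM y(1)]] by simp
      then have "y \<in> D2" using z by (simp add: B'_def)
      then have y': "y \<in> D'" "N y \<in> U'" by (auto simp: D2_def)
      have "\<theta> (N y) = y" using \<theta>N[OF y'(1) y(1)] by simp
      then have "N y = z" using inj\<psi>[OF y'(2) zU(1)] y(2) by (simp add: \<psi>_def)
      then show "\<theta> z \<in> L" using \<open>\<theta> (N y) = y\<close> y(1) by simp
    qed (simp add: \<psi>_def)
    finally show ?thesis using R(3) by simp
  qed
  have "B' \<subseteq> U'" by (auto simp: B'_def)
  then show thesis
    by (intro that[OF B' z0B' _ _ smooth_on_subset[OF \<psi>] bij iff])
      (use U'(2) B1B in \<open>auto simp: l_def\<close>)
qed

end

section \<open>The phase function\<close>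

text \<open>The parameter space carries no norm, so smoothness is pulled back from a normed space
  along an affine \<open>T\<close> with linear part \<open>T0\<close>: directional derivatives of
  \<open>F \<circ> T\<close> along \<open>d\<close> are derivatives of \<open>F\<close> along
  \<open>T0 d\<close>.\<close>

lemma Ck_on_param_compose:
  fixes T T0 :: "'e::euclidean_space \<times> (nat \<Rightarrow> real) \<Rightarrow> 'v::real_normed_vector"
    and F :: "'v \<Rightarrow> 'w::real_normed_vector"
  assumes T: "\<And>z d t. T (line z d t) = T z + t *\<^sub>R T0 d"
    and cont: "continuous_on W T" and WM: "T ` W \<subseteq> M"
    and W: "\<And>z d. z \<in> W \<Longrightarrow> d \<in> UNIV \<times> topspace (Euclidean_space N) \<Longrightarrow>
      \<exists>e>0. \<forall>t\<in>{-e<..<e}. line z d t \<in> W"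
    and "Ck_on k M F" "\<And>z. z \<in> W \<Longrightarrow> g z = F (T z)"
  shows "Ck_on_param N k W g"
  using assms(5,6)
proof (induction k arbitrary: F g)
  case 0
  have "continuous_on W (\<lambda>z. F (T z))"
    using continuous_on_compose2[OF _ cont WM] 0 by auto
  then show ?case using 0 by (simp cong: continuous_on_cong)
next
  case (Suc k)
  have "continuous_on W (\<lambda>z. F (T z))"
    using continuous_on_compose2[OF Ck_on_continuous[OF Suc.prems(1)] cont WM] .
  then have "continuous_on W g" using Suc.prems(2) by (simp cong: continuous_on_cong)
  moreover have D: "((\<lambda>t. g (line z d t)) has_vector_derivative frechet_derivative F (at (T z)) (T0 d)) (at 0)"
    if z: "z \<in> W" and d: "d \<in> UNIV \<times> topspace (Euclidean_space N)" for z d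
  proof -
    let ?D = "frechet_derivative F (at (T z))"
    obtain e :: real where e: "e > 0" "\<And>t. t \<in> {-e<..<e} \<Longrightarrow> line z d t \<in> W"
      using W[OF z d] by blast
    have "((\<lambda>t::real. T z + t *\<^sub>R T0 d) has_derivative (\<lambda>t. t *\<^sub>R T0 d)) (at 0)"
      by (auto intro!: derivative_eq_intros)
    moreover have DF: "(F has_derivative ?D) (at (T z + 0 *\<^sub>R T0 d))"
      using Ck_on_has_derivative[OF Suc.prems(1), of "T z"] z WM by auto
    ultimately have "((\<lambda>t. F (T z + t *\<^sub>R T0 d)) has_derivative (\<lambda>t. ?D (t *\<^sub>R T0 d))) (at 0)"
      by (rule has_derivative_compose)
    moreover have "linear ?D" using DF has_derivative_linear by auto
    ultimately have "((\<lambda>t. F (T z + t *\<^sub>R T0 d)) has_derivative (\<lambda>t. t *\<^sub>R ?D (T0 d))) (at 0)"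
      by (simp add: linear_cmul)
    then have "((\<lambda>t. g (line z d t)) has_derivative (\<lambda>t. t *\<^sub>R ?D (T0 d))) (at 0)"
      by (rule has_derivative_transform_within_open[OF _ open_greaterThanLessThan[of "-e" e]])
        (use e in \<open>auto simp: Suc.prems(2) T\<close>)
    then show ?thesis by (simp add: has_vector_derivative_def)
  qed
  moreover have "Ck_on_param N k W (\<lambda>z. dir_deriv g z d)"
    if d: "d \<in> UNIV \<times> topspace (Euclidean_space N)" for d
  proof (rule Suc.IH[where F = "\<lambda>x. frechet_derivative F (at x) (T0 d)"])
    show "Ck_on k M (\<lambda>x. frechet_derivative F (at x) (T0 d))" using Suc.prems(1) by simp
    show "dir_deriv g z d = frechet_derivative F (at (T z)) (T0 d)" if "z \<in> W" for z
      unfolding dir_deriv_def using D[OF that d] by (rule vector_derivative_at)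
  qed
  ultimately show ?case
    unfolding Ck_on_param.simps by (blast intro: differentiableI_vector)
qed

text \<open>Surjectivity of the derivative of \<open>\<psi>\<close> is asked at points of
  \<open>\<Sigma>\<close> only, so that a constant \<open>\<psi>\<close> can serve where the piece
  of \<open>\<Lambda>\<close> misses \<open>\<Sigma>\<close>. \<open>\<mu>\<close> is the slope
  called \<open>s\<close> elsewhere; here \<open>s\<close> denotes the fibre variable.\<close>

locale phase_construction = smooth_mfd X A
  for X :: "'a topology" and A :: "('a, 'e::euclidean_space) chart set" +
  fixes c :: "('a, 'e) chart" and \<Lambda> \<Sigma> :: "('a, 'e) covector set" and B :: "'e set" and \<mu> :: real
    and a :: "'e \<Rightarrow> 'e" and q :: "'e \<Rightarrow> ('a, 'e) covector" and h :: "'e \<Rightarrow> real"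
    and \<psi> :: "'e \<Rightarrow> 'e" and n l :: nat and b :: "nat \<Rightarrow> 'e"
  assumes c: "c \<in> A" and graph: "lagrangian_graph c \<Lambda> B \<mu> a q"
    and h: "\<And>z. z \<in> B \<Longrightarrow> (h has_derivative (\<lambda>v. a z \<bullet> v)) (at z)"
    and \<psi>: "smooth_on B \<psi>" and b: "bij_betw b {..<n} Basis" and l: "l \<le> n"
    and \<Sigma>_iff: "\<And>z. z \<in> B \<Longrightarrow> q z \<in> \<Sigma> \<longleftrightarrow> (\<forall>i<l. \<psi> z \<bullet> b i = 0)"
    and \<Sigma>_surj: "\<And>z. z \<in> B \<Longrightarrow> q z \<in> \<Sigma> \<Longrightarrow> surj (frechet_derivative \<psi> (at z))"
begin

abbreviation "N \<equiv> n + l"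
abbreviation "V \<equiv> fst c"

text \<open>\<open>Z s\<close> and \<open>U s\<close> are the fibre variables \<open>z\<close> and
  \<open>u\<close> as vectors of \<open>'e\<close>; since \<open>l \<le> n\<close>, the vector
  \<open>u\<close> fits when padded with zeros.\<close>

definition Z :: "(nat \<Rightarrow> real) \<Rightarrow> 'e" where "Z s = (\<Sum>j<n. s j *\<^sub>R b j)"

definition U :: "(nat \<Rightarrow> real) \<Rightarrow> 'e" where "U s = (\<Sum>i<l. s (n + i) *\<^sub>R b i)"

text \<open>\<open>u\<close> is left unrestricted, which admits both \<open>u = \<psi> z\<close> for
  every \<open>z\<close> in \<open>B\<close> and \<open>u = 0\<close>.\<close>

definition S where "S = {s \<in> topspace (Euclidean_space N). Z s \<in> B}"

text \<open>The terms without \<open>\<psi>\<close> generate \<open>\<Lambda>\<close>; the squares add the equations \<open>u = \<psi>(z)\<close> to the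
  critical set and, vanishing there to second order, do not change the phase map.\<close>

definition f :: "'a \<times> (nat \<Rightarrow> real) \<Rightarrow> real" where
  "f = (\<lambda>(x, s). \<mu> / 2 * (snd c x \<bullet> snd c x) + snd c x \<bullet> Z s - h (Z s)
     + (\<Sum>i<l. (s (n + i) - \<psi> (Z s) \<bullet> b i)\<^sup>2) / 2)"

section \<open>Fibre coordinates and smoothness of the phase function\<close>

lemma B: "open B" and a: "smooth_on B a" and q_cont: "continuous_map (top_of_set B) TX q"
  and q: "z \<in> B \<Longrightarrow> q z \<in> \<Lambda>" "z \<in> B \<Longrightarrow> q z \<in> fst (TC c)"
    "z \<in> B \<Longrightarrow> snd (TC c) (q z) = (a z, \<mu> *\<^sub>R a z + z)"
  using graph unfolding lagrangian_graph_def by auto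

lemma b_inner: "i < n \<Longrightarrow> j < n \<Longrightarrow> b i \<bullet> b j = (if i = j then 1 else 0)"
  using inner_Basis[of "b i" "b j"] bij_betwE[OF b] inj_on_eq_iff[OF bij_betw_imp_inj_on[OF b], of i j]
  by auto

lemma b_expand: "v = (\<Sum>j<n. (v \<bullet> b j) *\<^sub>R b j)"
  using sum.reindex_bij_betw[OF b, of "\<lambda>i. (v \<bullet> i) *\<^sub>R i"] by (simp add: euclidean_representation)

lemma b_eqI: "(\<And>j. j < n \<Longrightarrow> v \<bullet> b j = w \<bullet> b j) \<Longrightarrow> v = w"
  using b_expand[of v] b_expand[of w] by simp

lemma Z_inner: "j < n \<Longrightarrow> Z s \<bullet> b j = s j"
  by (simp add: Z_def inner_sum_left b_inner if_distrib[of "(*) _"] sum.If_cases)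

lemma U_inner: "i < l \<Longrightarrow> U s \<bullet> b i = s (n + i)"
  using l by (simp add: U_def inner_sum_left b_inner if_distrib[of "(*) _"] sum.If_cases)

lemma Z_line: "Z (\<lambda>j. s j + t * d j) = Z s + t *\<^sub>R Z d"
  by (simp add: Z_def scaleR_left_distrib sum.distrib scaleR_sum_right)

lemma U_line: "U (\<lambda>j. s j + t * d j) = U s + t *\<^sub>R U d"
  by (simp add: U_def scaleR_left_distrib sum.distrib scaleR_sum_right)

lemma Z_upd: "j < n \<Longrightarrow> Z (s(j := t)) = Z s + (t - s j) *\<^sub>R b j"
proof (rule b_eqI)
  fix i assume "i < n" "j < n"
  then show "Z (s(j := t)) \<bullet> b i = (Z s + (t - s j) *\<^sub>R b j) \<bullet> b i"
    by (simp add: Z_inner inner_add_left b_inner)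
qed

lemma Z_upd': "Z (s(n + i := t)) = Z s"
  by (simp add: Z_def)

lemma continuous_Z: "continuous_on W Z" and continuous_U: "continuous_on W U"
  unfolding Z_def U_def by (auto intro!: continuous_intros continuous_on_product_coordinates[THEN continuous_on_subset])

lemma openin_S: "openin (Euclidean_space N) S"
proof -
  have "continuous_map (Euclidean_space N) euclidean Z"
    by (simp add: continuous_map_Euclidean_space_iff continuous_Z)
  from openin_continuous_map_preimage[OF this, of B] show ?thesis
    unfolding S_def using B by simp
qed

text \<open>The functions whose smoothness on a chart of \<open>X\<close> times \<open>S\<close> is
  claimed factor through this map, and on its Euclidean target \<open>smooth_on\<close> is
  available.\<close>

definition T :: "'e \<times> (nat \<Rightarrow> real) \<Rightarrow> 'e \<times> 'e \<times> 'e" where "T = (\<lambda>(y, s). (y, Z s, U s))"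

lemma T_line: "T (line z d t) = T z + t *\<^sub>R T d"
  by (simp add: T_def line_def split_def Z_line U_line)

lemma continuous_T: "continuous_on W T"
  unfolding T_def split_def
  by (intro continuous_intros continuous_on_compose2[OF continuous_Z[of UNIV]]
      continuous_on_compose2[OF continuous_U[of UNIV]]) auto

abbreviation "ov d \<equiv> snd d ` (fst d \<inter> V)"

lemma ov_open: "d \<in> A \<Longrightarrow> open (ov d)"
  using overlap_open chart_open c by blast

lemma line_in_dom:
  assumes "d \<in> A" "z \<in> dom_in_chart d V S" "v \<in> UNIV \<times> topspace (Euclidean_space N)"
  shows "\<exists>e>0. \<forall>t\<in>{-e<..<e}. line z v t \<in> dom_in_chart d V S"
proof -
  have "open (ov d \<times> B)" using ov_open[OF assms(1)] B by (rule open_Times)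
  moreover have "(fst z, Z (snd z)) \<in> ov d \<times> B"
    using assms(2) by (auto simp: dom_in_chart_def S_def)
  ultimately obtain e :: real where e: "e > 0"
    "\<And>t. t \<in> {-e<..<e} \<Longrightarrow> (fst z, Z (snd z)) + t *\<^sub>R (fst v, Z (snd v)) \<in> ov d \<times> B"
    using line_in_open by metis
  have "line z v t \<in> dom_in_chart d V S" if "t \<in> {-e<..<e}" for t
  proof -
    have "(\<lambda>j. snd z j + t * snd v j) \<in> topspace (Euclidean_space N)"
      using assms(2,3) by (auto simp: dom_in_chart_def S_def topspace_Euclidean_space)
    then show ?thesis
      using e(2)[OF that] by (simp add: line_def dom_in_chart_def S_def Z_line)
  qed
  then show ?thesis using e(1) by blast
qed

lemma smooth_on_paramI:
  assumes d: "d \<in> A" and F: "smooth_on (ov d \<times> B \<times> UNIV) F"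
    and g: "\<And>z. z \<in> dom_in_chart d V S \<Longrightarrow> g z = F (T z)"
  shows "smooth_on_param N (dom_in_chart d V S) g"
  unfolding smooth_on_param_def
proof
  fix k
  show "Ck_on_param N k (dom_in_chart d V S) g"
  proof (rule Ck_on_param_compose[where T = T and ?T0.0 = T and F = F and M = "ov d \<times> B \<times> UNIV"])
    show "T ` dom_in_chart d V S \<subseteq> ov d \<times> B \<times> UNIV"
      by (auto simp: T_def dom_in_chart_def S_def)
    show "Ck_on k (ov d \<times> B \<times> UNIV) F" using F by (simp add: smooth_on_def)
  qed (use T_line continuous_T line_in_dom[OF d] g in auto)
qed

lemma smooth_h: "smooth_on B h"
  by (rule smooth_onI[OF B h]) (auto intro!: smooth_intros a B)

lemma smooth_components:
  fixes g :: "'e \<Rightarrow> 'w::real_normed_vector"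
  assumes "d \<in> A"
  shows "smooth_on (ov d) g \<Longrightarrow> smooth_on (ov d \<times> B \<times> UNIV) (\<lambda>w::'e\<times>'e\<times>'e. g (fst w))"
    and "smooth_on B g \<Longrightarrow> smooth_on (ov d \<times> B \<times> UNIV) (\<lambda>w::'e\<times>'e\<times>'e. g (fst (snd w)))"
    and "smooth_on (ov d \<times> B \<times> UNIV) (\<lambda>w::'e\<times>'e\<times>'e. fst w)"
    and "smooth_on (ov d \<times> B \<times> UNIV) (\<lambda>w::'e\<times>'e\<times>'e. fst (snd w))"
    and "smooth_on (ov d \<times> B \<times> UNIV) (\<lambda>w::'e\<times>'e\<times>'e. snd (snd w))"
    and "open (ov d \<times> B \<times> (UNIV :: 'e set))"
proof -
  show O: "open (ov d \<times> B \<times> (UNIV :: 'e set))"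
    by (intro open_Times ov_open assms B open_UNIV)
  show 1: "smooth_on (ov d \<times> B \<times> UNIV) (\<lambda>w::'e\<times>'e\<times>'e. fst w)"
    using O by (intro smooth_on_bounded_linear bounded_linear_fst)
  show 2: "smooth_on (ov d \<times> B \<times> UNIV) (\<lambda>w::'e\<times>'e\<times>'e. fst (snd w))"
    using O by (intro smooth_on_bounded_linear bounded_linear_fst_comp bounded_linear_snd)
  show "smooth_on (ov d \<times> B \<times> UNIV) (\<lambda>w::'e\<times>'e\<times>'e. snd (snd w))"
    using O by (intro smooth_on_bounded_linear bounded_linear_snd_comp bounded_linear_snd)
  show "smooth_on (ov d) g \<Longrightarrow> smooth_on (ov d \<times> B \<times> UNIV) (\<lambda>w::'e\<times>'e\<times>'e. g (fst w))"
    by (rule smooth_on_compose[OF O 1]) auto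
  show "smooth_on B g \<Longrightarrow> smooth_on (ov d \<times> B \<times> UNIV) (\<lambda>w::'e\<times>'e\<times>'e. g (fst (snd w)))"
    by (rule smooth_on_compose[OF O 2]) auto
qed

lemma ov_inv: "d \<in> A \<Longrightarrow> y \<in> ov d \<Longrightarrow> chart_inv d y \<in> fst d \<inter> V \<and> snd d (chart_inv d y) = y"
  by auto

lemma smooth_f: "smooth_function A N V S f"
  unfolding smooth_function_def
proof
  fix d assume d: "d \<in> A"
  let ?F = "\<lambda>w::'e\<times>'e\<times>'e. \<mu> / 2 * (transition d c (fst w) \<bullet> transition d c (fst w))
    + transition d c (fst w) \<bullet> fst (snd w) - h (fst (snd w))
    + (\<Sum>i<l. (snd (snd w) \<bullet> b i - \<psi> (fst (snd w)) \<bullet> b i) * (snd (snd w) \<bullet> b i - \<psi> (fst (snd w)) \<bullet> b i)) * (1 / 2)"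
  note sc = smooth_components[OF d]
  show "smooth_on_param N (dom_in_chart d V S) (in_chart d f)"
  proof (rule smooth_on_paramI[OF d, where F = ?F])
    show "smooth_on (ov d \<times> B \<times> UNIV) ?F"
      by (intro smooth_intros sc(2)[OF smooth_h] sc(1)[OF transition_smooth[OF d c]] sc(2)[OF \<psi>] sc(3-))
    show "in_chart d f z = ?F (T z)" if "z \<in> dom_in_chart d V S" for z
      using that by (auto simp: in_chart_def f_def T_def dom_in_chart_def U_inner power2_eq_square)
  qed
qed

lemma d_s_fiber:
  assumes "s \<in> S" "j < n"
  shows "d_s N f (x, s) j = (snd c x - a (Z s)) \<bullet> b j
    - (\<Sum>i<l. (s (n + i) - \<psi> (Z s) \<bullet> b i) * (frechet_derivative \<psi> (at (Z s)) (b j) \<bullet> b i))"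
proof -
  let ?D = "frechet_derivative \<psi> (at (Z s))"
  let ?g = "\<lambda>t. Z s + (t - s j) *\<^sub>R b j"
  have ZB: "Z s \<in> B" using assms by (simp add: S_def)
  have g: "(?g has_derivative (\<lambda>t. t *\<^sub>R b j)) (at (s j))"
    by (auto intro!: derivative_eq_intros)
  have "(h has_derivative (\<lambda>v. a (Z s) \<bullet> v)) (at (?g (s j)))" using h[OF ZB] by simp
  from has_derivative_compose[OF g this]
  have hD: "((\<lambda>t. h (?g t)) has_real_derivative a (Z s) \<bullet> b j) (at (s j))"
    by (simp add: has_field_derivative_def mult_commute_abs)
  have "(\<psi> has_derivative ?D) (at (?g (s j)))" using smooth_on_has_derivative[OF \<psi> ZB] by simp
  from has_derivative_compose[OF g this]
  have "((\<lambda>t. \<psi> (?g t)) has_derivative (\<lambda>t. t *\<^sub>R ?D (b j))) (at (s j))"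
    by (simp add: linear_cmul[OF smooth_on_linear_derivative[OF \<psi> ZB]])
  then have "((\<lambda>t. \<psi> (?g t) \<bullet> b i) has_derivative (\<lambda>t. (t *\<^sub>R ?D (b j)) \<bullet> b i)) (at (s j))" for i
    by (rule has_derivative_inner_left)
  then have \<psi>D: "((\<lambda>t. \<psi> (?g t) \<bullet> b i) has_real_derivative ?D (b j) \<bullet> b i) (at (s j))" for i
    by (simp add: has_field_derivative_def mult_commute_abs)
  have "((\<lambda>t. snd c x \<bullet> ?g t) has_real_derivative snd c x \<bullet> b j) (at (s j))"
    by (auto intro!: derivative_eq_intros simp: inner_add_right)
  then have "((\<lambda>t. \<mu> / 2 * (snd c x \<bullet> snd c x) + snd c x \<bullet> ?g t - h (?g t)
      + (\<Sum>i<l. (s (n + i) - \<psi> (?g t) \<bullet> b i)\<^sup>2) / 2) has_real_derivative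
      0 + snd c x \<bullet> b j - a (Z s) \<bullet> b j + (\<Sum>i<l. 2 * (s (n + i) - \<psi> (?g (s j)) \<bullet> b i) * (0 - ?D (b j) \<bullet> b i)) / 2) (at (s j))"
    by (intro DERIV_add DERIV_diff DERIV_const hD DERIV_cdivide DERIV_sum)
      (auto intro!: derivative_eq_intros \<psi>D)
  moreover have "f (x, s(j := t)) = \<mu> / 2 * (snd c x \<bullet> snd c x) + snd c x \<bullet> ?g t - h (?g t)
      + (\<Sum>i<l. (s (n + i) - \<psi> (?g t) \<bullet> b i)\<^sup>2) / 2" for t
    using assms(2) by (simp add: f_def Z_upd)
  moreover have "(\<Sum>i<l. 2 * (s (n + i) - \<psi> (?g (s j)) \<bullet> b i) * (0 - ?D (b j) \<bullet> b i)) / 2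
      = - (\<Sum>i<l. (s (n + i) - \<psi> (Z s) \<bullet> b i) * (?D (b j) \<bullet> b i))"
    unfolding sum_divide_distrib sum_negf[symmetric] by (intro sum.cong) auto
  ultimately have "((\<lambda>t. f (x, s(j := t))) has_real_derivative (snd c x - a (Z s)) \<bullet> b j
    - (\<Sum>i<l. (s (n + i) - \<psi> (Z s) \<bullet> b i) * (?D (b j) \<bullet> b i))) (at (s j))"
    by (simp add: inner_diff_left)
  then show ?thesis
    using assms(2) by (simp add: d_s_def DERIV_imp_deriv)
qed

lemma d_s_u:
  assumes "i < l"
  shows "d_s N f (x, s) (n + i) = s (n + i) - \<psi> (Z s) \<bullet> b i"
proof -
  have *: "(\<Sum>k<l. ((s(n + i := t)) (n + k) - \<psi> (Z s) \<bullet> b k)\<^sup>2) =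
      (\<Sum>k\<in>{..<l} - {i}. (s (n + k) - \<psi> (Z s) \<bullet> b k)\<^sup>2) + (t - \<psi> (Z s) \<bullet> b i)\<^sup>2" for t
    using assms by (subst sum.remove[of _ i]) auto
  have "((\<lambda>t. f (x, s(n + i := t))) has_real_derivative (s (n + i) - \<psi> (Z s) \<bullet> b i)) (at (s (n + i)))"
    unfolding f_def prod.case Z_upd' * by (auto intro!: derivative_eq_intros)
  then show ?thesis using assms by (simp add: d_s_def DERIV_imp_deriv)
qed

text \<open>The \<open>u\<close>-equations give \<open>u = \<psi>(z)\<close>. This annihilates the
  sum in the \<open>z\<close>-equations, where each term has a factor \<open>u - \<psi>(z)\<close>,
  and leaves \<open>x = a(z)\<close>.\<close>

lemma critical_iff:
  "(x, s) \<in> critical_set N V S f \<longleftrightarrow>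
    x \<in> V \<and> s \<in> S \<and> snd c x = a (Z s) \<and> (\<forall>i<l. s (n + i) = \<psi> (Z s) \<bullet> b i)"
proof (cases "x \<in> V \<and> s \<in> S")
  case True
  have split: "(\<forall>j. P j) \<longleftrightarrow> (\<forall>j<n. P j) \<and> (\<forall>i<l. P (n + i)) \<and> (\<forall>j\<ge>N. P j)" for P :: "nat \<Rightarrow> bool"
    by (metis add_less_cancel_left le_add_diff_inverse not_le)
  have "d_s N f (x, s) j = 0" if "j \<ge> N" for j using that by (simp add: d_s_def)
  then have "(x, s) \<in> critical_set N V S f \<longleftrightarrow>
      (\<forall>j<n. d_s N f (x, s) j = 0) \<and> (\<forall>i<l. d_s N f (x, s) (n + i) = 0)"
    using True split[of "\<lambda>j. d_s N f (x, s) j = 0"] by (auto simp: critical_set_def fun_eq_iff)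
  also have "\<dots> \<longleftrightarrow> (\<forall>j<n. (snd c x - a (Z s)) \<bullet> b j = 0) \<and> (\<forall>i<l. s (n + i) = \<psi> (Z s) \<bullet> b i)"
    using True by (auto simp: d_s_fiber d_s_u)
  also have "(\<forall>j<n. (snd c x - a (Z s)) \<bullet> b j = 0) \<longleftrightarrow> snd c x = a (Z s)"
    using b_eqI[of "snd c x" "a (Z s)"] by (auto simp: inner_diff_left)
  finally show ?thesis using True by simp
qed (auto simp: critical_set_def)

end

context smooth_mfd
begin

text \<open>The cocycle law makes this map idempotent, and it is also its own inverse.\<close>

lemma dtrans_self: "c \<in> A \<Longrightarrow> p \<in> fst c \<Longrightarrow> dtrans c c p v = v"
  using dtrans_cocycle[of c c c p v] dtrans_inverse[of c c p v] by simp

end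

lemma tangent_vectors_paramI:
  assumes "\<epsilon> > 0" "\<gamma> 0 = x" "\<sigma> 0 = s" "\<And>t. t \<in> {-\<epsilon><..<\<epsilon>} \<Longrightarrow> \<gamma> t \<in> fst d \<and> (\<gamma> t, \<sigma> t) \<in> M"
    and "smooth_on {-\<epsilon><..<\<epsilon>} (\<lambda>t. snd d (\<gamma> t))" "((\<lambda>t. snd d (\<gamma> t)) has_vector_derivative v) (at 0)"
    and "\<And>j. smooth_on {-\<epsilon><..<\<epsilon>} (\<lambda>t. \<sigma> t j)" "\<And>j. ((\<lambda>t. \<sigma> t j) has_vector_derivative w j) (at 0)"
  shows "(v, w) \<in> tangent_vectors_param d M (x, s)"
  unfolding tangent_vectors_param_def mem_Collect_eq
  by (rule exI[of _ \<gamma>], rule exI[of _ \<sigma>], rule exI[of _ \<epsilon>]) (use assms in \<open>auto simp: comp_def\<close>)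

section \<open>The phase map, its restriction to the critical set, and non-degeneracy\<close>

context phase_construction
begin

text \<open>\<open>h\<close> and the squares depend on \<open>s\<close> alone, so in the chart
  \<open>c\<close> the phase is quadratic in \<open>x\<close>.\<close>

lemma phase_derivative:
  assumes "x \<in> V"
  shows "((\<lambda>y. f (y, s)) \<circ> chart_inv c has_derivative (\<lambda>v. (\<mu> *\<^sub>R snd c x + Z s) \<bullet> v)) (at (snd c x))"
proof -
  let ?C = "(\<Sum>i<l. (s (n + i) - \<psi> (Z s) \<bullet> b i)\<^sup>2) / 2 - h (Z s)"
  have "((\<lambda>y. \<mu> / 2 * (y \<bullet> y) + y \<bullet> Z s + ?C) has_derivative (\<lambda>v. (\<mu> *\<^sub>R snd c x + Z s) \<bullet> v)) (at (snd c x))"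
    by (auto intro!: derivative_eq_intros simp: fun_eq_iff inner_add_left inner_add_right inner_commute)
  moreover have "open (snd c ` V)" using ov_open[OF c] by simp
  ultimately show ?thesis
    by (rule has_derivative_transform_within_open)
      (use assms c in \<open>auto simp: f_def\<close>)
qed

lemma differential_f:
  "d \<in> A \<Longrightarrow> x \<in> V \<Longrightarrow> x \<in> fst d \<Longrightarrow>
    differential A (\<lambda>y. f (y, s)) x d \<bullet> v = (\<mu> *\<^sub>R snd c x + Z s) \<bullet> dtrans d c x v"
  using differential_chart[OF c _ _ _ phase_derivative] by blast

lemma phase_map_in_chart:
  assumes "x \<in> V"
  shows "phase_map A f (x, s) \<in> fst (TC c)"
    and "snd (TC c) (phase_map A f (x, s)) = (snd c x, \<mu> *\<^sub>R snd c x + Z s)"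
proof -
  show "phase_map A f (x, s) \<in> fst (TC c)"
    using differential_in_cotangent_space[OF c assms phase_derivative[OF assms]]
      assms chart_topspace[OF chart[OF c]]
    by (auto simp: phase_map_def fst_TC)
  have "differential A (\<lambda>y. f (y, s)) x c = \<mu> *\<^sub>R snd c x + Z s"
    using differential_f[OF c assms assms] dtrans_self[OF c assms] vector_eq_rdot by metis
  then show "snd (TC c) (phase_map A f (x, s)) = (snd c x, \<mu> *\<^sub>R snd c x + Z s)"
    by (simp add: phase_map_def snd_TC)
qed

text \<open>Both covectors have the coordinates \<open>(a z, \<mu> a z + z)\<close> in
  \<open>TC c\<close>, where \<open>z = Z s\<close>.\<close>

lemma phase_map_critical:
  assumes "(x, s) \<in> critical_set N V S f"
  shows "phase_map A f (x, s) = q (Z s)"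
proof -
  have xs: "x \<in> V" "snd c x = a (Z s)" "Z s \<in> B" using assms unfolding critical_iff by (auto simp: S_def)
  then have "snd (TC c) (phase_map A f (x, s)) = snd (TC c) (q (Z s))"
    by (simp add: phase_map_in_chart q)
  then show ?thesis
    using inj_on_TC[OF c] phase_map_in_chart(1)[OF xs(1)] q(2)[OF xs(3)] by (metis inj_onD)
qed

text \<open>The fibre variables of the critical point over \<open>z\<close>: first \<open>z\<close>,
  then \<open>\<psi>(z)\<close>, and 0 from \<open>N\<close> on, as elements of
  \<open>Euclidean_space N\<close> require.\<close>

definition \<sigma> :: "'e \<Rightarrow> nat \<Rightarrow> real" where
  "\<sigma> z = (\<lambda>j. if j < n then z \<bullet> b j else if j < N then \<psi> z \<bullet> b (j - n) else 0)"

lemma Z_\<sigma>: "Z (\<sigma> z) = z"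
  by (rule b_eqI) (simp add: Z_inner \<sigma>_def)

lemma \<sigma>_S: "z \<in> B \<Longrightarrow> \<sigma> z \<in> S"
  by (simp add: S_def Z_\<sigma> topspace_Euclidean_space) (simp add: \<sigma>_def)

lemma base_q: "z \<in> B \<Longrightarrow> fst (q z) \<in> V" "z \<in> B \<Longrightarrow> snd c (fst (q z)) = a z"
  using q(2,3)[of z] by (auto simp: fst_TC snd_TC)

lemma base_q_inv: "z \<in> B \<Longrightarrow> fst (q z) = chart_inv c (a z)"
  using base_q[of z] inv_left[OF c] by metis

text \<open>With the critical set parametrized by \<open>B\<close>, the phase map becomes
  \<open>q\<close>, and topology and tangent vectors can be treated in the variable
  \<open>z\<close>.\<close>

lemma critical_param: "critical_set N V S f = (\<lambda>z. (fst (q z), \<sigma> z)) ` B"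
proof (intro set_eqI iffI)
  fix w assume w: "w \<in> critical_set N V S f"
  obtain x s where xs: "w = (x, s)" by fastforce
  have crit: "x \<in> V" "s \<in> S" "snd c x = a (Z s)" "\<And>i. i < l \<Longrightarrow> s (n + i) = \<psi> (Z s) \<bullet> b i"
    using w unfolding xs critical_iff by auto
  then have ZB: "Z s \<in> B" by (simp add: S_def)
  have "x = fst (q (Z s))"
    using crit(1,3) base_q[OF ZB] inv_left[OF c] by metis
  moreover have "s = \<sigma> (Z s)"
  proof
    fix j
    show "s j = \<sigma> (Z s) j"
      using crit(2) crit(4)[of "j - n"] by (auto simp: \<sigma>_def Z_inner S_def topspace_Euclidean_space)
  qed
  ultimately show "w \<in> (\<lambda>z. (fst (q z), \<sigma> z)) ` B" using xs ZB by blast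
next
  fix w assume "w \<in> (\<lambda>z. (fst (q z), \<sigma> z)) ` B"
  then obtain z where z: "z \<in> B" "w = (fst (q z), \<sigma> z)" by auto
  show "w \<in> critical_set N V S f"
    unfolding z(2) critical_iff using base_q[OF z(1)] \<sigma>_S[OF z(1)] by (simp add: Z_\<sigma>) (simp add: \<sigma>_def)
qed

lemma phase_map_param: "z \<in> B \<Longrightarrow> phase_map A f (fst (q z), \<sigma> z) = q z"
  using phase_map_critical[of "fst (q z)" "\<sigma> z"] critical_param by (simp add: Z_\<sigma>)

lemma phase_map_homeomorphic:
  "homeomorphic_map (subtopology (prod_topology X (Euclidean_space N)) (critical_set N V S f))
    (subtopology TX (q ` B)) (phase_map A f)"
proof -
  let ?C = "critical_set N V S f"
  let ?XE = "subtopology (prod_topology X (Euclidean_space N)) ?C"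
  let ?P = "\<lambda>z. (fst (q z), \<sigma> z)"
  \<comment> \<open>\<open>pr\<close> recovers \<open>z = \<xi> - \<mu> x\<close> from a covector,
    so \<open>?P \<circ> pr\<close> is the inverse homeomorphism.\<close>
  define pr where "pr = (\<lambda>w. snd (snd (TC c) w) - \<mu> *\<^sub>R fst (snd (TC c) w))"
  have pr_q: "pr (q z) = z" if "z \<in> B" for z using q(3)[OF that] by (simp add: pr_def)
  have Vtop: "V \<subseteq> topspace X" using chart_topspace[OF chart[OF c]] .
  have C_top: "topspace ?XE = ?C"
    using Vtop by (auto simp: critical_set_def S_def)
  have \<Gamma>_top: "topspace (subtopology TX (q ` B)) = q ` B"
    using q_cont by (auto simp: continuous_map_def)
  have "continuous_map ?XE (top_of_set B) (\<lambda>w. Z (snd w))"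
  proof -
    have "continuous_map ?XE (Euclidean_space N) snd"
      by (intro continuous_map_from_subtopology continuous_map_snd)
    moreover have "continuous_map (Euclidean_space N) euclidean Z"
      by (simp add: continuous_map_Euclidean_space_iff continuous_Z)
    ultimately have "continuous_map ?XE euclidean (\<lambda>w. Z (snd w))"
      using continuous_map_compose by (fastforce simp: comp_def)
    then show ?thesis
      unfolding continuous_map_in_subtopology C_top by (auto simp: critical_set_def S_def)
  qed
  from continuous_map_compose[OF this q_cont]
  have "continuous_map ?XE TX (\<lambda>w. q (Z (snd w)))" by (simp add: comp_def)
  then have "continuous_map ?XE TX (phase_map A f)"
    by (rule continuous_map_eq) (use C_top phase_map_critical in force)
  moreover have "phase_map A f ` ?C \<subseteq> q ` B"
    using critical_param phase_map_param by auto
  ultimately have 1: "continuous_map ?XE (subtopology TX (q ` B)) (phase_map A f)"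
    unfolding continuous_map_in_subtopology C_top by blast
  have P: "continuous_map (top_of_set B) ?XE ?P"
  proof -
    have "continuous_map (top_of_set B) (top_of_set (snd c ` V)) a"
      using smooth_on_continuous[OF a] base_q
      by (auto simp: continuous_map_in_subtopology) (metis imageI)
    from continuous_map_compose[OF this chart_inv_continuous[OF chart[OF c]]]
    have "continuous_map (top_of_set B) X (\<lambda>z. fst (q z))"
      by (rule continuous_map_eq) (simp add: base_q_inv)
    moreover have "continuous_map (top_of_set B) (Euclidean_space N) \<sigma>"
    proof -
      have "continuous_on B (\<lambda>z. \<sigma> z j)" for j
        unfolding \<sigma>_def using smooth_on_continuous[OF \<psi>]
        by (cases "j < n"; cases "j < N") (auto intro!: continuous_intros)
      then show ?thesis
        using \<sigma>_S unfolding Euclidean_space_def continuous_map_in_subtopology continuous_map_componentwise_UNIV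
        by (auto simp: S_def topspace_Euclidean_space)
    qed
    ultimately have "continuous_map (top_of_set B) (prod_topology X (Euclidean_space N)) ?P"
      by (rule continuous_map_pairedI)
    then show ?thesis unfolding continuous_map_in_subtopology critical_param by auto
  qed
  have "continuous_map (subtopology TX (q ` B)) (top_of_set B) pr"
  proof -
    have "continuous_map (subtopology TX (q ` B)) euclidean (snd (TC c))"
      using continuous_map_from_subtopology_mono[OF TC_continuous[OF c]] q(2) by blast
    moreover have "continuous_map euclidean euclidean (\<lambda>y::'e \<times> 'e. snd y - \<mu> *\<^sub>R fst y)"
      unfolding continuous_map_iff_continuous2 by (intro continuous_intros)
    ultimately have "continuous_map (subtopology TX (q ` B)) euclidean
        ((\<lambda>y. snd y - \<mu> *\<^sub>R fst y) \<circ> snd (TC c))"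
      by (rule continuous_map_compose)
    then have "continuous_map (subtopology TX (q ` B)) euclidean pr"
      by (simp add: pr_def comp_def)
    then show ?thesis unfolding continuous_map_in_subtopology \<Gamma>_top using pr_q by auto
  qed
  from continuous_map_compose[OF this P]
  have 2: "continuous_map (subtopology TX (q ` B)) ?XE (?P \<circ> pr)" .
  have "homeomorphic_maps ?XE (subtopology TX (q ` B)) (phase_map A f) (?P \<circ> pr)"
    unfolding homeomorphic_maps_def C_top \<Gamma>_top using 1 2
    by (auto simp: critical_param phase_map_param pr_q)
  then show ?thesis using homeomorphic_map_maps by blast
qed

abbreviation "G d \<equiv> snd (TC d) \<circ> in_chart d (phase_map A f)"

text \<open>The second component is the covector \<open>\<mu> x + z\<close> of the chart
  \<open>c\<close>, pulled back to the chart \<open>d\<close>; summing over the basis turns this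
  functional into the vector that represents it.\<close>

lemma G_eq:
  assumes d: "d \<in> A" and w: "(y, s) \<in> dom_in_chart d V S"
  shows "G d (y, s) = (y, \<Sum>e\<in>Basis. ((\<mu> *\<^sub>R transition d c y + Z s) \<bullet>
    frechet_derivative (transition d c) (at y) e) *\<^sub>R e)"
proof -
  obtain x where x: "x \<in> fst d" "x \<in> V" "y = snd d x" using w by (auto simp: dom_in_chart_def)
  let ?\<xi> = "differential A (\<lambda>y. f (y, s)) x d"
  have "?\<xi> = (\<Sum>e\<in>Basis. (?\<xi> \<bullet> e) *\<^sub>R e)" by (simp add: euclidean_representation)
  also have "\<dots> = (\<Sum>e\<in>Basis. ((\<mu> *\<^sub>R snd c x + Z s) \<bullet> dtrans d c x e) *\<^sub>R e)"
    using differential_f[OF d x(2,1)] by simp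
  finally show ?thesis
    using x d by (simp add: in_chart_def phase_map_def snd_TC)
qed

lemma smooth_G:
  assumes d: "d \<in> A"
  shows "smooth_on_param N (dom_in_chart d V S) (G d)"
proof (rule smooth_on_paramI[OF d])
  let ?\<tau> = "transition d c"
  note sc = smooth_components[OF d] and \<tau> = transition_smooth[OF d c]
  show "smooth_on (ov d \<times> B \<times> UNIV) (\<lambda>w::'e\<times>'e\<times>'e. (fst w,
      \<Sum>e\<in>Basis. ((\<mu> *\<^sub>R ?\<tau> (fst w) + fst (snd w)) \<bullet> frechet_derivative ?\<tau> (at (fst w)) e) *\<^sub>R e))"
    by (intro smooth_intros sc(1)[OF \<tau>] sc(1)[OF smooth_on_derivative[OF \<tau>]] sc(3-))
  show "G d z = (fst (T z), \<Sum>e\<in>Basis. ((\<mu> *\<^sub>R ?\<tau> (fst (T z)) + fst (snd (T z))) \<bullet>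
      frechet_derivative ?\<tau> (at (fst (T z))) e) *\<^sub>R e)" if "z \<in> dom_in_chart d V S" for z
    using G_eq[OF d, of "fst z" "snd z"] that by (simp add: T_def split_def del: comp_apply)
qed

lemma dtrans_surj:
  "d \<in> A \<Longrightarrow> x \<in> fst d \<Longrightarrow> x \<in> V \<Longrightarrow> \<exists>v. dtrans d c x v = w"
  using dtrans_inverse[OF c, of d x w] by blast

lemma line_in_domE:
  assumes "d \<in> A" "x \<in> fst d" "x \<in> V" "s \<in> S" "v \<in> UNIV \<times> topspace (Euclidean_space N)"
  obtains e :: real where "e > 0" "\<And>t. t \<in> {-e<..<e} \<Longrightarrow> line (snd d x, s) v t \<in> dom_in_chart d V S"
  using line_in_dom[OF assms(1) _ assms(5), of "(snd d x, s)"] assms(2-4) by (force simp: dom_in_chart_def)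

text \<open>The base component of the phase map forces the \<open>x\<close>-direction to vanish. Its
  covector component then forces the \<open>z\<close>-direction to vanish, because transition
  derivatives are onto. Tangency to \<open>u = \<psi>(z)\<close> takes care of the
  \<open>u\<close>-direction.\<close>

lemma phase_map_immersion:
  assumes d: "d \<in> A" and z: "z \<in> critical_set N V S f" "fst z \<in> fst d"
    and v: "v \<in> tangent_vectors_param d (critical_set N V S f) z"
    and zero: "dir_deriv (G d) (pt_in_chart d z) v = 0"
  shows "v = (0, \<lambda>j. 0)"
proof -
  obtain x s where xs: "z = (x, s)" by fastforce
  have x: "x \<in> V" "s \<in> S" "x \<in> fst d" using z unfolding xs critical_iff by auto
  let ?\<tau> = "transition d c"
  obtain \<gamma> :: "real \<Rightarrow> 'a" and \<rho> :: "real \<Rightarrow> nat \<Rightarrow> real" and \<epsilon> where \<epsilon>: "\<epsilon> > 0" "(\<gamma> 0, \<rho> 0) = (x, s)"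
    and crit: "\<And>t. t \<in> {-\<epsilon><..<\<epsilon>} \<Longrightarrow> (\<gamma> t, \<rho> t) \<in> critical_set N V S f"
    and D\<rho>: "\<And>j. ((\<lambda>t. \<rho> t j) has_vector_derivative snd v j) (at 0)"
    using v unfolding tangent_vectors_param_def xs mem_Collect_eq by blast
  have near0: "0 \<in> {-\<epsilon><..<\<epsilon>}" "open {-\<epsilon><..<\<epsilon>}" using \<epsilon> by auto
  \<comment> \<open>The curve stays in \<open>S\<close>, whose elements are 0 from index
    \<open>N\<close> on.\<close>
  have "snd v j = 0" if "j \<ge> N" for j
  proof -
    have "((\<lambda>t. 0) has_vector_derivative snd v j) (at 0)"
    proof (rule has_vector_derivative_transform_within_open[OF D\<rho> near0(2,1)])
      fix t assume "t \<in> {-\<epsilon><..<\<epsilon>}"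
      then have "\<rho> t \<in> S" using crit unfolding critical_iff by blast
      then show "\<rho> t j = 0" using that by (simp add: S_def topspace_Euclidean_space)
    qed
    then show ?thesis using has_vector_derivative_const vector_derivative_unique_at by blast
  qed
  note v_ge = this
  then have v_top: "v \<in> UNIV \<times> topspace (Euclidean_space N)"
    by (cases v) (simp add: topspace_Euclidean_space)
  obtain e :: real where e: "e > 0" "\<And>t. t \<in> {-e<..<e} \<Longrightarrow> line (snd d x, s) v t \<in> dom_in_chart d V S"
    using line_in_domE[OF d x(3,1,2) v_top] by metis
  have near0': "0 \<in> {-e<..<e}" "open {-e<..<e}" using e by auto
  have "Ck_on_param N (Suc 0) (dom_in_chart d V S) (G d)"
    using smooth_G[OF d] unfolding smooth_on_param_def by blast
  then have "(\<lambda>t. G d (line (snd d x, s) v t)) differentiable (at 0)"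
    using v_top x unfolding Ck_on_param.simps by (auto simp: dom_in_chart_def)
  then have D: "((\<lambda>t. G d (line (snd d x, s) v t)) has_vector_derivative 0) (at 0)"
    using zero unfolding dir_deriv_def xs pt_in_chart_def fst_conv snd_conv
    by (metis vector_derivative_works)
  have G_line: "G d (line (snd d x, s) v t) = (snd d x + t *\<^sub>R fst v,
      \<Sum>e\<in>Basis. ((\<mu> *\<^sub>R ?\<tau> (snd d x + t *\<^sub>R fst v) + (Z s + t *\<^sub>R Z (snd v))) \<bullet>
        frechet_derivative ?\<tau> (at (snd d x + t *\<^sub>R fst v)) e) *\<^sub>R e)" if "t \<in> {-e<..<e}" for t
    using G_eq[OF d, of "snd d x + t *\<^sub>R fst v" "\<lambda>j. s j + t * snd v j"] e(2)[OF that]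
    by (simp add: line_def Z_line del: comp_apply)
  have "((\<lambda>t. fst (G d (line (snd d x, s) v t))) has_vector_derivative fst (0 :: 'e \<times> 'e)) (at 0)"
    by (rule bounded_linear.has_vector_derivative[OF bounded_linear_fst D])
  from has_vector_derivative_transform_within_open[OF this[unfolded fst_zero] near0'(2,1)]
  have "((\<lambda>t. snd d x + t *\<^sub>R fst v) has_vector_derivative 0) (at 0)"
    by (simp only: G_line fst_conv)
  moreover have "((\<lambda>t. snd d x + t *\<^sub>R fst v) has_vector_derivative fst v) (at 0)"
    by (auto intro!: derivative_eq_intros)
  ultimately have v1: "fst v = 0" using vector_derivative_unique_at by blast
  have "Z (snd v) \<bullet> dtrans d c x w = 0" for w
  proof -
    \<comment> \<open>With zero \<open>x\<close>-direction the base point and the transition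
      derivative are constant along the line, and the covector component is affine in
      \<open>t\<close>.\<close>
    let ?K = "\<lambda>t. \<Sum>e\<in>Basis. ((\<mu> *\<^sub>R ?\<tau> (snd d x) + (Z s + t *\<^sub>R Z (snd v))) \<bullet> dtrans d c x e) *\<^sub>R e"
    have "((\<lambda>t. snd (G d (line (snd d x, s) v t))) has_vector_derivative snd (0 :: 'e \<times> 'e)) (at 0)"
      by (rule bounded_linear.has_vector_derivative[OF bounded_linear_snd D])
    from has_vector_derivative_transform_within_open[OF this[unfolded snd_zero] near0'(2,1)]
    have "(?K has_vector_derivative 0) (at 0)"
      by (simp only: G_line snd_conv v1 scaleR_zero_right add_0_right)
    moreover have "(?K has_vector_derivative (\<Sum>e\<in>Basis. (Z (snd v) \<bullet> dtrans d c x e) *\<^sub>R e)) (at 0)"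
      by (auto intro!: derivative_eq_intros simp: inner_add_left)
    ultimately have eq: "(\<Sum>e\<in>Basis. (Z (snd v) \<bullet> dtrans d c x e) *\<^sub>R e) = 0"
      using vector_derivative_unique_at by blast
    have "Z (snd v) \<bullet> dtrans d c x e = 0" if "e \<in> Basis" for e
    proof -
      have "(\<Sum>e\<in>Basis. (Z (snd v) \<bullet> dtrans d c x e) *\<^sub>R e) \<bullet> e = Z (snd v) \<bullet> dtrans d c x e"
        using that by (rule inner_sum_left_Basis)
      then show ?thesis using eq by simp
    qed
    then show ?thesis
      by (subst linear_euclidean_expand[OF dtrans_linear[OF d c x(3,1)], of w]) (simp add: inner_sum_right)
  qed
  then have Zv: "Z (snd v) = 0" using dtrans_surj[OF d x(3,1)] by (metis inner_eq_zero_iff)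
  have "snd v j = 0" for j
  proof -
    consider "j < n" | i where "j = n + i" "i < l" | "j \<ge> N"
      by (metis add_less_cancel_left le_add_diff_inverse not_le)
    then show ?thesis
    proof cases
      case 1
      then show ?thesis using Z_inner[of j "snd v"] Zv by simp
    next
      case (2 i)
      have ZB: "Z s \<in> B" using x by (simp add: S_def)
      \<comment> \<open>On the curve \<open>u = \<psi>(z)\<close> by criticality; \<open>z\<close>
        has velocity 0, hence so has \<open>u\<close>.\<close>
      have "((\<lambda>t. Z (\<rho> t)) has_vector_derivative Z (snd v)) (at 0)"
        unfolding Z_def
        by (intro has_vector_derivative_sum bounded_linear.has_vector_derivative[OF bounded_linear_scaleR_left D\<rho>])
      then have "((\<lambda>t. Z (\<rho> t)) has_derivative (\<lambda>t. 0)) (at 0)"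
        by (simp add: Zv has_vector_derivative_def)
      from has_derivative_compose[OF this, of \<psi> "frechet_derivative \<psi> (at (Z s))"]
      have "((\<lambda>t. \<psi> (Z (\<rho> t))) has_derivative (\<lambda>t. 0)) (at 0)"
        using smooth_on_has_derivative[OF \<psi> ZB] \<epsilon>(2) linear_0[OF smooth_on_linear_derivative[OF \<psi> ZB]] by simp
      then have "((\<lambda>t. \<psi> (Z (\<rho> t)) \<bullet> b i) has_derivative (\<lambda>t. 0 \<bullet> b i)) (at 0)"
        by (rule has_derivative_inner_left)
      then have "((\<lambda>t. \<psi> (Z (\<rho> t)) \<bullet> b i) has_vector_derivative 0) (at 0)"
        by (simp add: has_vector_derivative_def)
      then have "((\<lambda>t. \<rho> t j) has_vector_derivative 0) (at 0)"
        by (rule has_vector_derivative_transform_within_open[OF _ near0(2,1)])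
          (use crit 2 in \<open>simp add: critical_iff\<close>)
      then show ?thesis using D\<rho> vector_derivative_unique_at by blast
    qed (rule v_ge)
  qed
  then show ?thesis using v1 by (auto simp: prod_eq_iff)
qed

text \<open>With \<open>z\<close> held fixed the system is block triangular in
  \<open>(x, u)\<close>: the \<open>u\<close>-equations contain \<open>u\<close> with the identity
  matrix and no \<open>x\<close>, and the \<open>z\<close>-equations contain the coordinates of
  \<open>x\<close> in the chart \<open>c\<close> with the identity matrix.\<close>

lemma d_s_regular: "regular_value A N V S (d_s N f) (\<lambda>j. 0)"
  unfolding regular_value_def
proof (intro ballI impI)
  fix z d and \<eta> :: "nat \<Rightarrow> real" assume z: "z \<in> V \<times> S" and d: "d \<in> A" "fst z \<in> fst d"
  obtain x s where xs: "z = (x, s)" "x \<in> V" "s \<in> S" "x \<in> fst d" using z d by auto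
  let ?D = "frechet_derivative \<psi> (at (Z s))"
  let ?\<tau> = "transition d c"
  \<comment> \<open>Moving \<open>u\<close> by the last \<open>l\<close> entries of
    \<open>\<eta>\<close> changes the \<open>z\<close>-equations by minus the inner sum;
    \<open>w\<close> compensates for this and adds the prescribed \<open>\<eta> j\<close>.\<close>
  define w where "w = (\<Sum>j<n. (\<eta> j + (\<Sum>i<l. \<eta> (n + i) * (?D (b j) \<bullet> b i))) *\<^sub>R b j)"
  have w: "w \<bullet> b j = \<eta> j + (\<Sum>i<l. \<eta> (n + i) * (?D (b j) \<bullet> b i))" if "j < n" for j
    using that by (simp add: w_def inner_sum_left b_inner if_distrib[of "(*) _"] sum.If_cases)
  obtain v where v: "dtrans d c x v = w" using dtrans_surj[OF d(1) xs(4,2)] by blast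
  define \<delta> where "\<delta> = (\<lambda>j. if n \<le> j \<and> j < N then \<eta> j else 0)"
  have Z\<delta>: "Z \<delta> = 0" by (rule b_eqI) (simp add: Z_inner \<delta>_def)
  have top: "(v, \<delta>) \<in> UNIV \<times> topspace (Euclidean_space N)"
    by (simp add: topspace_Euclidean_space \<delta>_def)
  obtain e :: real where e: "e > 0" "\<And>t. t \<in> {-e<..<e} \<Longrightarrow> line (snd d x, s) (v, \<delta>) t \<in> dom_in_chart d V S"
    using line_in_domE[OF d(1) xs(4,2,3) top] by metis
  have near0: "0 \<in> {-e<..<e}" "open {-e<..<e}" using e by auto
  have dom: "chart_inv d (snd d x + t *\<^sub>R v) \<in> V" "(\<lambda>j. s j + t * \<delta> j) \<in> S" if "t \<in> {-e<..<e}" for t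
    using e(2)[OF that] d(1) by (auto simp: line_def dom_in_chart_def)
  have "((\<lambda>t::real. snd d x + t *\<^sub>R v) has_derivative (\<lambda>t. t *\<^sub>R v)) (at 0)"
    by (auto intro!: derivative_eq_intros)
  moreover have "(?\<tau> has_derivative dtrans d c x) (at (snd d x + 0 *\<^sub>R v))"
    using transition_has_derivative[OF d(1) c xs(4,2)] by simp
  ultimately have "((\<lambda>t. ?\<tau> (snd d x + t *\<^sub>R v)) has_derivative (\<lambda>t. dtrans d c x (t *\<^sub>R v))) (at 0)"
    by (rule has_derivative_compose)
  then have \<tau>D: "((\<lambda>t. ?\<tau> (snd d x + t *\<^sub>R v)) has_vector_derivative w) (at 0)"
    by (simp add: has_vector_derivative_def linear_cmul[OF dtrans_linear[OF d(1) c xs(4,2)]] v)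
  have "dir_deriv (in_chart d (\<lambda>z. d_s N f z j)) (pt_in_chart d z) (v, \<delta>) = \<eta> j" if "j < N" for j
  proof -
    have line: "line (snd d x, s) (v, \<delta>) t = (snd d x + t *\<^sub>R v, \<lambda>j. s j + t * \<delta> j)" for t
      by (simp add: line_def)
    have "((\<lambda>t. in_chart d (\<lambda>z. d_s N f z j) (line (snd d x, s) (v, \<delta>) t)) has_vector_derivative \<eta> j) (at 0)"
    proof (cases "j < n")
      case True
      have "((\<lambda>t. (?\<tau> (snd d x + t *\<^sub>R v) - a (Z s)) \<bullet> b j
          - (\<Sum>i<l. (s (n + i) + t * \<eta> (n + i) - \<psi> (Z s) \<bullet> b i) * (?D (b j) \<bullet> b i)))
          has_vector_derivative (w - 0) \<bullet> b j - (\<Sum>i<l. \<eta> (n + i) * (?D (b j) \<bullet> b i))) (at 0)"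
        by (intro has_vector_derivative_diff bounded_linear.has_vector_derivative[OF bounded_linear_inner_left]
            \<tau>D has_vector_derivative_const has_vector_derivative_sum)
          (auto intro!: derivative_eq_intros simp: has_real_derivative_iff_has_vector_derivative[symmetric])
      then have D: "((\<lambda>t. (?\<tau> (snd d x + t *\<^sub>R v) - a (Z s)) \<bullet> b j
          - (\<Sum>i<l. (s (n + i) + t * \<eta> (n + i) - \<psi> (Z s) \<bullet> b i) * (?D (b j) \<bullet> b i)))
          has_vector_derivative \<eta> j) (at 0)"
        using w[OF True] by simp
      have eq: "in_chart d (\<lambda>z. d_s N f z j) (line (snd d x, s) (v, \<delta>) t) = (?\<tau> (snd d x + t *\<^sub>R v) - a (Z s)) \<bullet> b j
          - (\<Sum>i<l. (s (n + i) + t * \<eta> (n + i) - \<psi> (Z s) \<bullet> b i) * (?D (b j) \<bullet> b i))"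
        if "t \<in> {-e<..<e}" for t
      proof -
        have "\<delta> (n + i) = \<eta> (n + i)" if "i < l" for i using that by (simp add: \<delta>_def)
        then show ?thesis
          unfolding line in_chart_def prod.case d_s_fiber[OF dom(2)[OF that] True] Z_line Z\<delta> by simp
      qed
      show ?thesis
        by (rule has_vector_derivative_transform_within_open[OF D near0(2,1)]) (rule eq[symmetric])
    next
      case False
      then obtain i where i: "j = n + i" "i < l" using \<open>j < N\<close> by (metis add_less_cancel_left le_add_diff_inverse not_le)
      have "((\<lambda>t. s j + t * \<eta> j - \<psi> (Z s) \<bullet> b i) has_vector_derivative \<eta> j) (at 0)"
        by (auto intro!: derivative_eq_intros simp: has_real_derivative_iff_has_vector_derivative[symmetric])
      moreover have "in_chart d (\<lambda>z. d_s N f z j) (line (snd d x, s) (v, \<delta>) t) = s j + t * \<eta> j - \<psi> (Z s) \<bullet> b i" for t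
        using i by (simp add: line in_chart_def d_s_u Z_line Z\<delta>) (simp add: \<delta>_def)
      ultimately show ?thesis by simp
    qed
    then show ?thesis
      unfolding dir_deriv_def xs(1) pt_in_chart_def fst_conv snd_conv by (rule vector_derivative_at)
  qed
  then show "\<exists>v\<in>UNIV \<times> topspace (Euclidean_space N). \<forall>j<N.
      dir_deriv (in_chart d (\<lambda>z. d_s N f z j)) (pt_in_chart d z) v = \<eta> j"
    using top by blast
qed

lemma nondegenerate: "nondegenerate_phase_function X A N V S f (q ` B)"
  unfolding nondegenerate_phase_function_def embedding_onto_def Let_def
  using smooth_f d_s_regular smooth_G phase_map_immersion phase_map_homeomorphic by blast

section \<open>The intersection with u = 0 and its transversality\<close>

lemma critical_zero_iff:
  assumes "z \<in> B"
  shows "(fst (q z), \<sigma> z) \<in> u_zero_set n l V S \<longleftrightarrow> q z \<in> \<Sigma>"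
proof -
  have "(\<forall>j. n \<le> j \<and> j < N \<longrightarrow> \<sigma> z j = 0) \<longleftrightarrow> (\<forall>i<l. \<psi> z \<bullet> b i = 0)"
  proof (intro iffI allI impI)
    fix i assume "\<forall>j. n \<le> j \<and> j < N \<longrightarrow> \<sigma> z j = 0" "i < l"
    then have "\<sigma> z (n + i) = 0" by simp
    then show "\<psi> z \<bullet> b i = 0" using \<open>i < l\<close> by (simp add: \<sigma>_def)
  next
    fix j assume "\<forall>i<l. \<psi> z \<bullet> b i = 0" "n \<le> j \<and> j < N"
    moreover from this have "j - n < l" by auto
    ultimately show "\<sigma> z j = 0" by (simp add: \<sigma>_def)
  qed
  then show ?thesis
    using base_q[OF assms] \<sigma>_S[OF assms] \<Sigma>_iff[OF assms] by (simp add: u_zero_set_def)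
qed

lemma phase_map_zero: "phase_map A f ` (critical_set N V S f \<inter> u_zero_set n l V S) = \<Sigma> \<inter> q ` B"
proof (intro set_eqI iffI)
  fix y assume "y \<in> phase_map A f ` (critical_set N V S f \<inter> u_zero_set n l V S)"
  then obtain z where "z \<in> B" "(fst (q z), \<sigma> z) \<in> u_zero_set n l V S" "y = phase_map A f (fst (q z), \<sigma> z)"
    unfolding critical_param by auto
  then show "y \<in> \<Sigma> \<inter> q ` B" using critical_zero_iff phase_map_param by auto
next
  fix y assume "y \<in> \<Sigma> \<inter> q ` B"
  then obtain z where "z \<in> B" "y = q z" "q z \<in> \<Sigma>" by auto
  then show "y \<in> phase_map A f ` (critical_set N V S f \<inter> u_zero_set n l V S)"
    using critical_zero_iff phase_map_param unfolding critical_param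
    by (intro image_eqI[of _ _ "(fst (q z), \<sigma> z)"]) auto
qed

text \<open>The curve is the image of \<open>z + t w\<close> under the parametrization of the
  critical set. Its \<open>x\<close>-velocity is left unnamed, since the free
  \<open>x\<close>-directions of \<open>u = 0\<close> can absorb it.\<close>

lemma tangent_critical:
  assumes d: "d \<in> A" and z: "z \<in> B" "fst (q z) \<in> fst d"
  shows "\<exists>v. (v, \<lambda>j. if j < n then w \<bullet> b j else if j < N then frechet_derivative \<psi> (at z) w \<bullet> b (j - n) else 0)
    \<in> tangent_vectors_param d (critical_set N V S f) (fst (q z), \<sigma> z)"
proof -
  let ?\<tau> = "transition c d"
  \<comment> \<open>On \<open>W\<close> the base point of \<open>q y\<close> remains in the chart
    \<open>d\<close>.\<close>
  define W where "W = {y \<in> B. a y \<in> snd c ` (V \<inter> fst d)}"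
  have Wo: "open W"
    unfolding W_def
    using continuous_open_preimage[OF smooth_on_continuous[OF a] B overlap_open[OF c chart_open[OF d]]]
    by (simp add: vimage_def Int_def)
  have zW: "z \<in> W" using z base_q[OF z(1)] unfolding W_def by (metis (mono_tags, lifting) IntI imageI mem_Collect_eq)
  obtain e :: real where e: "e > 0" "\<And>t. t \<in> {-e<..<e} \<Longrightarrow> z + t *\<^sub>R w \<in> W"
    using line_in_open[OF Wo zW] by metis
  have along: "smooth_on {-e<..<e} (\<lambda>t. g (z + t *\<^sub>R w)) \<and>
      ((\<lambda>t. g (z + t *\<^sub>R w)) has_vector_derivative frechet_derivative g (at z) w) (at 0)"
    if g: "smooth_on W g" for g :: "'e \<Rightarrow> 'w::real_normed_vector"
  proof
    show "smooth_on {-e<..<e} (\<lambda>t. g (z + t *\<^sub>R w))"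
      by (rule smooth_on_compose[OF _ smooth_on_affine g]) (use e in auto)
    have "((\<lambda>t::real. z + t *\<^sub>R w) has_derivative (\<lambda>t. t *\<^sub>R w)) (at 0)"
      by (auto intro!: derivative_eq_intros)
    moreover have "(g has_derivative frechet_derivative g (at z)) (at (z + 0 *\<^sub>R w))"
      using smooth_on_has_derivative[OF g zW] by simp
    ultimately have "((\<lambda>t. g (z + t *\<^sub>R w)) has_derivative (\<lambda>t. frechet_derivative g (at z) (t *\<^sub>R w))) (at 0)"
      by (rule has_derivative_compose)
    then show "((\<lambda>t. g (z + t *\<^sub>R w)) has_vector_derivative frechet_derivative g (at z) w) (at 0)"
      by (simp add: has_vector_derivative_def linear_cmul[OF smooth_on_linear_derivative[OF g zW]])
  qed
  have WB: "W \<subseteq> B" by (auto simp: W_def)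
  have base: "fst (q y) \<in> fst d" if "y \<in> W" for y
    using that base_q_inv[of y] c by (auto simp: W_def)
  have "smooth_on W (\<lambda>y. ?\<tau> (a y))"
    by (rule smooth_on_compose[OF Wo smooth_on_subset[OF a WB] transition_smooth[OF c d]]) (auto simp: W_def)
  then have sq: "smooth_on W (\<lambda>y. snd d (fst (q y)))"
    by (rule smooth_on_cong[OF Wo, THEN iffD1, rotated]) (use WB base_q_inv in auto)
  define \<delta> where "\<delta> = (\<lambda>j. if j < n then w \<bullet> b j else if j < N then frechet_derivative \<psi> (at z) w \<bullet> b (j - n) else 0)"
  have s\<sigma>: "smooth_on W (\<lambda>y. \<sigma> y j)" "frechet_derivative (\<lambda>y. \<sigma> y j) (at z) w = \<delta> j" for j
  proof -
    have \<psi>W: "smooth_on W \<psi>" by (rule smooth_on_subset[OF \<psi> WB])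
    show "smooth_on W (\<lambda>y. \<sigma> y j)"
      unfolding \<sigma>_def by (cases "j < n"; cases "j < N") (auto intro!: smooth_intros Wo \<psi>W)
    have "((\<lambda>y. y \<bullet> b j) has_derivative (\<lambda>w. w \<bullet> b j)) (at z)"
      "((\<lambda>y. \<psi> y \<bullet> b (j - n)) has_derivative (\<lambda>w. frechet_derivative \<psi> (at z) w \<bullet> b (j - n))) (at z)"
      by (rule has_derivative_inner_left, rule has_derivative_ident,
          rule has_derivative_inner_left, rule smooth_on_has_derivative[OF \<psi>W zW])
    then show "frechet_derivative (\<lambda>y. \<sigma> y j) (at z) w = \<delta> j"
      unfolding \<sigma>_def \<delta>_def by (cases "j < n"; cases "j < N") (simp_all add: frechet_derivative_eq)
  qed
  have "(frechet_derivative (\<lambda>y. snd d (fst (q y))) (at z) w, \<delta>)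
      \<in> tangent_vectors_param d (critical_set N V S f) (fst (q z), \<sigma> z)"
  proof (rule tangent_vectors_paramI[where \<epsilon> = e and \<gamma> = "\<lambda>t. fst (q (z + t *\<^sub>R w))" and \<sigma> = "\<lambda>t. \<sigma> (z + t *\<^sub>R w)"])
    show "((\<lambda>t. \<sigma> (z + t *\<^sub>R w) j) has_vector_derivative \<delta> j) (at 0)" for j
      using along[OF s\<sigma>(1)] s\<sigma>(2) by metis
    show "fst (q (z + t *\<^sub>R w)) \<in> fst d \<and> (fst (q (z + t *\<^sub>R w)), \<sigma> (z + t *\<^sub>R w)) \<in> critical_set N V S f"
      if "t \<in> {-e<..<e}" for t
      using base[OF e(2)[OF that]] WB e(2)[OF that] unfolding critical_param by blast
  qed (use e(1) along[OF sq] along[OF s\<sigma>(1)] in auto)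
  then show ?thesis unfolding \<delta>_def by blast
qed

text \<open>\<open>u = 0\<close> is a linear condition, so a straight line in the chart
  \<open>d\<close> that starts in this direction stays in the set for a short time.\<close>

lemma tangent_u_zero:
  assumes d: "d \<in> A" and z: "(x, s) \<in> u_zero_set n l V S" "x \<in> fst d"
    and v: "v \<in> UNIV \<times> topspace (Euclidean_space N)" "\<And>j. n \<le> j \<Longrightarrow> j < N \<Longrightarrow> snd v j = 0"
  shows "v \<in> tangent_vectors_param d (u_zero_set n l V S) (x, s)"
proof -
  have x: "x \<in> V" "s \<in> S" "\<And>j. n \<le> j \<Longrightarrow> j < N \<Longrightarrow> s j = 0" using z by (auto simp: u_zero_set_def)
  obtain e :: real where e: "e > 0" "\<And>t. t \<in> {-e<..<e} \<Longrightarrow> line (snd d x, s) v t \<in> dom_in_chart d V S"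
    using line_in_domE[OF d z(2) x(1,2) v(1)] by metis
  have dom: "snd d x + t *\<^sub>R fst v \<in> ov d" "(\<lambda>j. s j + t * snd v j) \<in> S" if "t \<in> {-e<..<e}" for t
    using e(2)[OF that] by (auto simp: line_def dom_in_chart_def)
  have inv: "snd d (chart_inv d (snd d x + t *\<^sub>R fst v)) = snd d x + t *\<^sub>R fst v"
    "chart_inv d (snd d x + t *\<^sub>R fst v) \<in> fst d \<inter> V" if "t \<in> {-e<..<e}" for t
    using ov_inv[OF d dom(1)[OF that]] by auto
  have D: "((\<lambda>t. snd d x + t *\<^sub>R fst v) has_vector_derivative fst v) (at 0)"
    by (auto intro!: derivative_eq_intros)
  have "(fst v, snd v) \<in> tangent_vectors_param d (u_zero_set n l V S) (x, s)"
  proof (rule tangent_vectors_paramI[where \<epsilon> = e and \<gamma> = "\<lambda>t. chart_inv d (snd d x + t *\<^sub>R fst v)"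
        and \<sigma> = "\<lambda>t j. s j + t * snd v j"])
    show "smooth_on {-e<..<e} (\<lambda>t. snd d (chart_inv d (snd d x + t *\<^sub>R fst v)))"
      by (rule smooth_on_cong[THEN iffD2, OF _ _ smooth_on_affine[of _ "snd d x" "fst v"]]) (auto simp: inv)
    show "((\<lambda>t. snd d (chart_inv d (snd d x + t *\<^sub>R fst v))) has_vector_derivative fst v) (at 0)"
      by (rule has_vector_derivative_transform_within_open[OF D, of "{-e<..<e}"]) (use e inv in auto)
    show "((\<lambda>t. s j + t * snd v j) has_vector_derivative snd v j) (at 0)" for j
      by (auto intro!: derivative_eq_intros simp: has_real_derivative_iff_has_vector_derivative[symmetric])
    show "smooth_on {-e<..<e} (\<lambda>t. s j + t * snd v j)" for j
      using smooth_on_affine[of "{-e<..<e}" "s j" "snd v j"] by simp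
  qed (use e(1) z d inv dom v(2) x in \<open>auto simp: u_zero_set_def\<close>)
  then show ?thesis by simp
qed

text \<open>The tangent vectors of \<open>u = 0\<close> cover all directions in \<open>x\<close> and
  \<open>z\<close>, so a tangent vector of the critical set has only to match the
  \<open>u\<close>-component of \<open>v\<close>.\<close>

lemma transverse_critical: "transverse A N (critical_set N V S f) (u_zero_set n l V S)"
  unfolding transverse_def
proof (intro ballI impI)
  fix y d v
  assume y: "y \<in> critical_set N V S f \<inter> u_zero_set n l V S" and d: "d \<in> A" "fst y \<in> fst d"
    and v: "v \<in> (UNIV :: 'e set) \<times> topspace (Euclidean_space N)"
  obtain z where z: "z \<in> B" "y = (fst (q z), \<sigma> z)" using y critical_param by auto
  then have "q z \<in> \<Sigma>" using y critical_zero_iff by auto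
  \<comment> \<open>Matching the \<open>u\<close>-component is a single equation in
    \<open>'e\<close> because \<open>U\<close> pads with zeros; it is solvable by surjectivity at
    points of \<open>\<Sigma>\<close>.\<close>
  then obtain w where w: "frechet_derivative \<psi> (at z) w = U (snd v)"
    using \<Sigma>_surj[OF z(1)] by (metis surjD)
  define \<delta> where "\<delta> = (\<lambda>j. if j < n then w \<bullet> b j else if j < N then frechet_derivative \<psi> (at z) w \<bullet> b (j - n) else 0)"
  obtain v1 where v1: "(v1, \<delta>) \<in> tangent_vectors_param d (critical_set N V S f) y"
    using tangent_critical[OF d(1) z(1), of w] d(2) z(2) unfolding \<delta>_def by auto
  have "snd v j - \<delta> j = 0" if "n \<le> j" "j < N" for j
    using that U_inner[of "j - n" "snd v"] w by (simp add: \<delta>_def)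
  then have "(fst v - v1, \<lambda>j. snd v j - \<delta> j) \<in> tangent_vectors_param d (u_zero_set n l V S) y"
    unfolding z(2) using y d v z(2)
    by (intro tangent_u_zero) (auto simp: topspace_Euclidean_space \<delta>_def)
  then show "\<exists>\<alpha>\<in>tangent_vectors_param d (critical_set N V S f) y.
      \<exists>\<beta>\<in>tangent_vectors_param d (u_zero_set n l V S) y.
        fst v = fst \<alpha> + fst \<beta> \<and> (\<forall>j. snd v j = snd \<alpha> j + snd \<beta> j)"
    using v1 by (intro bexI[of _ "(v1, \<delta>)"] bexI[of _ "(fst v - v1, \<lambda>j. snd v j - \<delta> j)"]) auto
qed

lemma phase_exists:
  "\<exists>N K l V S f. N = K + l \<and> openin X V \<and> openin (Euclidean_space N) S \<and>
    nondegenerate_phase_function X A N V S f (q ` B) \<and>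
    transverse A N (critical_set N V S f) (u_zero_set K l V S) \<and>
    phase_map A f ` (critical_set N V S f \<inter> u_zero_set K l V S) = \<Sigma> \<inter> q ` B"
  using chart_open[OF c] openin_S nondegenerate transverse_critical phase_map_zero by blast

end

section \<open>Local and global existence\<close>

context smooth_mfd
begin

text \<open>At a point of \<open>\<Sigma>\<close> the adapted coordinates provide the equations;
  elsewhere \<open>sep\<close> gives a neighbourhood free of \<open>\<Sigma>\<close>, on which an
  equation without solutions is used.\<close>

lemma local_phase_function:
  assumes lag: "lagrangian_submanifold X A \<Lambda>" and \<Sigma>: "\<Sigma> \<subseteq> \<Lambda>" "submanifold TX TA k \<Sigma>"
    and p: "p \<in> \<Lambda>" and sep: "p \<notin> \<Sigma> \<Longrightarrow> \<exists>W. openin TX W \<and> p \<in> W \<and> W \<inter> \<Sigma> = {}"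
  shows "\<exists>\<Gamma>. p \<in> \<Gamma> \<and> openin (subtopology TX \<Lambda>) \<Gamma> \<and>
    (\<exists>N K l V S f. N = K + l \<and> openin X V \<and> openin (Euclidean_space N) S \<and>
      nondegenerate_phase_function X A N V S f \<Gamma> \<and>
      transverse A N (critical_set N V S f) (u_zero_set K l V S) \<and>
      phase_map A f ` (critical_set N V S f \<inter> u_zero_set K l V S) = \<Sigma> \<inter> \<Gamma>)"
    (is "\<exists>\<Gamma>. p \<in> \<Gamma> \<and> _ \<and> ?phase \<Gamma>")
proof -
  have "p \<in> topspace TX"
    using lag p unfolding lagrangian_submanifold_def submanifold_def by blast
  then obtain c where c: "c \<in> A" "p \<in> fst (TC c)" by (rule chart_around)
  obtain B s a q z0 where graph: "lagrangian_graph c \<Lambda> B s a q" and z0: "z0 \<in> B" "q z0 = p"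
    and sym: "\<And>z v w. z \<in> B \<Longrightarrow> frechet_derivative a (at z) v \<bullet> w = frechet_derivative a (at z) w \<bullet> v"
    using lagrangian_local_form[OF lag p c] by metis
  obtain b :: "nat \<Rightarrow> 'e" where b: "bij_betw b {..<DIM('e)} Basis"
    using ex_bij_betw_nat_finite[OF finite_Basis] by (metis lessThan_atLeast0)
  have "\<exists>B' l \<psi>. open B' \<and> z0 \<in> B' \<and> B' \<subseteq> B \<and> l \<le> DIM('e) \<and> smooth_on B' \<psi> \<and>
    (\<forall>z\<in>B'. (q z \<in> \<Sigma> \<longleftrightarrow> (\<forall>i<l. \<psi> z \<bullet> b i = 0)) \<and> (q z \<in> \<Sigma> \<longrightarrow> surj (frechet_derivative \<psi> (at z))))"
  proof (cases "p \<in> \<Sigma>")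
    case True
    then have q0: "q z0 \<in> \<Sigma>" using z0(2) by simp
    show ?thesis
    proof (rule adapted_coordinates[OF graph c(1) z0(1) q0 \<Sigma> b])
      fix B' l and \<psi> :: "'e \<Rightarrow> 'e"
      assume "open B'" "z0 \<in> B'" "B' \<subseteq> B" "l \<le> DIM('e)" "smooth_on B' \<psi>"
        "\<And>z. z \<in> B' \<Longrightarrow> bij (frechet_derivative \<psi> (at z))"
        "\<And>z. z \<in> B' \<Longrightarrow> q z \<in> \<Sigma> \<longleftrightarrow> (\<forall>i<l. \<psi> z \<bullet> b i = 0)"
      then show ?thesis
        by (intro exI[of _ B'] exI[of _ l] exI[of _ \<psi>]) (auto simp: bij_is_surj)
    qed
  next
    case False
    then obtain W where W: "openin TX W" "p \<in> W" "W \<inter> \<Sigma> = {}" using sep by blast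
    define B' where "B' = {z \<in> B. q z \<in> W}"
    have "openin (top_of_set B) B'"
      using graph openin_continuous_map_preimage[of "top_of_set B" TX q W] W(1)
      unfolding lagrangian_graph_def B'_def by simp
    then have "open B'" using graph openin_open_trans unfolding lagrangian_graph_def by blast
    \<comment> \<open>With \<open>l = 1\<close> and the constant map \<open>\<psi> = b 0\<close>,
      the equation \<open>\<psi> z \<bullet> b 0 = 0\<close> reads 1 = 0. So \<open>u = 0\<close>
      will miss the critical set, and the surjectivity condition is vacuous.\<close>
    moreover have "b 0 \<in> Basis" using b by (auto simp: bij_betw_def)
    ultimately show ?thesis using W z0
      by (intro exI[of _ B'] exI[of _ 1] exI[of _ "\<lambda>_. b 0"])
        (auto simp: B'_def smooth_on_const Suc_le_eq)
  qed
  then obtain B' l \<psi> where B': "open B'" "z0 \<in> B'" "B' \<subseteq> B" and l: "l \<le> DIM('e)" and \<psi>: "smooth_on B' \<psi>"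
    and \<Sigma>_iff: "\<And>z. z \<in> B' \<Longrightarrow> q z \<in> \<Sigma> \<longleftrightarrow> (\<forall>i<l. \<psi> z \<bullet> b i = 0)"
    and \<Sigma>_surj: "\<And>z. z \<in> B' \<Longrightarrow> q z \<in> \<Sigma> \<Longrightarrow> surj (frechet_derivative \<psi> (at z))"
    by blast
  \<comment> \<open>The potential \<open>h\<close> is obtained by integrating along rays from
    \<open>z0\<close>, hence the restriction to a ball.\<close>
  obtain r where r: "r > 0" "ball z0 r \<subseteq> B'" using B' open_contains_ball by blast
  have graph': "lagrangian_graph c \<Lambda> (ball z0 r) s a q"
    using lagrangian_graph_subset[OF graph open_ball] r(2) B'(3) by blast
  then have a: "smooth_on (ball z0 r) a" by (simp add: lagrangian_graph_def)
  have "frechet_derivative a (at z) v \<bullet> w = frechet_derivative a (at z) w \<bullet> v" if "z \<in> ball z0 r" for z v w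
    using sym that r(2) B'(3) by blast
  then obtain h where h: "\<And>z. z \<in> ball z0 r \<Longrightarrow> (h has_derivative (\<lambda>v. a z \<bullet> v)) (at z)"
    using closed_one_form_exact[OF a] by metis
  interpret phase_construction X A c \<Lambda> \<Sigma> "ball z0 r" s a q h \<psi> "DIM('e)" l b
  proof unfold_locales
    show "smooth_on (ball z0 r) \<psi>" using smooth_on_subset[OF \<psi> r(2)] .
  qed (use c graph' h b l \<Sigma>_iff \<Sigma>_surj r(2) in auto)
  have "openin (subtopology TX \<Lambda>) (q ` ball z0 r)"
    using graph' unfolding lagrangian_graph_def by blast
  moreover have "p \<in> q ` ball z0 r" using z0(2) r(1) by (metis centre_in_ball imageI)
  ultimately show ?thesis by (intro exI[of _ "q ` ball z0 r"] conjI phase_exists)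
qed

end

theorem proposition2p3:
  fixes X :: "'a topology"
    and A :: "('a, 'e::euclidean_space) chart set"
    and \<Sigma> \<Lambda> :: "('a, 'e) covector set"
  assumes "smooth_manifold X A"
    and "framed_isotropic X A \<Sigma> \<Lambda>"
  shows "\<exists>\<Lambda>'. openin (subtopology (cotangent_topology X A) \<Lambda>) \<Lambda>' \<and> \<Sigma> \<subseteq> \<Lambda>' \<and>
     (closedin (subtopology (cotangent_topology X A) \<Lambda>) \<Sigma> \<longrightarrow> \<Lambda>' = \<Lambda>) \<and>
     (\<exists>\<G>. \<Union>\<G> = \<Lambda>' \<and>
       (\<forall>\<Gamma>\<in>\<G>. openin (subtopology (cotangent_topology X A) \<Lambda>) \<Gamma> \<and>
         (\<exists>N K l V S f. N = K + l \<and> openin X V \<and> openin (Euclidean_space N) S \<and>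
            nondegenerate_phase_function X A N V S f \<Gamma> \<and>
            transverse A N (critical_set N V S f) (u_zero_set K l V S) \<and>
            phase_map A f ` (critical_set N V S f \<inter> u_zero_set K l V S) = \<Sigma> \<inter> \<Gamma>)))"
proof -
  interpret smooth_mfd X A by unfold_locales (rule assms(1))
  let ?T\<Lambda> = "subtopology TX \<Lambda>"
  define phase where "phase \<Gamma> \<longleftrightarrow> (\<exists>N K l V S f. N = K + l \<and> openin X V \<and> openin (Euclidean_space N) S \<and>
      nondegenerate_phase_function X A N V S f \<Gamma> \<and>
      transverse A N (critical_set N V S f) (u_zero_set K l V S) \<and>
      phase_map A f ` (critical_set N V S f \<inter> u_zero_set K l V S) = \<Sigma> \<inter> \<Gamma>)" for \<Gamma>
  obtain k where lag: "lagrangian_submanifold X A \<Lambda>" and \<Sigma>: "\<Sigma> \<subseteq> \<Lambda>" "submanifold TX TA k \<Sigma>"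
    using assms(2) unfolding framed_isotropic_def by blast
  note local = local_phase_function[OF lag \<Sigma>, folded phase_def]
  let ?G = "{\<Gamma>. openin ?T\<Lambda> \<Gamma> \<and> phase \<Gamma>}"
  have "openin ?T\<Lambda> (\<Union>?G)" by (rule openin_Union) blast
  moreover have "\<Sigma> \<subseteq> \<Union>?G" using local \<Sigma>(1) by blast
  moreover have "\<Union>?G = \<Lambda>" if closed: "closedin ?T\<Lambda> \<Sigma>"
  proof
    show "\<Union>?G \<subseteq> \<Lambda>" using openin_subset by fastforce
    have "\<Lambda> \<subseteq> topspace TX"
      using lag unfolding lagrangian_submanifold_def submanifold_def by blast
    then have "openin ?T\<Lambda> (\<Lambda> - \<Sigma>)"
      using closed by (simp add: closedin_def inf.absorb2)
    then obtain W where W: "openin TX W" "\<Lambda> - \<Sigma> = W \<inter> \<Lambda>"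
      unfolding openin_subtopology by blast
    then have "W \<inter> \<Sigma> = {}" using \<Sigma>(1) by blast
    with W have "\<exists>W. openin TX W \<and> p \<in> W \<and> W \<inter> \<Sigma> = {}" if "p \<in> \<Lambda>" "p \<notin> \<Sigma>" for p
      using that by blast
    then show "\<Lambda> \<subseteq> \<Union>?G" using local by blast
  qed
  ultimately show ?thesis
    unfolding phase_def[symmetric]
    by (intro exI[of _ "\<Union>?G"] conjI impI exI[of _ ?G]) auto
qed

end
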